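(* Let $V:[0,T]\times L^2_\mu(\mathbb{R}^d)\to\mathcal{V}^{\mathrm{as}}(D)$ be continuous in time and satisfy, for constants $C_V,L_V>0$, $$\sup_{t\in[0,T]}\sup_{r\in L^2_\mu(\mathbb{R}^d)}\sup_{x\in\mathbb{R}^d}\int_{\mathbb{R}^d\setminus\{x\}}|V_t[r](x,x')|^2\,d\mu(x')\le C_V$$ and, for all $t\in[0,T]$ and all $g,\tilde g\in L^2_\mu(\mathbb{R}^d)$, $$\sup_{x\in\mathbb{R}^d}\int_{\mathbb{R}^d\setminus\{x\}}|V_t[g](x,x')-V_t[\tilde g](x,x')|^2\,d\mu(x')\le L_V\|g-\tilde g\|^2_{L^2_\mu(\mathbb{R}^d)} .$$ Let $(r,\eta)$ be the solution of the Euler Co-NCL system with initial datum $(r_0,\eta_0)\in L^2_\mu(\mathbb{R}^d)\times C_b(D)$. Then there is a constant $C(T)$, depending on $T$ and on the fixed data but not on $\sigma^1,\sigma^2$, such that whenever $\sigma^i\in C([0,T],\mathcal{P}_2^\mu(\mathbb{R}\times\mathbb{R}^d))$, $i=1,2$, are the solutions of the corresponding graph continuity equation with initial conditions $\tilde\sigma^i_0\in\mathcal{P}_2^\mu(\mathbb{R}\times\mathbb{R}^d)$, $$\sup_{t\in[0,T]}L^2_\mu d_2(\sigma^1_t,\sigma^2_t)\le\sqrt2\,e^{C(T)}\,L^2_\mu d_2(\tilde\sigma^1_0,\tilde\sigma^2_0).$$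
   Context: Fix $T>0$, $d\ge1$ and a Borel probability measure $\mu$ on $\mathbb{R}^d$ with finite second moment. Let $D:=\{(x,y)\in\mathbb{R}^d\times\mathbb{R}^d: x\ne y\}$; $C_b(D)$ is the space of bounded continuous real functions on $D$ with the supremum norm; $\mathcal{V}^{\mathrm{as}}(D):=\{v:D\to\mathbb{R}: v(x,y)=-v(y,x)\}$. A function $h$ on $D$ is symmetric if $h(x,y)=h(y,x)$. A measurable $\Phi:\mathbb{R}^3\to\mathbb{R}$ is an admissible flux interpolation if: (i) $\Phi(0,0;v)=\Phi(a,b;0)=0$; (ii) for some $L_\Phi>0$ and all real $a,b,c,d,v,w$: $|\Phi(a,b;w)-\Phi(a,b;v)|\le L_\Phi(|a|+|b|)|w-v|$ and $|\Phi(a,b;v)-\Phi(c,d;v)|\le L_\Phi(|a-c|+|b-d|)|v|$; (iii) $\Phi(\alpha a,\alpha b;w)=\alpha\Phi(a,b;w)$ for all $\alpha>0$. It is jointly antisymmetric if $\Phi(a,b;-v)=-\Phi(b,a;v)$. Standing data: $\Phi$ is a jointly antisymmetric admissible flux interpolation; $\eta_0$ is symmetric; $\omega:[0,T]\times L^2_\mu(\mathbb{R}^d)\times D\to\mathbb{R}$ is such that $\omega_t[r](\cdot,\cdot)$ is continuous and symmetric on $D$, $t\mapsto\omega_t$ is in $L^1([0,T])$, $|\omega_t[r](x,y)-\omega_t[\tilde r](x,y)|\le L_\omega\|r-\tilde r\|_{L^2_\mu}$ and $|\omega_t[r](x,y)|\le C_\omega$ uniformly in $t$, $(x,y)$, $r,\tilde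 r$. Along a curve $t\mapsto r_t$, $V_t[r]$ and $\omega_t[r]$ mean $V_t[r_t]$ and $\omega_t[r_t]$. $V,\omega$ are understood to be measurable so that all integrals make sense. "$V$ continuous in time" means $t\mapsto V_t[r](x,y)$ is continuous. The solution $(r,\eta)$ of the Euler Co-NCL system is the pair $r\in AC([0,T],L^2_\mu(\mathbb{R}^d))$, $\eta\in AC([0,T],C_b(D))$ (absolutely continuous curves), unique under these assumptions, such that for $\mu$-a.e. $x$, all $t\in[0,T]$, all $(x,y)\in D$, $$r_t(x)=r_0(x)-\int_0^t\int_{\mathbb{R}^d\setminus\{x\}}\Phi(r_s(x),r_s(y);V_s[r](x,y))\eta_s(x,y)\,d\mu(y)\,ds,\quad \eta_t(x,y)=\eta_0(x,y)+\int_0^t(\omega_s[r](x,y)-\eta_s(x,y))\,ds,$$ with time-integrable integrands. $\mathcal{P}_2^\mu(\mathbb{R}\times\mathbb{R}^d)$ is the set of Borel probability measures on $\mathbb{R}\times\mathbb{R}^d$ with finite second moment and marginal $\mu$ on $\mathbb{R}^d$. For $\nu$ in it, $\nu=\int\nu_x\,d\mu(x)$ is its disintegration with respect to $\mu$, $\nu_x\in\mathcal{P}(\mathbb{R})$. It carries the metric $L^2_\mu d_2(\nu^1,\nu^2)=\left(\int_{\mathbb{R}^d}d_2^2(\nu^1_x,\nu^2_x)\,d\mu(x)\right)^{1/2}$, $d_2$ the 2-Wasserstein distance on $\mathbb{R}$; continuity of curves is with respect to it. For a curve $\sigma$ put $\mathcal{X}[\sigma,r,\eta](t,\xi,x):=-\int_{\mathbb{R}\times(\mathbb{R}^d\setminus\{x\})}\Phi(\xi,\xi';V_t[r](x,x'))\eta_t(x,x')\,d\sigma_t(\xi',x')$.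 The graph continuity equation is $\partial_t\sigma+\partial_\xi(\sigma\,\mathcal{X}[\sigma,r,\eta])=0$; a curve $\sigma$ is a solution with initial datum $\sigma_0$ if for every $\varphi\in C_c^1([0,T]\times\mathbb{R}\times\mathbb{R}^d)$ $$\int_0^T\!\!\int\partial_t\varphi\,d\sigma_t\,dt+\int\varphi(0,\cdot)\,d\sigma_0-\int\varphi(T,\cdot)\,d\sigma_T=\int_0^T\!\!\int_{\mathbb{R}\times\mathbb{R}^d}\int_{\mathbb{R}\times(\mathbb{R}^d\setminus\{x\})}\partial_\xi\varphi(t,\xi,x)\,\Phi(\xi,\xi';V_t[r](x,x'))\eta_t(x,x')\,d\sigma_t(\xi',x')\,d\sigma_t(\xi,x)\,dt .$$ Under these assumptions such a solution in $C([0,T],\mathcal{P}_2^\mu(\mathbb{R}\times\mathbb{R}^d))$ exists and is unique for each initial datum in $\mathcal{P}_2^\mu(\mathbb{R}\times\mathbb{R}^d)$. *)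

theory Defs
  imports "HOL-Probability.Probability"
begin

section \<open>Function spaces\<close>

text \<open>Functions on the off-diagonal set are represented by total curried functions; their values on
  the diagonal are never used.\<close>

definition offdiag :: "('a \<times> 'a) set" where
  "offdiag = {(x, y). x \<noteq> y}"

text \<open>Elements of \<open>L\<^sup>2\<^sub>\<mu>\<close> are represented by functions.  A map defined on \<open>L\<^sup>2\<^sub>\<mu>\<close> is
  therefore a map on representatives that does not distinguish \<open>\<mu>\<close>-a.e. equal ones.\<close>

definition L2 :: "'a measure \<Rightarrow> ('a \<Rightarrow> real) set" where
  "L2 \<mu> = {f \<in> borel_measurable \<mu>. integrable \<mu> (\<lambda>x. (f x)\<^sup>2)}"

definition L2_dist :: "'a measure \<Rightarrow> ('a \<Rightarrow> real) \<Rightarrow> ('a \<Rightarrow> real) \<Rightarrow> real" where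
  "L2_dist \<mu> f g = sqrt (LINT x|\<mu>. (f x - g x)\<^sup>2)"

definition respects_AE :: "'a measure \<Rightarrow> real \<Rightarrow>
    (real \<Rightarrow> ('a \<Rightarrow> real) \<Rightarrow> 'a \<Rightarrow> 'a \<Rightarrow> real) \<Rightarrow> bool" where
  "respects_AE \<mu> T W \<longleftrightarrow>
     (\<forall>t\<in>{0..T}. \<forall>g\<in>L2 \<mu>. \<forall>h\<in>L2 \<mu>. (AE x in \<mu>. g x = h x) \<longrightarrow>
        (\<forall>(x, y)\<in>offdiag. W t g x y = W t h x y))"

definition Cb_offdiag :: "('a::topological_space \<Rightarrow> 'a \<Rightarrow> real) set" where
  "Cb_offdiag = {f. continuous_on offdiag (\<lambda>(x, y). f x y) \<and>
                    bounded ((\<lambda>(x, y). f x y) ` offdiag)}"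

definition sup_dist :: "('a \<Rightarrow> 'a \<Rightarrow> real) \<Rightarrow> ('a \<Rightarrow> 'a \<Rightarrow> real) \<Rightarrow> real" where
  "sup_dist f g = (SUP (x, y)\<in>offdiag. \<bar>f x y - g x y\<bar>)"

definition symmetric_offdiag :: "('a \<Rightarrow> 'a \<Rightarrow> real) \<Rightarrow> bool" where
  "symmetric_offdiag h \<longleftrightarrow> (\<forall>(x, y)\<in>offdiag. h x y = h y x)"

definition antisymmetric_offdiag :: "('a \<Rightarrow> 'a \<Rightarrow> real) \<Rightarrow> bool" where
  "antisymmetric_offdiag v \<longleftrightarrow> (\<forall>(x, y)\<in>offdiag. v x y = - v y x)"

section \<open>Curves\<close>

definition continuous_curve :: "'b set \<Rightarrow> ('b \<Rightarrow> 'b \<Rightarrow> real) \<Rightarrow> real \<Rightarrow> (real \<Rightarrow> 'b) \<Rightarrow> bool" where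
  "continuous_curve X \<delta> T u \<longleftrightarrow>
     (\<forall>t\<in>{0..T}. u t \<in> X) \<and>
     (\<forall>t\<in>{0..T}. ((\<lambda>s. \<delta> (u s) (u t)) \<longlongrightarrow> 0) (at t within {0..T}))"

text \<open>Absolute continuity of curves in a metric space, as in Ambrosio, Gigli and Savare.\<close>

definition abs_cont_curve :: "'b set \<Rightarrow> ('b \<Rightarrow> 'b \<Rightarrow> real) \<Rightarrow> real \<Rightarrow> (real \<Rightarrow> 'b) \<Rightarrow> bool" where
  "abs_cont_curve X \<delta> T u \<longleftrightarrow>
     (\<forall>t\<in>{0..T}. u t \<in> X) \<and>
     (\<exists>m. set_integrable lborel {0..T} m \<and>
          (\<forall>s\<in>{0..T}. \<forall>t\<in>{s..T}. \<delta> (u s) (u t) \<le> (LBINT \<tau>:{s..t}. m \<tau>)))"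

text \<open>Measurability of a map \<open>W\<close> on \<open>[0,T] \<times> L\<^sup>2\<^sub>\<mu> \<times> D\<close>, in the form needed for integrals along
  curves \<open>r\<close> to make sense.  Constant curves give the measurability of
  \<open>(t, x, y) \<mapsto> W t g x y\<close> for fixed \<open>g\<close>.\<close>

definition measurable_along_curves :: "('a::topological_space) measure \<Rightarrow> real \<Rightarrow>
    (real \<Rightarrow> ('a \<Rightarrow> real) \<Rightarrow> 'a \<Rightarrow> 'a \<Rightarrow> real) \<Rightarrow> bool" where
  "measurable_along_curves \<mu> T W \<longleftrightarrow>
     (\<forall>r. continuous_curve (L2 \<mu>) (L2_dist \<mu>) T r \<longrightarrow>
        (\<lambda>(t, x, y). W t (r t) x y) \<in> borel_measurable (restrict_space borel ({0..T} \<times> offdiag)))"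

section \<open>Flux interpolations and the Euler Co-NCL system\<close>

definition admissible_flux :: "(real \<Rightarrow> real \<Rightarrow> real \<Rightarrow> real) \<Rightarrow> bool" where
  "admissible_flux \<Phi> \<longleftrightarrow>
     (\<lambda>(a, b, v). \<Phi> a b v) \<in> borel_measurable borel \<and>
     (\<forall>v. \<Phi> 0 0 v = 0) \<and> (\<forall>a b. \<Phi> a b 0 = 0) \<and>
     (\<exists>L>0. (\<forall>a b v w. \<bar>\<Phi> a b w - \<Phi> a b v\<bar> \<le> L * (\<bar>a\<bar> + \<bar>b\<bar>) * \<bar>w - v\<bar>) \<and>
            (\<forall>a b c d v. \<bar>\<Phi> a b v - \<Phi> c d v\<bar> \<le> L * (\<bar>a - c\<bar> + \<bar>b - d\<bar>) * \<bar>v\<bar>)) \<and>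
     (\<forall>\<alpha>>0. \<forall>a b w. \<Phi> (\<alpha> * a) (\<alpha> * b) w = \<alpha> * \<Phi> a b w)"

definition jointly_antisymmetric :: "(real \<Rightarrow> real \<Rightarrow> real \<Rightarrow> real) \<Rightarrow> bool" where
  "jointly_antisymmetric \<Phi> \<longleftrightarrow> (\<forall>a b v. \<Phi> a b (- v) = - \<Phi> b a v)"

definition euler_co_ncl_solution ::
  "real \<Rightarrow> 'a::topological_space measure \<Rightarrow> (real \<Rightarrow> real \<Rightarrow> real \<Rightarrow> real) \<Rightarrow>
   (real \<Rightarrow> ('a \<Rightarrow> real) \<Rightarrow> 'a \<Rightarrow> 'a \<Rightarrow> real) \<Rightarrow>
   (real \<Rightarrow> ('a \<Rightarrow> real) \<Rightarrow> 'a \<Rightarrow> 'a \<Rightarrow> real) \<Rightarrow>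
   ('a \<Rightarrow> real) \<Rightarrow> ('a \<Rightarrow> 'a \<Rightarrow> real) \<Rightarrow>
   (real \<Rightarrow> 'a \<Rightarrow> real) \<Rightarrow> (real \<Rightarrow> 'a \<Rightarrow> 'a \<Rightarrow> real) \<Rightarrow> bool" where
  "euler_co_ncl_solution T \<mu> \<Phi> V \<omega> r0 \<eta>0 r \<eta> \<longleftrightarrow>
     abs_cont_curve (L2 \<mu>) (L2_dist \<mu>) T r \<and>
     abs_cont_curve Cb_offdiag sup_dist T \<eta> \<and>
     (AE x in \<mu>.
        set_integrable lborel {0..T}
          (\<lambda>s. LINT y:-{x}|\<mu>. \<Phi> (r s x) (r s y) (V s (r s) x y) * \<eta> s x y) \<and>
        (\<forall>t\<in>{0..T}. r t x = r0 x -
           (LBINT s:{0..t}. LINT y:-{x}|\<mu>. \<Phi> (r s x) (r s y) (V s (r s) x y) * \<eta> s x y))) \<and>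
     (\<forall>(x, y)\<in>offdiag.
        set_integrable lborel {0..T} (\<lambda>s. \<omega> s (r s) x y - \<eta> s x y) \<and>
        (\<forall>t\<in>{0..T}. \<eta> t x y = \<eta>0 x y + (LBINT s:{0..t}. \<omega> s (r s) x y - \<eta> s x y)))"

section \<open>Measures with prescribed marginal and the fibred Wasserstein metric\<close>

definition P2_marginal :: "'a::euclidean_space measure \<Rightarrow> (real \<times> 'a) measure set" where
  "P2_marginal \<mu> = {\<nu>. sets \<nu> = sets borel \<and> prob_space \<nu> \<and>
     integrable \<nu> (\<lambda>z. (norm z)\<^sup>2) \<and> distr \<nu> borel snd = \<mu>}"

definition is_disintegration ::
  "'a::euclidean_space measure \<Rightarrow> (real \<times> 'a) measure \<Rightarrow> ('a \<Rightarrow> real measure) \<Rightarrow> bool" where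
  "is_disintegration \<mu> \<nu> \<kappa> \<longleftrightarrow>
     \<kappa> \<in> \<mu> \<rightarrow>\<^sub>M prob_algebra borel \<and>
     (\<forall>A\<in>sets borel. emeasure \<nu> A = (\<integral>\<^sup>+ x. emeasure (\<kappa> x) {\<xi>. (\<xi>, x) \<in> A} \<partial>\<mu>))"

text \<open>The disintegration exists for \<open>\<nu> \<in> P2_marginal \<mu>\<close> and is unique up to a \<open>\<mu>\<close>-null set; an
  arbitrary version is chosen.\<close>

definition disintegration ::
  "'a::euclidean_space measure \<Rightarrow> (real \<times> 'a) measure \<Rightarrow> 'a \<Rightarrow> real measure" where
  "disintegration \<mu> \<nu> = (SOME \<kappa>. is_disintegration \<mu> \<nu> \<kappa>)"

definition couplings :: "real measure \<Rightarrow> real measure \<Rightarrow> (real \<times> real) measure set" where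
  "couplings \<alpha> \<beta> = {\<pi>. sets \<pi> = sets borel \<and> distr \<pi> borel fst = \<alpha> \<and> distr \<pi> borel snd = \<beta>}"

text \<open>The square of the 2-Wasserstein distance on the real line, as an extended real: it may be
  infinite when the second moments are, which for the fibres of elements of \<open>P2_marginal \<mu>\<close> happens
  on a \<open>\<mu>\<close>-null set at most.\<close>

definition wasserstein2_sq :: "real measure \<Rightarrow> real measure \<Rightarrow> ennreal" where
  "wasserstein2_sq \<alpha> \<beta> = (INF \<pi>\<in>couplings \<alpha> \<beta>. \<integral>\<^sup>+ (\<xi>, \<zeta>). ennreal ((\<xi> - \<zeta>)\<^sup>2) \<partial>\<pi>)"

text \<open>For measures in \<open>P2_marginal \<mu>\<close> the integral is finite.\<close>

definition L2_d2 :: "'a::euclidean_space measure \<Rightarrow> (real \<times> 'a) measure \<Rightarrow> (real \<times> 'a) measure \<Rightarrow> real" where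
  "L2_d2 \<mu> \<nu>1 \<nu>2 =
     sqrt (enn2real (\<integral>\<^sup>+ x. wasserstein2_sq (disintegration \<mu> \<nu>1 x) (disintegration \<mu> \<nu>2 x) \<partial>\<mu>))"

section \<open>The graph continuity equation\<close>

text \<open>Test functions need not vanish at times \<open>0\<close> and \<open>T\<close>; there, time derivatives are one-sided.\<close>

definition C1c_test :: "real \<Rightarrow> (real \<times> real \<times> 'a::euclidean_space \<Rightarrow> real) set" where
  "C1c_test T = {\<phi>.
     (\<exists>\<phi>' :: real \<times> real \<times> 'a \<Rightarrow> (real \<times> real \<times> 'a) \<Rightarrow>\<^sub>L real.
        (\<forall>z\<in>{0..T} \<times> UNIV. (\<phi> has_derivative blinfun_apply (\<phi>' z)) (at z within {0..T} \<times> UNIV)) \<and>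
        continuous_on ({0..T} \<times> UNIV) \<phi>') \<and>
     compact (closure {z \<in> {0..T} \<times> UNIV. \<phi> z \<noteq> 0})}"

definition graph_ce_solution ::
  "real \<Rightarrow> 'a::euclidean_space measure \<Rightarrow> (real \<Rightarrow> real \<Rightarrow> real \<Rightarrow> real) \<Rightarrow>
   (real \<Rightarrow> ('a \<Rightarrow> real) \<Rightarrow> 'a \<Rightarrow> 'a \<Rightarrow> real) \<Rightarrow>
   (real \<Rightarrow> 'a \<Rightarrow> real) \<Rightarrow> (real \<Rightarrow> 'a \<Rightarrow> 'a \<Rightarrow> real) \<Rightarrow>
   (real \<times> 'a) measure \<Rightarrow> (real \<Rightarrow> (real \<times> 'a) measure) \<Rightarrow> bool" where
  "graph_ce_solution T \<mu> \<Phi> V r \<eta> \<sigma>0 \<sigma> \<longleftrightarrow>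
     continuous_curve (P2_marginal \<mu>) (L2_d2 \<mu>) T \<sigma> \<and> \<sigma> 0 = \<sigma>0 \<and>
     (\<forall>\<phi>\<in>C1c_test T.
        (LBINT t:{0..T}. LINT (\<xi>, x)|\<sigma> t.
            vector_derivative (\<lambda>s. \<phi> (s, \<xi>, x)) (at t within {0..T}))
        + (LINT (\<xi>, x)|\<sigma>0. \<phi> (0, \<xi>, x)) - (LINT (\<xi>, x)|\<sigma> T. \<phi> (T, \<xi>, x))
        = (LBINT t:{0..T}. LINT (\<xi>, x)|\<sigma> t.
             set_lebesgue_integral (\<sigma> t) (UNIV \<times> -{x}) (\<lambda>(\<xi>', x').
               deriv (\<lambda>\<zeta>. \<phi> (t, \<zeta>, x)) \<xi> * \<Phi> \<xi> \<xi>' (V t (r t) x x') * \<eta> t x x')))"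

end

theory Submission
  imports Defs
begin

text \<open>
  Fix a solution \<open>\<sigma>\<close>.  Its nonlocal velocity \<open>b(t,\<xi>,x)\<close> is Lipschitz in \<open>\<xi>\<close> and only
  measurable in \<open>t\<close> and \<open>x\<close>, so for fixed \<open>\<sigma>\<close> the equation is a family, indexed by \<open>x\<close>, of linear
  continuity equations on the line.  In one dimension such an equation conserves the mass on either
  side of a characteristic.  Hence a characteristic that starts at the \<open>u\<close>-quantile of the fibre
  \<open>\<sigma>\<^sub>0\<^sub>,\<^sub>x\<close> stays a \<open>u\<close>-quantile of \<open>\<sigma>\<^sub>t\<^sub>,\<^sub>x\<close>, and the fibres of \<open>\<sigma>\<^sub>t\<close> are the laws, under Lebesgue
  measure in \<open>u\<close>, of a flow \<open>Y\<^sub>t(u,x)\<close>.  The quantile coupling is optimal for the quadratic cost on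
  the line, so at time \<open>0\<close> the fibred distance of two solutions is exactly the \<open>L\<^sup>2\<close> distance of their
  flows, and at later times it is at most that.  The latter grows at most exponentially, at a rate
  that depends only on \<open>\<Phi>\<close>, \<open>C\<^sub>V\<close> and the bound of \<open>\<eta>\<close>.
\<close>

section \<open>Quantile functions and the Wasserstein distance on the line\<close>

text \<open>This shapes the proof: the class of test functions is enlarged step by step to
  \<theta>(\<xi> - h(x)) times the indicator of a Borel set in x, and the flow enters through
  difference quotients in time. Conservation of mass then comes from the Lipschitz bound: near a
  characteristic, a step of slope n acts over a width 1/n and sees a velocity difference of order
  1/n, so the product stays bounded and vanishes pointwise in the limit. Realising all fibres over
  one probability space replaces a measurable selection of optimal plans by the joint measurability
  of quantile functions; the disintegration itself is produced in this way. The growth estimate uses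
  suprema weighted by exp(-4 rate t), so that the L^2 distance need not be measurable in time. The
  resulting prefactor 3 becomes sqrt 2 by adding ln(3 / sqrt 2) to the exponent.\<close>

definition unit_lborel :: "real measure" where
  "unit_lborel = density lborel (indicator {0<..<1})"

lemma sets_unit_lborel [simp, measurable_cong]: "sets unit_lborel = sets borel"
  by (simp add: unit_lborel_def)

lemma space_unit_lborel [simp]: "space unit_lborel = UNIV"
  by (simp add: unit_lborel_def)

lemma emeasure_unit_lborel: "A \<in> sets borel \<Longrightarrow> emeasure unit_lborel A = emeasure lborel (A \<inter> {0<..<1})"
  by (simp add: unit_lborel_def emeasure_density Int_commute flip: indicator_inter_arith)

lemma prob_space_unit_lborel: "prob_space unit_lborel"
  by (rule prob_spaceI) (simp add: emeasure_unit_lborel)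

lemma AE_unit_lborel: "AE u in unit_lborel. 0 < u \<and> u < 1"
  unfolding unit_lborel_def by (subst AE_density) (auto simp: indicator_def)

lemma emeasure_unit_lborel_atMost: "0 \<le> c \<Longrightarrow> c \<le> 1 \<Longrightarrow> emeasure unit_lborel {..c} = ennreal c"
proof -
  assume c: "0 \<le> c" "c \<le> 1"
  have "emeasure unit_lborel {..c} = emeasure lborel ({..c} \<inter> {0<..<1})"
    by (simp add: emeasure_unit_lborel)
  also have "\<dots> = emeasure lborel {0<..<c}"
    using c AE_lborel_singleton[of c] by (intro emeasure_eq_AE) auto
  finally show ?thesis using c by simp
qed

lemma emeasure_unit_lborel_lessThan: "0 \<le> c \<Longrightarrow> c \<le> 1 \<Longrightarrow> emeasure unit_lborel {..<c} = ennreal c"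
proof -
  assume c: "0 \<le> c" "c \<le> 1"
  have "emeasure unit_lborel {..<c} = emeasure lborel ({..<c} \<inter> {0<..<1})"
    by (simp add: emeasure_unit_lborel)
  also have "{..<c} \<inter> {0<..<1} = {0<..<c}" using c by auto
  finally show ?thesis using c by simp
qed

lemma emeasure_unit_lborel_Ioc:
  "0 \<le> c \<Longrightarrow> c \<le> d \<Longrightarrow> d \<le> 1 \<Longrightarrow> emeasure unit_lborel {c<..d} = ennreal (d - c)"
proof -
  assume c: "0 \<le> c" "c \<le> d" "d \<le> 1"
  have "emeasure unit_lborel {c<..d} = emeasure lborel ({c<..d} \<inter> {0<..<1})"
    by (simp add: emeasure_unit_lborel)
  also have "\<dots> = emeasure lborel {c<..<d}"
    using c AE_lborel_singleton[of d] by (intro emeasure_eq_AE) auto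
  finally show ?thesis using c by simp
qed

text \<open>Left-continuous generalised inverse of the distribution function. Outside (0,1) the set
  may be empty or unbounded below, so a default is fixed there; it lives on a null set of
  \<open>unit_lborel\<close>.\<close>

definition quantile :: "real measure \<Rightarrow> real \<Rightarrow> real" where
  "quantile \<alpha> u = (if 0 < u \<and> u < 1 then Inf {x. u \<le> cdf \<alpha> x} else 0)"

text \<open>The infimum is attained because \<open>cdf\<close> is right-continuous, which gives this
  Galois connection. Later facts about quantiles are read off from it.\<close>

lemma quantile_le_iff:
  assumes "real_distribution \<alpha>" "0 < u" "u < 1"
  shows "quantile \<alpha> u \<le> x \<longleftrightarrow> u \<le> cdf \<alpha> x"
proof -
  interpret cdf_distribution \<alpha> using assms(1) by (simp add: cdf_distribution_def)
  show ?thesis using pseudoinverse[OF assms(2,3), of x] assms by (simp add: quantile_def)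
qed

text \<open>By the Galois connection the sublevel sets for u in (0,1) are given by u <=
  \<open>cdf (\<kappa> x) c\<close>, which is jointly measurable. Joint measurability in level and
  fibre is what allows one coupling to be chosen for all fibres at once.\<close>

lemma quantile_measurable_kernel:
  assumes \<kappa>: "\<kappa> \<in> M \<rightarrow>\<^sub>M prob_algebra borel"
  shows "(\<lambda>(u, x). quantile (\<kappa> x) u) \<in> borel_measurable (borel \<Otimes>\<^sub>M M)"
proof -
  have rd: "real_distribution (\<kappa> x)" if "x \<in> space M" for x
    using measurable_space[OF \<kappa> that]
    by (auto simp: space_prob_algebra real_distribution_def real_distribution_axioms_def
        dest: sets_eq_imp_space_eq)
  have *: "(\<lambda>x. cdf (\<kappa> x) c) \<in> borel_measurable M" for c
    unfolding cdf_def
    by (rule measure_measurable_prob_algebra2[OF _ \<kappa>]) (simp add: sets_Pair)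
  have "{z \<in> space (borel \<Otimes>\<^sub>M M). (case z of (u, x) \<Rightarrow> quantile (\<kappa> x) u) \<le> c}
      = {z \<in> space (borel \<Otimes>\<^sub>M M). if 0 < fst z \<and> fst z < 1 then fst z \<le> cdf (\<kappa> (snd z)) c else 0 \<le> c}"
    for c
  proof (intro Collect_cong conj_cong refl)
    fix z assume "z \<in> space ((borel :: real measure) \<Otimes>\<^sub>M M)"
    then have "real_distribution (\<kappa> (snd z))" using rd by (auto simp: space_pair_measure)
    from quantile_le_iff[OF this, of "fst z" c]
    show "((case z of (u, x) \<Rightarrow> quantile (\<kappa> x) u) \<le> c) =
       (if 0 < fst z \<and> fst z < 1 then fst z \<le> cdf (\<kappa> (snd z)) c else 0 \<le> c)"
      by (cases "0 < fst z \<and> fst z < 1") (auto simp: case_prod_beta quantile_def)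
  qed
  moreover have "{z \<in> space (borel \<Otimes>\<^sub>M M). if 0 < fst z \<and> fst z < 1 then fst z \<le> cdf (\<kappa> (snd z)) c else 0 \<le> c}
      \<in> sets (borel \<Otimes>\<^sub>M M)" for c
    using *[of c] by measurable
  ultimately show ?thesis
    by (subst borel_measurable_iff_le) auto
qed

lemma real_distribution_distr_unit:
  "q \<in> borel_measurable borel \<Longrightarrow> real_distribution (distr unit_lborel borel q)"
  by (simp add: real_distribution_def real_distribution_axioms_def
      prob_space.prob_space_distr[OF prob_space_unit_lborel] measurable_cong_sets[OF sets_unit_lborel refl])

lemma real_distribution_alt: "prob_space \<alpha> \<Longrightarrow> sets \<alpha> = sets borel \<Longrightarrow> real_distribution \<alpha>"
  by (auto simp: real_distribution_def real_distribution_axioms_def dest: sets_eq_imp_space_eq)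

text \<open>No monotonicity of \<open>q\<close> is assumed. With F the distribution function, the
  right-tail bound shows that q u <= c implies u <= F c, and the left-tail bound that u < F c
  implies q u <= c, so {q <= c} has mass F c. These two tail bounds are exactly what conservation of
  mass along characteristics will deliver.\<close>

lemma law_eq_if_quantile:
  assumes \<alpha>: "real_distribution \<alpha>" and q[measurable]: "q \<in> borel_measurable borel"
    and ae: "AE u in unit_lborel. measure \<alpha> {q u<..} \<le> 1 - u \<and> measure \<alpha> {..<q u} \<le> u"
  shows "\<alpha> = distr unit_lborel borel q"
proof (rule cdf_unique[OF \<alpha> real_distribution_distr_unit[OF q]])
  interpret real_distribution \<alpha> by fact
  show "cdf \<alpha> = cdf (distr unit_lborel borel q)"
  proof
    fix c
    have cb: "0 \<le> cdf \<alpha> c" "cdf \<alpha> c \<le> 1" by (auto simp: cdf_def)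
    have ae': "AE u in unit_lborel. (u < cdf \<alpha> c \<longrightarrow> q u \<le> c) \<and> (q u \<le> c \<longrightarrow> u \<le> cdf \<alpha> c)"
    proof (rule AE_mp[OF ae], rule AE_I2, intro impI conjI; elim conjE)
      fix u assume a: "measure \<alpha> {q u<..} \<le> 1 - u" "measure \<alpha> {..<q u} \<le> u"
      { assume u: "u < cdf \<alpha> c"
        show "q u \<le> c"
        proof (rule ccontr)
          assume "\<not> q u \<le> c"
          then have "cdf \<alpha> c \<le> measure \<alpha> {..<q u}"
            unfolding cdf_def by (intro finite_measure_mono) auto
          then show False using a u by simp
        qed }
      { assume "q u \<le> c"
        then have "measure \<alpha> {c<..} \<le> measure \<alpha> {q u<..}" by (intro finite_measure_mono) auto
        moreover have "measure \<alpha> {c<..} = 1 - cdf \<alpha> c"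
          using prob_compl[of "{..c}"] by (simp add: cdf_def Compl_eq_Diff_UNIV[symmetric])
        ultimately show "u \<le> cdf \<alpha> c" using a by simp }
    qed
    have "emeasure unit_lborel {u. q u \<le> c} = ennreal (cdf \<alpha> c)"
    proof (rule antisym)
      have "emeasure unit_lborel {u. q u \<le> c} \<le> emeasure unit_lborel {..cdf \<alpha> c}"
        using ae' by (intro emeasure_mono_AE) auto
      then show "emeasure unit_lborel {u. q u \<le> c} \<le> ennreal (cdf \<alpha> c)"
        using cb by (simp add: emeasure_unit_lborel_atMost)
      have "emeasure unit_lborel {..<cdf \<alpha> c} \<le> emeasure unit_lborel {u. q u \<le> c}"
        using ae' by (intro emeasure_mono_AE) auto
      then show "ennreal (cdf \<alpha> c) \<le> emeasure unit_lborel {u. q u \<le> c}"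
        using cb by (simp add: emeasure_unit_lborel_lessThan)
    qed
    then show "cdf \<alpha> c = cdf (distr unit_lborel borel q) c"
      using cb by (simp add: cdf_def measure_def emeasure_distr vimage_def measurable_cong_sets[OF sets_unit_lborel refl])
  qed
qed

lemma borel_measurable_quantile: "real_distribution \<alpha> \<Longrightarrow> quantile \<alpha> \<in> borel_measurable borel"
proof -
  assume \<alpha>: "real_distribution \<alpha>"
  then have "(\<lambda>_. \<alpha>) \<in> borel \<rightarrow>\<^sub>M prob_algebra (borel :: real measure)"
    by (auto simp: space_prob_algebra real_distribution_def real_distribution_axioms_def)
  from measurable_Pair1[OF quantile_measurable_kernel[OF this], of 0]
  show ?thesis by simp
qed

text \<open>Both tails are open half-lines, since there may be an atom at the quantile. The mass of
  the left one is the left limit of \<open>cdf\<close>, and below the quantile \<open>cdf\<close>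
  stays under u.\<close>

lemma quantile_tails:
  assumes \<alpha>: "real_distribution \<alpha>" and u: "0 < u" "u < 1"
  shows "measure \<alpha> {quantile \<alpha> u<..} \<le> 1 - u" "measure \<alpha> {..<quantile \<alpha> u} \<le> u"
proof -
  interpret real_distribution \<alpha> by fact
  have "u \<le> cdf \<alpha> (quantile \<alpha> u)" using quantile_le_iff[OF \<alpha> u, of "quantile \<alpha> u"] by simp
  moreover have "measure \<alpha> {quantile \<alpha> u<..} = 1 - cdf \<alpha> (quantile \<alpha> u)"
    using prob_compl[of "{..quantile \<alpha> u}"] by (simp add: cdf_def Compl_eq_Diff_UNIV[symmetric])
  ultimately show "measure \<alpha> {quantile \<alpha> u<..} \<le> 1 - u" by simp
  have "((cdf \<alpha>) \<longlongrightarrow> measure \<alpha> {..<quantile \<alpha> u}) (at_left (quantile \<alpha> u))"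
    by (rule cdf_at_left)
  then show "measure \<alpha> {..<quantile \<alpha> u} \<le> u"
  proof (rule tendsto_upperbound)
    have "cdf \<alpha> x \<le> u" if "x < quantile \<alpha> u" for x
      using quantile_le_iff[OF \<alpha> u, of x] that by simp
    then show "\<forall>\<^sub>F x in at_left (quantile \<alpha> u). cdf \<alpha> x \<le> u"
      by (auto simp: eventually_at_filter)
  qed simp
qed

lemma distr_quantile:
  assumes \<alpha>: "real_distribution \<alpha>" shows "distr unit_lborel borel (quantile \<alpha>) = \<alpha>"
proof (rule law_eq_if_quantile[OF \<alpha> borel_measurable_quantile[OF \<alpha>], symmetric])
  show "AE u in unit_lborel. measure \<alpha> {quantile \<alpha> u<..} \<le> 1 - u \<and> measure \<alpha> {..<quantile \<alpha> u} \<le> u"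
    using AE_unit_lborel by eventually_elim (auto intro: quantile_tails[OF \<alpha>])
qed

text \<open>Layer-cake formula for the quadratic cost: it turns the cost of a coupling into quadrant
  probabilities, which the monotone coupling minimises simultaneously.\<close>

lemma sq_diff_layer_cake:
  fixes x y :: real
  shows "ennreal ((x - y)\<^sup>2) = 2 * (\<integral>\<^sup>+s. \<integral>\<^sup>+t. (if s \<le> t then 1 else 0) *
           ((if y \<le> s then 1 else 0) * (if t < x then 1 else 0) + (if x \<le> s then 1 else 0) * (if t < y then 1 else 0)) \<partial>lborel \<partial>lborel)"
proof -
  \<comment> \<open>The region y <= s <= t < x is a triangle of area (x - y)^2 / 2 if y < x and is
    empty otherwise; of the two mirrored regions at most one counts.\<close>
  have *: "(\<integral>\<^sup>+s. \<integral>\<^sup>+t. (if s \<le> t then 1 else 0) * ((if y \<le> s then 1 else 0) * (if t < x then 1 else 0)) \<partial>lborel \<partial>lborel)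
     = ennreal ((max 0 (x - y))\<^sup>2 / 2)" for x y :: real
  proof -
    have "(\<integral>\<^sup>+t. (if s \<le> t then 1 else 0) * ((if y \<le> s then 1 else 0) * (if t < x then 1 else 0)) \<partial>lborel)
        = ennreal (x - s) * indicator {y..x} s" for s
    proof -
      have "(\<integral>\<^sup>+t. (if s \<le> t then 1 else 0) * ((if y \<le> s then 1 else 0) * (if t < x then 1 else 0)) \<partial>lborel)
        = (\<integral>\<^sup>+t. indicator {y..} s * indicator {s..<x} t \<partial>lborel)"
        by (intro nn_integral_cong) (auto simp: indicator_def)
      also have "\<dots> = indicator {y..} s * emeasure lborel {s..<x}"
        by (subst nn_integral_cmult_indicator) auto
      also have "\<dots> = ennreal (x - s) * indicator {y..x} s"
        by (cases "s \<le> x") (auto simp: indicator_def ennreal_neg)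
      finally show ?thesis .
    qed
    then have "(\<integral>\<^sup>+s. \<integral>\<^sup>+t. (if s \<le> t then 1 else 0) * ((if y \<le> s then 1 else 0) * (if t < x then 1 else 0)) \<partial>lborel \<partial>lborel)
      = (\<integral>\<^sup>+s. ennreal (x - s) * indicator {y..x} s \<partial>lborel)" by simp
    also have "\<dots> = ennreal ((max 0 (x - y))\<^sup>2 / 2)"
    proof (cases "y \<le> x")
      case True
      have "(\<integral>\<^sup>+s. ennreal (x - s) * indicator {y..x} s \<partial>lborel) = ennreal (- ((x - x)\<^sup>2 / 2) - (- ((x - y)\<^sup>2 / 2)))"
        by (rule nn_integral_FTC_Icc[where F="\<lambda>s. - ((x - s)\<^sup>2 / 2)"])
           (use True in \<open>auto intro!: derivative_eq_intros simp: field_simps\<close>)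
      then show ?thesis using True by (simp add: max_def)
    qed (simp add: max_def)
    finally show ?thesis .
  qed
  have "2 * (\<integral>\<^sup>+s. \<integral>\<^sup>+t. (if s \<le> t then 1 else 0) *
           ((if y \<le> s then 1 else 0) * (if t < x then 1 else 0) + (if x \<le> s then 1 else 0) * (if t < y then 1 else 0)) \<partial>lborel \<partial>lborel)
     = 2 * ((\<integral>\<^sup>+s. \<integral>\<^sup>+t. (if s \<le> t then 1 else 0) * ((if y \<le> s then 1 else 0) * (if t < x then 1 else 0)) \<partial>lborel \<partial>lborel)
        + (\<integral>\<^sup>+s. \<integral>\<^sup>+t. (if s \<le> t then 1 else 0) * ((if x \<le> s then 1 else 0) * (if t < y then 1 else 0)) \<partial>lborel \<partial>lborel))"
    by (subst nn_integral_add[symmetric], measurable, simp add: distrib_left nn_integral_add)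
  also have "\<dots> = 2 * (ennreal ((max 0 (x - y))\<^sup>2 / 2) + ennreal ((max 0 (y - x))\<^sup>2 / 2))"
    unfolding * by simp
  also have "\<dots> = 2 * ennreal ((max 0 (x - y))\<^sup>2 / 2 + (max 0 (y - x))\<^sup>2 / 2)"
    by (subst ennreal_plus) auto
  also have "\<dots> = ennreal (2 * ((max 0 (x - y))\<^sup>2 / 2 + (max 0 (y - x))\<^sup>2 / 2))"
    by (subst ennreal_mult) auto
  also have "2 * ((max 0 (x - y))\<^sup>2 / 2 + (max 0 (y - x))\<^sup>2 / 2) = (x - y)\<^sup>2"
    by (auto simp: max_def power2_commute)
  finally show ?thesis by simp
qed

text \<open>Tonelli turns the cost into an integral of quadrant masses. It is used for a coupling,
  with f and g the projections, and for \<open>unit_lborel\<close>, with f and g the quantile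
  functions, so that the two costs can be compared quadrant by quadrant.\<close>

lemma nn_integral_sq_diff_layer_cake:
  assumes "sigma_finite_measure \<pi>" and [measurable]: "f \<in> borel_measurable \<pi>" "g \<in> borel_measurable \<pi>"
  shows "(\<integral>\<^sup>+z. ennreal ((f z - g z)\<^sup>2) \<partial>\<pi>) = 2 * (\<integral>\<^sup>+s. \<integral>\<^sup>+t. (if s \<le> t then 1 else 0) *
           (emeasure \<pi> {z \<in> space \<pi>. g z \<le> s \<and> t < f z} + emeasure \<pi> {z \<in> space \<pi>. f z \<le> s \<and> t < g z})
           \<partial>lborel \<partial>lborel)"
proof -
  interpret \<pi>: sigma_finite_measure \<pi> by fact
  interpret p: pair_sigma_finite \<pi> lborel by standard
  interpret p2: pair_sigma_finite "\<pi>" "lborel \<Otimes>\<^sub>M lborel :: (real \<times> real) measure" by standard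
  let ?h = "\<lambda>z s t. (if s \<le> t then 1 else 0) *
       ((if g z \<le> s then 1 else 0) * (if t < f z then 1 else 0)
         + (if f z \<le> s then 1 else 0) * (if t < g z then 1 else 0)) :: ennreal"
  have "(\<integral>\<^sup>+z. ennreal ((f z - g z)\<^sup>2) \<partial>\<pi>) = (\<integral>\<^sup>+z. 2 * (\<integral>\<^sup>+s. \<integral>\<^sup>+t. ?h z s t \<partial>lborel \<partial>lborel) \<partial>\<pi>)"
    by (simp only: sq_diff_layer_cake)
  also have "\<dots> = 2 * (\<integral>\<^sup>+z. (\<integral>\<^sup>+s. \<integral>\<^sup>+t. ?h z s t \<partial>lborel \<partial>lborel) \<partial>\<pi>)"
    by (subst nn_integral_cmult) auto
  also have "(\<integral>\<^sup>+z. (\<integral>\<^sup>+s. \<integral>\<^sup>+t. ?h z s t \<partial>lborel \<partial>lborel) \<partial>\<pi>) =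
      (\<integral>\<^sup>+s. (\<integral>\<^sup>+z. \<integral>\<^sup>+t. ?h z s t \<partial>lborel \<partial>\<pi>) \<partial>lborel)"
    by (rule p.Fubini'[symmetric]) simp
  also have "\<dots> = (\<integral>\<^sup>+s. (\<integral>\<^sup>+t. \<integral>\<^sup>+z. ?h z s t \<partial>\<pi> \<partial>lborel) \<partial>lborel)"
    by (intro nn_integral_cong p.Fubini'[symmetric]) simp
  also have "\<dots> = (\<integral>\<^sup>+s. \<integral>\<^sup>+t. (if s \<le> t then 1 else 0) *
           (emeasure \<pi> {z \<in> space \<pi>. g z \<le> s \<and> t < f z} + emeasure \<pi> {z \<in> space \<pi>. f z \<le> s \<and> t < g z})
           \<partial>lborel \<partial>lborel)"
  proof (intro nn_integral_cong)
    fix s t :: real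
    have "(\<integral>\<^sup>+z. ?h z s t \<partial>\<pi>) = (\<integral>\<^sup>+z. (if s \<le> t then 1 else 0) *
       (indicator {z \<in> space \<pi>. g z \<le> s \<and> t < f z} z + indicator {z \<in> space \<pi>. f z \<le> s \<and> t < g z} z) \<partial>\<pi>)"
      by (intro nn_integral_cong) (auto simp: indicator_def)
    also have "\<dots> = (if s \<le> t then 1 else 0) *
           (emeasure \<pi> {z \<in> space \<pi>. g z \<le> s \<and> t < f z} + emeasure \<pi> {z \<in> space \<pi>. f z \<le> s \<and> t < g z})"
      by (simp add: nn_integral_cmult nn_integral_add)
    finally show "(\<integral>\<^sup>+z. ?h z s t \<partial>\<pi>) = \<dots>" .
  qed
  finally show ?thesis .
qed

text \<open>The push-forward of \<open>unit_lborel\<close> under (p, q) is a coupling. Neither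
  function has to be monotone, so the bound also serves for flows at positive times.\<close>

lemma wasserstein2_sq_le_unit:
  assumes [measurable]: "p \<in> borel_measurable borel" "q \<in> borel_measurable borel"
  shows "wasserstein2_sq (distr unit_lborel borel p) (distr unit_lborel borel q)
    \<le> (\<integral>\<^sup>+u. ennreal ((p u - q u)\<^sup>2) \<partial>unit_lborel)"
proof -
  let ?\<pi> = "distr unit_lborel borel (\<lambda>u. (p u, q u))"
  have m: "(\<lambda>u. (p u, q u)) \<in> unit_lborel \<rightarrow>\<^sub>M borel"
    unfolding borel_prod[symmetric] by simp
  have [measurable]: "fst \<in> (borel :: (real \<times> real) measure) \<rightarrow>\<^sub>M borel" "snd \<in> (borel :: (real \<times> real) measure) \<rightarrow>\<^sub>M borel"
    unfolding borel_prod[symmetric] by simp_all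
  have "?\<pi> \<in> couplings (distr unit_lborel borel p) (distr unit_lborel borel q)"
    using m by (auto simp: couplings_def distr_distr comp_def)
  then have "wasserstein2_sq (distr unit_lborel borel p) (distr unit_lborel borel q)
     \<le> (\<integral>\<^sup>+ (\<xi>, \<zeta>). ennreal ((\<xi> - \<zeta>)\<^sup>2) \<partial>?\<pi>)"
    unfolding wasserstein2_sq_def by (rule INF_lower)
  also have "\<dots> = (\<integral>\<^sup>+u. ennreal ((p u - q u)\<^sup>2) \<partial>unit_lborel)"
    by (subst nn_integral_distr[OF m]) (auto simp: borel_prod[symmetric])
  finally show ?thesis .
qed

theorem wasserstein2_sq_quantile:
  assumes \<alpha>: "real_distribution \<alpha>" and \<beta>: "real_distribution \<beta>"
  shows "wasserstein2_sq \<alpha> \<beta> = (\<integral>\<^sup>+u. ennreal ((quantile \<alpha> u - quantile \<beta> u)\<^sup>2) \<partial>unit_lborel)"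
proof (rule antisym)
  interpret A: real_distribution \<alpha> by fact
  interpret B: real_distribution \<beta> by fact
  interpret U: prob_space unit_lborel by (rule prob_space_unit_lborel)
  note [measurable] = borel_measurable_quantile[OF \<alpha>] borel_measurable_quantile[OF \<beta>]
  show "wasserstein2_sq \<alpha> \<beta> \<le> (\<integral>\<^sup>+u. ennreal ((quantile \<alpha> u - quantile \<beta> u)\<^sup>2) \<partial>unit_lborel)"
    using wasserstein2_sq_le_unit[of "quantile \<alpha>" "quantile \<beta>"]
    by (simp add: distr_quantile[OF \<alpha>] distr_quantile[OF \<beta>])
  show "(\<integral>\<^sup>+u. ennreal ((quantile \<alpha> u - quantile \<beta> u)\<^sup>2) \<partial>unit_lborel) \<le> wasserstein2_sq \<alpha> \<beta>"
    unfolding wasserstein2_sq_def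
  proof (rule INF_greatest)
    fix \<pi> assume "\<pi> \<in> couplings \<alpha> \<beta>"
    then have [measurable_cong]: "sets \<pi> = sets borel" and fst: "distr \<pi> borel fst = \<alpha>" and snd: "distr \<pi> borel snd = \<beta>"
      by (auto simp: couplings_def)
    have sp: "space \<pi> = UNIV" using \<open>sets \<pi> = sets borel\<close> by (auto dest: sets_eq_imp_space_eq)
    have [measurable]: "fst \<in> (borel :: (real \<times> real) measure) \<rightarrow>\<^sub>M borel" "snd \<in> (borel :: (real \<times> real) measure) \<rightarrow>\<^sub>M borel"
      unfolding borel_prod[symmetric] by simp_all
    interpret \<pi>: prob_space \<pi>
    proof (rule prob_spaceI)
      have "emeasure \<pi> (space \<pi>) = emeasure (distr \<pi> borel fst) UNIV"
        by (subst emeasure_distr) (auto simp: sp)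
      then show "emeasure \<pi> (space \<pi>) = 1" by (simp add: fst A.emeasure_space_1[simplified])
    qed
    \<comment> \<open>Frechet lower bound, valid for every coupling: {snd <= s} is contained in the
      union of {fst <= t} and {snd <= s, t < fst}.\<close>
    have key: "ennreal (max 0 (cdf \<beta> s - cdf \<alpha> t)) \<le> emeasure \<pi> {z \<in> space \<pi>. snd z \<le> s \<and> t < fst z}"
      "ennreal (max 0 (cdf \<alpha> s - cdf \<beta> t)) \<le> emeasure \<pi> {z \<in> space \<pi>. fst z \<le> s \<and> t < snd z}" for s t
    proof -
      have a: "cdf \<alpha> t = measure \<pi> {z. fst z \<le> t}" for t
        unfolding fst[symmetric] cdf_def by (subst measure_distr) (auto simp: sp vimage_def)
      have b: "cdf \<beta> t = measure \<pi> {z. snd z \<le> t}" for t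
        unfolding snd[symmetric] cdf_def by (subst measure_distr) (auto simp: sp vimage_def)
      have m: "{z. snd z \<le> s} \<in> sets \<pi>" "{z. fst z \<le> s} \<in> sets \<pi>"
         "{z. snd z \<le> s \<and> t < fst z} \<in> sets \<pi>" "{z. fst z \<le> s \<and> t < snd z} \<in> sets \<pi>" for s t
        using sets.sets_Collect[OF] unfolding \<open>sets \<pi> = sets borel\<close>
        by (auto simp: pred_def[symmetric])
      have "cdf \<beta> s \<le> cdf \<alpha> t + measure \<pi> {z. snd z \<le> s \<and> t < fst z}"
        unfolding a b by (rule order_trans[OF \<pi>.finite_measure_mono measure_Un_le])
           (use m in auto)
      then show "ennreal (max 0 (cdf \<beta> s - cdf \<alpha> t)) \<le> emeasure \<pi> {z \<in> space \<pi>. snd z \<le> s \<and> t < fst z}"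
        by (simp add: sp \<pi>.emeasure_eq_measure ennreal_leI)
      have "cdf \<alpha> s \<le> cdf \<beta> t + measure \<pi> {z. fst z \<le> s \<and> t < snd z}"
        unfolding a b by (rule order_trans[OF \<pi>.finite_measure_mono measure_Un_le])
           (use m in auto)
      then show "ennreal (max 0 (cdf \<alpha> s - cdf \<beta> t)) \<le> emeasure \<pi> {z \<in> space \<pi>. fst z \<le> s \<and> t < snd z}"
        by (simp add: sp \<pi>.emeasure_eq_measure ennreal_leI)
    qed
    \<comment> \<open>The monotone coupling does not exceed this bound: by
      \<open>quantile_le_iff\<close> the quadrant corresponds to levels u between
      \<open>cdf a t\<close> and \<open>cdf b s\<close>.\<close>
    have q: "emeasure unit_lborel {u. quantile b u \<le> s \<and> t < quantile a u} \<le> ennreal (max 0 (cdf b s - cdf a t))"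
      if a: "real_distribution a" and b: "real_distribution b" for a b s t
    proof -
      interpret a: real_distribution a by fact
      interpret b: real_distribution b by fact
      have "emeasure unit_lborel {u. quantile b u \<le> s \<and> t < quantile a u}
        \<le> emeasure unit_lborel {cdf a t<..cdf b s}"
      proof (rule emeasure_mono_AE)
        show "AE u in unit_lborel. u \<in> {u. quantile b u \<le> s \<and> t < quantile a u} \<longrightarrow> u \<in> {cdf a t<..cdf b s}"
          using AE_unit_lborel
          by eventually_elim (metis (mono_tags, lifting) a b greaterThanAtMost_iff linorder_not_le mem_Collect_eq quantile_le_iff)
      qed simp
      also have "\<dots> = ennreal (max 0 (cdf b s - cdf a t))"
      proof (cases "cdf a t \<le> cdf b s")
        case True
        then show ?thesis by (simp add: emeasure_unit_lborel_Ioc a.cdf_nonneg b.cdf_bounded_prob)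
      qed auto
      finally show ?thesis .
    qed
    have "(\<integral>\<^sup>+u. ennreal ((quantile \<alpha> u - quantile \<beta> u)\<^sup>2) \<partial>unit_lborel)
      = 2 * (\<integral>\<^sup>+s. \<integral>\<^sup>+t. (if s \<le> t then 1 else 0) *
           (emeasure unit_lborel {z \<in> space unit_lborel. quantile \<beta> z \<le> s \<and> t < quantile \<alpha> z}
             + emeasure unit_lborel {z \<in> space unit_lborel. quantile \<alpha> z \<le> s \<and> t < quantile \<beta> z})
           \<partial>lborel \<partial>lborel)"
      by (rule nn_integral_sq_diff_layer_cake) (auto intro: U.sigma_finite_measure_axioms)
    also have "\<dots> \<le> 2 * (\<integral>\<^sup>+s. \<integral>\<^sup>+t. (if s \<le> t then 1 else 0) *
           (emeasure \<pi> {z \<in> space \<pi>. snd z \<le> s \<and> t < fst z} + emeasure \<pi> {z \<in> space \<pi>. fst z \<le> s \<and> t < snd z})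
           \<partial>lborel \<partial>lborel)"
      by (intro mult_left_mono nn_integral_mono add_mono)
         (auto intro!: order_trans[OF q key(1)] order_trans[OF q key(2)] \<alpha> \<beta>)
    also have "\<dots> = (\<integral>\<^sup>+z. ennreal ((fst z - snd z)\<^sup>2) \<partial>\<pi>)"
      by (rule nn_integral_sq_diff_layer_cake[symmetric]) (auto intro: \<pi>.sigma_finite_measure_axioms)
    finally show "(\<integral>\<^sup>+u. ennreal ((quantile \<alpha> u - quantile \<beta> u)\<^sup>2) \<partial>unit_lborel)
       \<le> (\<integral>\<^sup>+ (\<xi>, \<zeta>). ennreal ((\<xi> - \<zeta>)\<^sup>2) \<partial>\<pi>)"
      by (simp add: case_prod_beta')
  qed
qed

section \<open>Disintegrations\<close>

text \<open>Integrate f - g over the set where f exceeds g. Finiteness of the integral of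
  \<open>g\<close> makes the subtraction in \<open>ennreal\<close> legitimate.\<close>

lemma AE_le_if_nn_integral_le:
  assumes [measurable]: "f \<in> borel_measurable M" "g \<in> borel_measurable M"
    and le: "\<And>B. B \<in> sets M \<Longrightarrow> (\<integral>\<^sup>+x\<in>B. f x \<partial>M) \<le> (\<integral>\<^sup>+x\<in>B. g x \<partial>M)"
    and fin: "(\<integral>\<^sup>+x. g x \<partial>M) < \<infinity>"
  shows "AE x in M. f x \<le> g x"
proof -
  let ?B = "{x \<in> space M. g x < f x}"
  have B[measurable]: "?B \<in> sets M" by measurable
  have "(\<integral>\<^sup>+x\<in>?B. g x \<partial>M) \<le> (\<integral>\<^sup>+x. g x \<partial>M)"
    by (intro nn_integral_mono) (auto simp: indicator_def)
  then have gfin: "(\<integral>\<^sup>+x\<in>?B. g x \<partial>M) \<noteq> \<infinity>" using fin by auto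
  have "(\<integral>\<^sup>+x. f x * indicator ?B x - g x * indicator ?B x \<partial>M)
      = (\<integral>\<^sup>+x\<in>?B. f x \<partial>M) - (\<integral>\<^sup>+x\<in>?B. g x \<partial>M)"
    using gfin by (intro nn_integral_diff AE_I2) (auto simp: indicator_def)
  also have "\<dots> = 0"
    using le[OF B] gfin by (intro diff_eq_0_ennreal) (auto simp: less_top[symmetric] top_unique)
  finally have "AE x in M. f x * indicator ?B x - g x * indicator ?B x = 0"
    by (subst (asm) nn_integral_0_iff_AE) auto
  then show ?thesis
    using AE_space
  proof eventually_elim
    case (elim x)
    show ?case
    proof (rule ccontr)
      assume "\<not> f x \<le> g x"
      moreover from this have "x \<in> ?B" using elim by auto
      ultimately show False using elim ennreal_minus_eq_0[of "f x" "g x"] by simp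
    qed
  qed
qed

lemma sets_borel_prod:
  "sets (borel \<Otimes>\<^sub>M borel) = sets (borel :: ('a::second_countable_topology \<times> 'b::second_countable_topology) measure)"
  by (subst borel_prod) simp

text \<open>For fixed B, finite measures on the line are determined by open rays, which gives
  equality on all rectangles; these are an intersection-stable generator of the product.\<close>

lemma measure_eqI_rays_times:
  fixes M N :: "(real \<times> 'a::euclidean_space) measure"
  assumes M: "sets M = sets borel" "finite_measure M" and N: "sets N = sets borel"
    and eq: "\<And>c B. B \<in> sets borel \<Longrightarrow> emeasure M ({c<..} \<times> B) = emeasure N ({c<..} \<times> B)"
  shows "M = N"
proof -
  interpret M: finite_measure M by fact
  have sM: "sets M = sets (borel \<Otimes>\<^sub>M borel)" and sN: "sets N = sets (borel \<Otimes>\<^sub>M borel)"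
    using M N by (simp_all add: sets_borel_prod)
  note [measurable_cong] = sM sN
  have rect: "emeasure M (A \<times> B) = emeasure N (A \<times> B)" if A: "A \<in> sets borel" and B: "B \<in> sets borel" for A B
  proof -
    let ?R = "\<lambda>K. distr (restrict_space K (UNIV \<times> B)) borel fst"
    have Bs: "UNIV \<times> B \<in> sets (borel \<Otimes>\<^sub>M borel)" by (rule pair_measureI) (use B in auto)
    have R: "emeasure (?R K) A = emeasure K (A \<times> B)"
      if A: "A \<in> sets borel" and K: "sets K = sets (borel \<Otimes>\<^sub>M borel)" for K and A :: "real set"
    proof -
      have [simp]: "space K = UNIV" using K by (auto dest: sets_eq_imp_space_eq simp: space_pair_measure)
      have [measurable]: "fst \<in> K \<rightarrow>\<^sub>M borel" by (simp add: measurable_cong_sets[OF K refl])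
      have "fst -` A \<inter> UNIV \<times> B = A \<times> B" by auto
      then show ?thesis
        by (subst emeasure_distr[OF _ A])
          (use Bs K in \<open>auto intro!: measurable_restrict_space1 emeasure_restrict_space simp: space_restrict_space\<close>)
    qed
    have "?R M = ?R N"
    proof (rule measure_eqI_lessThan)
      fix c
      show "emeasure (?R M) {c<..} < \<infinity>" by (subst R) (auto simp: sM M.emeasure_eq_measure)
      show "emeasure (?R M) {c<..} = emeasure (?R N) {c<..}"
        by (simp add: R sM sN eq B)
    qed auto
    then show ?thesis using R[OF A sM] R[OF A sN] by simp
  qed
  show ?thesis
  proof (rule measure_eqI_generator_eq[OF Int_stable_pair_measure_generator[of borel borel]])
    show "sets M = sigma_sets (space borel \<times> space borel) {a \<times> b |a b. a \<in> sets borel \<and> b \<in> sets borel}"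
      "sets N = sigma_sets (space borel \<times> space borel) {a \<times> b |a b. a \<in> sets borel \<and> b \<in> sets borel}"
      unfolding sM sN by (simp_all add: sets_pair_measure)
    show "range (\<lambda>_::nat. UNIV \<times> UNIV) \<subseteq> {a \<times> b |a b. a \<in> sets (borel :: real measure) \<and> b \<in> sets (borel :: 'a measure)}"
      by (auto intro!: exI[of _ UNIV])
  qed (auto simp: M.emeasure_finite intro: rect)
qed

locale marginal_space =
  fixes \<mu> :: "'a::euclidean_space measure"
  assumes prob_\<mu>: "prob_space \<mu>" and sets_\<mu>[measurable_cong]: "sets \<mu> = sets borel"
begin

sublocale M: prob_space \<mu> by (rule prob_\<mu>)
sublocale U: prob_space unit_lborel by (rule prob_space_unit_lborel)
sublocale P: pair_prob_space unit_lborel \<mu> ..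

text \<open>Common probability space for all measures and flows: a quantile level u together with a
  base point x. Two solutions realised on it share x, so their difference is automatically taken
  fibrewise.\<close>

abbreviation "P \<equiv> unit_lborel \<Otimes>\<^sub>M \<mu>"

lemma space_\<mu> [simp]: "space \<mu> = UNIV"
  using sets_eq_imp_space_eq[OF sets_\<mu>] by simp

lemma emeasure_\<mu>_UNIV [simp]: "emeasure \<mu> UNIV = 1"
  using M.emeasure_space_1 by simp

lemma sets_P: "sets P = sets (borel \<Otimes>\<^sub>M borel)"
  by (rule sets_pair_measure_cong) (auto simp: sets_\<mu>)

definition graph_law :: "(real \<Rightarrow> 'a \<Rightarrow> real) \<Rightarrow> (real \<times> 'a) measure" where
  "graph_law q = distr P borel (\<lambda>(u, x). (q u x, x))"

lemma measurable_graph: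
  fixes q :: "real \<Rightarrow> 'a \<Rightarrow> real"
  assumes "(\<lambda>(u, x). q u x) \<in> borel_measurable (borel \<Otimes>\<^sub>M borel)"
  shows "(\<lambda>(u, x). (q u x, x)) \<in> P \<rightarrow>\<^sub>M borel"
proof -
  have "(\<lambda>z. (q (fst z) (snd z), snd z)) \<in> borel \<Otimes>\<^sub>M borel \<rightarrow>\<^sub>M borel \<Otimes>\<^sub>M (borel :: 'a measure)"
    by (rule measurable_Pair) (use assms in \<open>simp_all add: split_beta'\<close>)
  then show ?thesis
    unfolding split_beta' by (subst measurable_cong_sets[OF sets_P sets_borel_prod[symmetric]])
qed

lemma emeasure_graph_law:
  assumes q: "(\<lambda>(u, x). q u x) \<in> borel_measurable (borel \<Otimes>\<^sub>M borel)" and A: "A \<in> sets borel"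
  shows "emeasure (graph_law q) A = (\<integral>\<^sup>+x. emeasure (distr unit_lborel borel (\<lambda>u. q u x)) {\<xi>. (\<xi>, x) \<in> A} \<partial>\<mu>)"
proof -
  have q'[measurable]: "(\<lambda>u. q u x) \<in> borel_measurable borel" for x
    using measurable_Pair1[OF q] by simp
  have sec: "{\<xi>. (\<xi>, x) \<in> A} \<in> sets borel" for x
    using sets_Pair2[of A borel borel x] A by (simp add: sets_borel_prod vimage_def)
  have "emeasure (graph_law q) A = emeasure P ((\<lambda>(u, x). (q u x, x)) -` A \<inter> space P)"
    unfolding graph_law_def by (rule emeasure_distr[OF measurable_graph[OF q] A])
  also have "\<dots> = (\<integral>\<^sup>+x. emeasure unit_lborel ((\<lambda>u. (u, x)) -` ((\<lambda>(u, x). (q u x, x)) -` A \<inter> space P)) \<partial>\<mu>)"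
    by (rule P.emeasure_pair_measure_alt2) (rule measurable_sets[OF measurable_graph[OF q] A])
  also have "\<dots> = (\<integral>\<^sup>+x. emeasure (distr unit_lborel borel (\<lambda>u. q u x)) {\<xi>. (\<xi>, x) \<in> A} \<partial>\<mu>)"
    by (intro nn_integral_cong) (auto simp: emeasure_distr sec space_pair_measure vimage_def)
  finally show ?thesis .
qed

lemma sets_graph_law [simp, measurable_cong]: "sets (graph_law q) = sets borel"
  by (simp add: graph_law_def)

lemma is_disintegration_graph_law:
  assumes q: "(\<lambda>(u, x). q u x) \<in> borel_measurable (borel \<Otimes>\<^sub>M borel)"
  shows "is_disintegration \<mu> (graph_law q) (\<lambda>x. distr unit_lborel borel (\<lambda>u. q u x))"
proof -
  have "(\<lambda>x. distr unit_lborel borel (\<lambda>u. q u x)) \<in> \<mu> \<rightarrow>\<^sub>M prob_algebra borel"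
  proof (rule measurable_distr_prob_space2)
    show "(\<lambda>x. unit_lborel) \<in> \<mu> \<rightarrow>\<^sub>M prob_algebra borel"
      by (simp add: space_prob_algebra U.prob_space_axioms)
    show "(\<lambda>(x, u). q u x) \<in> \<mu> \<Otimes>\<^sub>M borel \<rightarrow>\<^sub>M borel"
      using measurable_compose[OF measurable_pair_swap' q]
      by (simp add: split_beta' measurable_cong_sets[OF sets_pair_measure_cong[OF sets_\<mu> refl] refl])
  qed
  then show ?thesis
    by (auto simp: is_disintegration_def emeasure_graph_law[OF q])
qed

text \<open>Fibres enter only through an integral against \<mu>, so an almost everywhere identity of
  the fibres determines the measure.\<close>

lemma graph_law_eqI:
  assumes \<nu>: "sets \<nu> = sets borel" and dis: "is_disintegration \<mu> \<nu> \<kappa>"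
    and q: "(\<lambda>(u, x). q u x) \<in> borel_measurable (borel \<Otimes>\<^sub>M borel)"
    and ae: "AE x in \<mu>. \<kappa> x = distr unit_lborel borel (\<lambda>u. q u x)"
  shows "\<nu> = graph_law q"
proof (rule measure_eqI)
  fix A assume "A \<in> sets \<nu>"
  then have A: "A \<in> sets borel" using \<nu> by simp
  have "emeasure \<nu> A = (\<integral>\<^sup>+x. emeasure (\<kappa> x) {\<xi>. (\<xi>, x) \<in> A} \<partial>\<mu>)"
    using dis A by (auto simp: is_disintegration_def)
  also have "\<dots> = emeasure (graph_law q) A"
    unfolding emeasure_graph_law[OF q A]
    by (rule nn_integral_cong_AE) (use ae in eventually_elim, simp)
  finally show "emeasure \<nu> A = emeasure (graph_law q) A" .
qed (simp add: \<nu>)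

text \<open>The conditional survival functions, the probability of \<xi> > q given x, are
  Radon-Nikodym densities \<open>f q\<close>. Instead of assembling a kernel from them, the proof
  inverts them to a jointly measurable \<open>Q u x\<close>; the kernel is then the family of laws
  of \<open>Q\<close>, whose measurability and normalisation are automatic.\<close>

theorem disintegration_exists:
  assumes \<nu>: "sets \<nu> = sets borel" "prob_space \<nu>" and marg: "distr \<nu> borel snd = \<mu>"
  shows "\<exists>\<kappa>. is_disintegration \<mu> \<nu> \<kappa>"
proof -
  interpret N: prob_space \<nu> by fact
  have \<nu>': "sets \<nu> = sets (borel \<Otimes>\<^sub>M borel)" using \<nu> by (simp add: sets_borel_prod)
  note [measurable_cong] = \<nu>'
  have sp\<nu>: "space \<nu> = UNIV" using \<nu>(1) by (auto dest: sets_eq_imp_space_eq)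
  have marg': "emeasure \<mu> B = emeasure \<nu> (UNIV \<times> B)" if "B \<in> sets borel" for B
    unfolding marg[symmetric] by (subst emeasure_distr) (use that in \<open>auto simp: sp\<nu> vimage_def intro!: arg_cong[where f="emeasure \<nu>"]\<close>)
  have "\<exists>f. f \<in> borel_measurable \<mu> \<and> (\<forall>B\<in>sets borel. (\<integral>\<^sup>+x\<in>B. f x \<partial>\<mu>) = emeasure \<nu> ({q<..} \<times> B))" for q :: real
  proof -
    let ?m = "distr (density \<nu> (indicator ({q<..} \<times> UNIV))) borel snd"
    have R[measurable]: "{q<..} \<times> (UNIV :: 'a set) \<in> sets \<nu>" unfolding \<nu>' by simp
    have m: "emeasure ?m B = emeasure \<nu> ({q<..} \<times> B)" if B: "B \<in> sets borel" for B
    proof -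
      have "emeasure ?m B = emeasure (density \<nu> (indicator ({q<..} \<times> UNIV))) (UNIV \<times> B)"
        by (subst emeasure_distr) (use B in \<open>auto simp: sp\<nu> vimage_def intro!: arg_cong2[where f=emeasure]\<close>)
      also have "\<dots> = (\<integral>\<^sup>+z. indicator ({q<..} \<times> UNIV) z * indicator (UNIV \<times> B) z \<partial>\<nu>)"
        by (rule emeasure_density) (use B in \<open>auto simp: \<nu>'\<close>)
      also have "\<dots> = (\<integral>\<^sup>+z. indicator ({q<..} \<times> B) z \<partial>\<nu>)"
        by (intro nn_integral_cong) (auto simp: indicator_def)
      also have "\<dots> = emeasure \<nu> ({q<..} \<times> B)"
        by (rule nn_integral_indicator) (use B in \<open>auto simp: \<nu>'\<close>)
      finally show ?thesis .
    qed
    have "absolutely_continuous \<mu> ?m"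
      unfolding absolutely_continuous_def
    proof
      fix B assume "B \<in> null_sets \<mu>"
      then have B: "B \<in> sets borel" "emeasure \<mu> B = 0" by (auto simp: sets_\<mu>)
      have "emeasure \<nu> ({q<..} \<times> B) \<le> emeasure \<nu> (UNIV \<times> B)"
        by (rule emeasure_mono) (use B in \<open>auto simp: \<nu>'\<close>)
      then show "B \<in> null_sets ?m" using B m[OF B(1)] marg'[OF B(1)] by (auto simp: null_sets_def)
    qed
    from M.Radon_Nikodym[OF this] obtain f where f: "f \<in> borel_measurable \<mu>" "density \<mu> f = ?m"
      by (auto simp: sets_\<mu>)
    have "(\<integral>\<^sup>+x\<in>B. f x \<partial>\<mu>) = emeasure \<nu> ({q<..} \<times> B)" if "B \<in> sets borel" for B
    proof -
      have "(\<integral>\<^sup>+x\<in>B. f x \<partial>\<mu>) = emeasure (density \<mu> f) B"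
        by (rule emeasure_density[symmetric]) (use f that in \<open>auto simp: sets_\<mu>\<close>)
      also have "\<dots> = emeasure ?m B" by (simp only: f(2))
      finally show ?thesis using m[OF that] by simp
    qed
    then show ?thesis using f(1) by blast
  qed
  then obtain f where f[measurable]: "\<And>q. f q \<in> borel_measurable \<mu>"
    and fint: "\<And>q B. B \<in> sets borel \<Longrightarrow> (\<integral>\<^sup>+x\<in>B. f q x \<partial>\<mu>) = emeasure \<nu> ({q<..} \<times> B)"
    by metis
  have fle1: "AE x in \<mu>. f q x \<le> 1" for q
  proof (rule AE_le_if_nn_integral_le)
    fix B assume B: "B \<in> sets \<mu>"
    have "emeasure \<nu> ({q<..} \<times> B) \<le> emeasure \<nu> (UNIV \<times> B)"
      by (rule emeasure_mono) (use B in \<open>auto simp: \<nu>' sets_\<mu>\<close>)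
    then show "(\<integral>\<^sup>+x\<in>B. f q x \<partial>\<mu>) \<le> (\<integral>\<^sup>+x\<in>B. 1 \<partial>\<mu>)"
      using B by (simp add: fint sets_\<mu> marg'[symmetric])
  qed (auto simp: M.emeasure_space_1)
  have fin: "(\<integral>\<^sup>+x. f q x \<partial>\<mu>) < \<infinity>" for q
  proof -
    have "(\<integral>\<^sup>+x. f q x \<partial>\<mu>) = emeasure \<nu> ({q<..} \<times> UNIV)" using fint[of UNIV q] by simp
    then show ?thesis by (simp add: less_top[symmetric])
  qed
  have fmono: "AE x in \<mu>. f q x \<le> f p x" if "p \<le> q" for p q
  proof (rule AE_le_if_nn_integral_le)
    fix B assume B: "B \<in> sets \<mu>"
    have "emeasure \<nu> ({q<..} \<times> B) \<le> emeasure \<nu> ({p<..} \<times> B)"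
      by (rule emeasure_mono) (use B that in \<open>auto simp: \<nu>' sets_\<mu>\<close>)
    then show "(\<integral>\<^sup>+x\<in>B. f q x \<partial>\<mu>) \<le> (\<integral>\<^sup>+x\<in>B. f p x \<partial>\<mu>)"
      using B by (simp add: fint sets_\<mu>)
  qed (use fin in auto)
  have ftop: "AE x in \<mu>. 1 \<le> (SUP n::nat. f (- real n) x)"
  proof (rule AE_le_if_nn_integral_le)
    fix B assume B: "B \<in> sets \<mu>"
    have "(\<integral>\<^sup>+x\<in>B. 1 \<partial>\<mu>) = emeasure \<nu> (UNIV \<times> B)" using B by (simp add: sets_\<mu> marg'[symmetric])
    also have "UNIV \<times> B = (\<Union>n::nat. {- real n<..} \<times> B)"
      by auto (metis minus_less_iff reals_Archimedean2)
    also have "emeasure \<nu> \<dots> = (SUP n::nat. emeasure \<nu> ({- real n<..} \<times> B))"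
      by (rule SUP_emeasure_incseq[symmetric]) (use B in \<open>auto simp: \<nu>' sets_\<mu> incseq_def\<close>)
    also have "\<dots> = (SUP n::nat. \<integral>\<^sup>+x\<in>B. f (- real n) x \<partial>\<mu>)"
      using B by (simp add: fint sets_\<mu>)
    also have "\<dots> \<le> (\<integral>\<^sup>+x\<in>B. (SUP n::nat. f (- real n) x) \<partial>\<mu>)"
      by (intro SUP_least nn_integral_mono mult_right_mono SUP_upper) auto
    finally show "(\<integral>\<^sup>+x\<in>B. 1 \<partial>\<mu>) \<le> \<dots>" .
  next
    have "AE x in \<mu>. \<forall>n::nat. f (- real n) x \<le> 1" using fle1 by (simp add: AE_all_countable)
    then have "(\<integral>\<^sup>+x. (SUP n::nat. f (- real n) x) \<partial>\<mu>) \<le> (\<integral>\<^sup>+x. 1 \<partial>\<mu>)"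
      by (intro nn_integral_mono_AE) (auto elim!: eventually_mono intro: SUP_least)
    also have "\<dots> < \<infinity>" by simp
    finally show "(\<integral>\<^sup>+x. (SUP n::nat. f (- real n) x) \<partial>\<mu>) < \<infinity>" .
  qed auto
  have fbot: "AE x in \<mu>. (INF n::nat. f (real n) x) = 0"
  proof -
    have "(\<integral>\<^sup>+x. (INF n::nat. f (real n) x) \<partial>\<mu>) \<le> (INF n::nat. emeasure \<nu> ({real n<..} \<times> UNIV))"
    proof (rule INF_greatest)
      fix n :: nat
      have "(\<integral>\<^sup>+x. (INF n::nat. f (real n) x) \<partial>\<mu>) \<le> (\<integral>\<^sup>+x. f (real n) x \<partial>\<mu>)"
        by (intro nn_integral_mono INF_lower) auto
      then show "(\<integral>\<^sup>+x. (INF n::nat. f (real n) x) \<partial>\<mu>) \<le> emeasure \<nu> ({real n<..} \<times> UNIV)"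
        using fint[of UNIV "real n"] by simp
    qed
    also have "\<dots> = emeasure \<nu> (\<Inter>n::nat. {real n<..} \<times> UNIV)"
      by (rule INF_emeasure_decseq) (auto simp: \<nu>' decseq_def N.emeasure_eq_measure)
    also have "(\<Inter>n::nat. {real n<..} \<times> (UNIV::'a set)) = {}"
      by auto (metis linorder_not_less order_less_imp_le reals_Archimedean2)
    finally have "(\<integral>\<^sup>+x. (INF n::nat. f (real n) x) \<partial>\<mu>) = 0" by simp
    then show ?thesis by (subst (asm) nn_integral_0_iff_AE) auto
  qed
  \<comment> \<open>The almost sure properties of a survival function. Restricting to rational q
    leaves countably many null sets; every other x receives a default fibre.\<close>
  define good where "good x \<longleftrightarrow> (\<forall>q\<in>\<rat>. f q x \<le> 1) \<and> (\<forall>p\<in>\<rat>. \<forall>q\<in>\<rat>. p \<le> q \<longrightarrow> f q x \<le> f p x) \<and>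
     1 \<le> (SUP n::nat. f (- real n) x) \<and> (INF n::nat. f (real n) x) = 0" for x
  have good_AE: "AE x in \<mu>. good x"
  proof -
    have "AE x in \<mu>. \<forall>q\<in>\<rat>. f q x \<le> 1" using fle1 by (subst AE_ball_countable) (auto simp: countable_rat)
    moreover have "AE x in \<mu>. \<forall>p\<in>\<rat>. \<forall>q\<in>\<rat>. p \<le> q \<longrightarrow> f q x \<le> f p x"
      using fmono by (auto simp: AE_ball_countable countable_rat)
    ultimately show ?thesis using ftop fbot by eventually_elim (auto simp: good_def)
  qed
  have [measurable]: "Measurable.pred borel good"
  proof -
    have [measurable]: "f q \<in> borel_measurable borel" for q
      using f[of q] by (simp add: measurable_cong_sets[OF sets_\<mu> refl])
    show ?thesis unfolding good_def using countable_rat by measurable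
  qed
  \<comment> \<open>\<open>f\<close> decreases in q, so \<open>Q\<close> runs through the quantiles
    from top to bottom; reversing the levels does not change the law under
    \<open>unit_lborel\<close>.\<close>
  define Q where "Q u x = (if good x \<and> 0 < u \<and> u < 1 then Sup {q \<in> \<rat>. ennreal u \<le> f q x} else 0)" for u :: real and x
  \<comment> \<open>\<open>d n c\<close> is a dyadic rational strictly above c and decreases to c;
    the summand 1 forces strictness even when c itself is dyadic. Along it \<open>f\<close>
    increases to its right limit at c.\<close>
  define d :: "nat \<Rightarrow> real \<Rightarrow> real" where "d n c = (of_int \<lfloor>c * 2 ^ n\<rfloor> + 1) / 2 ^ n" for n :: nat and c :: real
  have dRat: "d n c \<in> \<rat>" for n c by (simp add: d_def)
  have dgt: "c < d n c" for n c
    by (simp add: d_def field_simps) linarith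
  have ddec: "d (Suc n) c \<le> d n c" for n c
  proof -
    have "\<lfloor>c * 2 ^ n * 2\<rfloor> \<le> 2 * \<lfloor>c * 2 ^ n\<rfloor> + 1" by linarith
    then have "of_int \<lfloor>c * 2 ^ Suc n\<rfloor> \<le> (2 * of_int \<lfloor>c * 2 ^ n\<rfloor> + 1 :: real)"
      by (simp add: mult_ac)
    then have "(of_int \<lfloor>c * 2 ^ Suc n\<rfloor> + 1) / 2 / 2 ^ n \<le> (of_int \<lfloor>c * 2 ^ n\<rfloor> + 1 :: real) / 2 ^ n"
      by (intro divide_right_mono) auto
    then show ?thesis by (simp add: d_def)
  qed
  have dlim: "\<exists>n. d n c < q" if cq: "c < q" for c q
  proof -
    obtain n where n: "(1/2) ^ n < q - c" using real_arch_pow_inv[of "q - c" "1/2"] cq by auto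
    have "d n c \<le> (c * 2 ^ n + 1) / 2 ^ n" unfolding d_def by (intro divide_right_mono) auto
    also have "\<dots> = c + (1/2)^n" by (simp add: add_divide_distrib power_one_over)
    finally have "d n c \<le> c + (1/2)^n" .
    then show ?thesis using n by (intro exI[of _ n]) linarith
  qed
  \<comment> \<open>Strict superlevel sets are used because the supremum need not be attained: c <
    \<open>Q u x\<close> means that some rational above c lies in the set, and by monotonicity some
    \<open>d n c\<close> does.\<close>
  have Q_gt: "c < Q u x \<longleftrightarrow> (\<exists>n. ennreal u \<le> f (d n c) x)" if "good x" "0 < u" "u < 1" for c u x
  proof -
    let ?S = "{q \<in> \<rat>. ennreal u \<le> f q x}"
    have g: "\<And>p q. p \<in> \<rat> \<Longrightarrow> q \<in> \<rat> \<Longrightarrow> p \<le> q \<Longrightarrow> f q x \<le> f p x" "1 \<le> (SUP n::nat. f (- real n) x)"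
      "(INF n::nat. f (real n) x) = 0" using that(1) by (auto simp: good_def)
    have "ennreal u < 1" using that ennreal_lessI[of 1 u] by simp
    then have "ennreal u < (SUP n::nat. f (- real n) x)" using g(2) by (rule less_le_trans)
    then obtain n :: nat where "ennreal u < f (- real n) x" by (auto simp: less_SUP_iff)
    then have ne: "?S \<noteq> {}" by (auto intro!: exI[of _ "- real n"] less_imp_le)
    have "(INF n::nat. f (real n) x) < ennreal u" using g(3) that by simp
    then obtain m :: nat where m: "f (real m) x < ennreal u" by (auto simp: INF_less_iff)
    have bdd: "bdd_above ?S"
    proof (rule bdd_aboveI)
      fix q assume "q \<in> ?S"
      then show "q \<le> real m" using g(1)[of "real m" q] m by (cases "real m \<le> q") (auto simp: not_le)
    qed
    have "c < Q u x \<longleftrightarrow> (\<exists>q\<in>?S. c < q)"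
      using less_cSup_iff[OF ne bdd] that by (simp add: Q_def)
    also have "\<dots> \<longleftrightarrow> (\<exists>n. ennreal u \<le> f (d n c) x)"
    proof
      assume "\<exists>q\<in>?S. c < q"
      then obtain q where q: "q \<in> \<rat>" "ennreal u \<le> f q x" "c < q" by auto
      obtain n where "d n c < q" using dlim[OF q(3)] by auto
      then show "\<exists>n. ennreal u \<le> f (d n c) x" using g(1)[OF dRat q(1), of n c] q(2) by (intro exI[of _ n]) auto
    qed (use dRat dgt in blast)
    finally show ?thesis .
  qed
  have Qm: "(\<lambda>(u, x). Q u x) \<in> borel_measurable (borel \<Otimes>\<^sub>M borel)"
  proof (subst borel_measurable_iff_greater, intro allI)
    fix c
    have [measurable]: "f q \<in> borel_measurable borel" for q
      using f[of q] by (simp add: measurable_cong_sets[OF sets_\<mu> refl])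
    have "{z \<in> space (borel \<Otimes>\<^sub>M borel). c < (case z of (u, x) \<Rightarrow> Q u x)}
       = {z \<in> space (borel \<Otimes>\<^sub>M borel). if good (snd z) \<and> 0 < fst z \<and> fst z < 1
            then \<exists>n. ennreal (fst z) \<le> f (d n c) (snd z) else c < 0}"
    proof (intro Collect_cong conj_cong refl)
      fix z :: "real \<times> 'a"
      show "(c < (case z of (u, x) \<Rightarrow> Q u x)) = (if good (snd z) \<and> 0 < fst z \<and> fst z < 1
            then \<exists>n. ennreal (fst z) \<le> f (d n c) (snd z) else c < 0)"
        using Q_gt[of "snd z" "fst z" c]
        by (cases "good (snd z) \<and> 0 < fst z \<and> fst z < 1") (auto simp: case_prod_beta Q_def)
    qed
    also have "\<dots> \<in> sets (borel \<Otimes>\<^sub>M borel)" by measurable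
    finally show "{z \<in> space (borel \<Otimes>\<^sub>M borel). c < (case z of (u, x) \<Rightarrow> Q u x)} \<in> sets (borel \<Otimes>\<^sub>M borel)" .
  qed
  have "\<nu> = graph_law Q"
  proof (rule measure_eqI_rays_times)
    fix c and B :: "'a set" assume B: "B \<in> sets borel"
    \<comment> \<open>On the fibre over x, the ray above c has as mass the right limit at c of the
      survival function. Monotone convergence then identifies its integral over B with the
      \<nu>-mass of the ray times B, since the rays above \<open>d n c\<close> exhaust the ray above
      c.\<close>
    have sl: "emeasure (distr unit_lborel borel (\<lambda>u. Q u x)) {\<xi>. (\<xi>, x) \<in> {c<..} \<times> B}
      = (SUP n. f (d n c) x) * indicator B x" if g: "good x" for x
    proof -
      have Qx: "(\<lambda>u. Q u x) \<in> borel_measurable unit_lborel"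
        using measurable_Pair1[OF Qm, of x] by (simp add: measurable_cong_sets[OF sets_unit_lborel refl])
      have le1: "f (d n c) x \<le> 1" for n using g dRat by (auto simp: good_def)
      have inc: "incseq (\<lambda>n. f (d n c) x)"
        by (rule incseq_SucI) (use g dRat ddec in \<open>auto simp: good_def\<close>)
      have f1: "f (d n c) x = ennreal (enn2real (f (d n c) x))" for n
        using le1[of n] by (metis ennreal_enn2real ennreal_one_less_top order_le_less_trans)
      have "emeasure (distr unit_lborel borel (\<lambda>u. Q u x)) {c<..} = emeasure unit_lborel {u. c < Q u x}"
        by (subst emeasure_distr[OF Qx]) (auto simp: vimage_def)
      also have "\<dots> = emeasure unit_lborel (\<Union>n. {..enn2real (f (d n c) x)})"
      proof (rule emeasure_eq_AE)
        show "AE u in unit_lborel. (u \<in> {u. c < Q u x}) = (u \<in> (\<Union>n. {..enn2real (f (d n c) x)}))"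
          using AE_unit_lborel
        proof eventually_elim
          case (elim u)
          have "ennreal u \<le> f (d n c) x \<longleftrightarrow> u \<le> enn2real (f (d n c) x)" for n
            by (subst f1) simp
          then show ?case using Q_gt[OF g, of u c] elim by auto
        qed
        show "{u. c < Q u x} \<in> sets unit_lborel"
          using measurable_sets[OF Qx, of "{c<..}"] by (simp add: vimage_def)
      qed auto
      also have "\<dots> = (SUP n. emeasure unit_lborel {..enn2real (f (d n c) x)})"
      proof (rule SUP_emeasure_incseq[symmetric])
        show "incseq (\<lambda>n. {..enn2real (f (d n c) x)})"
        proof (rule monoI, rule subsetI)
          fix m n :: nat and u assume mn: "m \<le> n" "u \<in> {..enn2real (f (d m c) x)}"
          have "f (d m c) x \<le> f (d n c) x" using inc mn by (auto dest: incseqD)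
          then have "enn2real (f (d m c) x) \<le> enn2real (f (d n c) x)"
            using le1[of n] by (intro enn2real_mono) (auto intro: le_less_trans)
          then show "u \<in> {..enn2real (f (d n c) x)}" using mn by auto
        qed
      qed auto
      also have "\<dots> = (SUP n. f (d n c) x)"
      proof (intro SUP_cong refl)
        fix n
        have "enn2real (f (d n c) x) \<le> 1" using le1[of n] by (metis enn2real_1 enn2real_mono ennreal_one_less_top)
        then show "emeasure unit_lborel {..enn2real (f (d n c) x)} = f (d n c) x"
          by (simp add: emeasure_unit_lborel_atMost f1[symmetric])
      qed
      finally show ?thesis by (auto simp: indicator_def greaterThan_def)
    qed
    have "emeasure (graph_law Q) ({c<..} \<times> B) = (\<integral>\<^sup>+x. (SUP n. f (d n c) x * indicator B x) \<partial>\<mu>)"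
    proof -
      have "emeasure (distr unit_lborel borel (\<lambda>u. Q u x)) {\<xi>. (\<xi>, x) \<in> {c<..} \<times> B}
          = (SUP n. f (d n c) x * indicator B x)" if "good x" for x
        unfolding sl[OF that] by (cases "x \<in> B") auto
      then have "AE x in \<mu>. emeasure (distr unit_lborel borel (\<lambda>u. Q u x)) {\<xi>. (\<xi>, x) \<in> {c<..} \<times> B}
          = (SUP n. f (d n c) x * indicator B x)"
        using good_AE by (auto elim: eventually_mono)
      moreover have "{c<..} \<times> B \<in> sets borel" using B by (simp add: sets_borel_prod[symmetric])
      ultimately show ?thesis by (simp only: emeasure_graph_law[OF Qm] nn_integral_cong_AE)
    qed
    also have "\<dots> = (SUP n. \<integral>\<^sup>+x. f (d n c) x * indicator B x \<partial>\<mu>)"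
    proof (rule nn_integral_monotone_convergence_SUP_AE)
      show "AE x in \<mu>. f (d n c) x * indicator B x \<le> f (d (Suc n) c) x * indicator B x" for n
        using fmono[OF ddec] by eventually_elim (auto intro: mult_right_mono)
    qed (use B in \<open>auto simp: sets_\<mu>\<close>)
    also have "\<dots> = (SUP n. emeasure \<nu> ({d n c<..} \<times> B))" using B by (simp add: fint)
    also have "\<dots> = emeasure \<nu> (\<Union>n. {d n c<..} \<times> B)"
      by (rule SUP_emeasure_incseq)
         (use B lift_Suc_antimono_le[of "\<lambda>n. d n c"] ddec in \<open>auto simp: \<nu>' incseq_def intro: le_less_trans\<close>)
    also have "(\<Union>n. {d n c<..} \<times> B) = {c<..} \<times> B"
      using dlim dgt by auto (meson less_trans)
    finally show "emeasure \<nu> ({c<..} \<times> B) = emeasure (graph_law Q) ({c<..} \<times> B)" by simp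
  qed (auto simp: \<nu> N.finite_measure_axioms)
  then show ?thesis using is_disintegration_graph_law[OF Qm] by auto
qed

end

lemma Cauchy_Schwarz_integral:
  fixes f g :: "'a \<Rightarrow> real"
  assumes [measurable]: "f \<in> borel_measurable M" "g \<in> borel_measurable M"
    and f2: "integrable M (\<lambda>x. (f x)\<^sup>2)" and g2: "integrable M (\<lambda>x. (g x)\<^sup>2)"
  shows "integrable M (\<lambda>x. f x * g x)"
    and "(LINT x|M. \<bar>f x * g x\<bar>) \<le> sqrt (LINT x|M. (f x)\<^sup>2) * sqrt (LINT x|M. (g x)\<^sup>2)"
proof -
  show fg: "integrable M (\<lambda>x. f x * g x)"
  proof (rule Bochner_Integration.integrable_bound[OF Bochner_Integration.integrable_add[OF f2 g2]])
    show "AE x in M. norm (f x * g x) \<le> norm ((f x)\<^sup>2 + (g x)\<^sup>2)"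
    proof (rule AE_I2)
      fix x
      have "2 * \<bar>f x * g x\<bar> \<le> (f x)\<^sup>2 + (g x)\<^sup>2"
        using sum_squares_bound[of "\<bar>f x\<bar>" "\<bar>g x\<bar>"] by (simp add: abs_mult)
      then show "norm (f x * g x) \<le> norm ((f x)\<^sup>2 + (g x)\<^sup>2)"
        unfolding real_norm_def using abs_ge_zero[of "f x * g x"] by linarith
    qed
  qed measurable
  have "(\<integral>\<^sup>+x. ennreal \<bar>f x\<bar> * ennreal \<bar>g x\<bar> \<partial>M)\<^sup>2
      \<le> (\<integral>\<^sup>+x. ennreal \<bar>f x\<bar> ^ 2 \<partial>M) * (\<integral>\<^sup>+x. ennreal \<bar>g x\<bar> ^ 2 \<partial>M)"
    by (rule Cauchy_Schwarz_nn_integral) auto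
  also have "(\<integral>\<^sup>+x. ennreal \<bar>f x\<bar> ^ 2 \<partial>M) = ennreal (LINT x|M. (f x)\<^sup>2)"
    by (subst nn_integral_eq_integral[OF f2, symmetric]) (auto simp: ennreal_power)
  also have "(\<integral>\<^sup>+x. ennreal \<bar>g x\<bar> ^ 2 \<partial>M) = ennreal (LINT x|M. (g x)\<^sup>2)"
    by (subst nn_integral_eq_integral[OF g2, symmetric]) (auto simp: ennreal_power)
  also have "(\<integral>\<^sup>+x. ennreal \<bar>f x\<bar> * ennreal \<bar>g x\<bar> \<partial>M) = ennreal (LINT x|M. \<bar>f x * g x\<bar>)"
    by (subst nn_integral_eq_integral[symmetric])
      (use fg in \<open>auto simp: abs_mult ennreal_mult intro!: integrable_abs[of _ "\<lambda>x. f x * g x", simplified abs_mult]\<close>)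
  finally have "(LINT x|M. \<bar>f x * g x\<bar>)\<^sup>2 \<le> (LINT x|M. (f x)\<^sup>2) * (LINT x|M. (g x)\<^sup>2)"
    by (simp add: ennreal_power ennreal_mult[symmetric])
  then show "(LINT x|M. \<bar>f x * g x\<bar>) \<le> sqrt (LINT x|M. (f x)\<^sup>2) * sqrt (LINT x|M. (g x)\<^sup>2)"
    unfolding real_sqrt_mult[symmetric] by (rule real_le_rsqrt)
qed

lemma (in prob_space) integral_abs_le_sqrt:
  fixes f :: "'a \<Rightarrow> real"
  assumes [measurable]: "f \<in> borel_measurable M" and f2: "integrable M (\<lambda>x. (f x)\<^sup>2)"
  shows "integrable M f" and "(LINT x|M. \<bar>f x\<bar>) \<le> sqrt (LINT x|M. (f x)\<^sup>2)"
  using Cauchy_Schwarz_integral[of f M "\<lambda>_. 1"] f2 by (simp_all add: prob_space)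

section \<open>Fibred measures as square-integrable functions of level and base point\<close>

context marginal_space
begin

definition qfun :: "(real \<times> 'a) measure \<Rightarrow> real \<Rightarrow> 'a \<Rightarrow> real" where
  "qfun \<nu> u x = quantile (disintegration \<mu> \<nu> x) u"

lemma P2_marginalD:
  assumes "\<nu> \<in> P2_marginal \<mu>"
  shows "sets \<nu> = sets borel" "prob_space \<nu>" "integrable \<nu> (\<lambda>z. (norm z)\<^sup>2)" "distr \<nu> borel snd = \<mu>"
  using assms by (auto simp: P2_marginal_def)

lemma is_disintegration_disintegration:
  "\<nu> \<in> P2_marginal \<mu> \<Longrightarrow> is_disintegration \<mu> \<nu> (disintegration \<mu> \<nu>)"
  using disintegration_exists[OF P2_marginalD(1,2,4)] unfolding disintegration_def by (rule someI_ex)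

text \<open>Valid for every x and not just almost every one, since the kernel maps all of
  \<open>UNIV\<close> into \<open>prob_algebra borel\<close>. Hence no exceptional fibres have to be
  carried along.\<close>

lemma real_distribution_disintegration:
  assumes "\<nu> \<in> P2_marginal \<mu>" shows "real_distribution (disintegration \<mu> \<nu> x)"
proof -
  have "disintegration \<mu> \<nu> \<in> \<mu> \<rightarrow>\<^sub>M prob_algebra borel"
    using is_disintegration_disintegration[OF assms] by (auto simp: is_disintegration_def)
  from measurable_space[OF this, of x] show ?thesis
    by (auto simp: space_prob_algebra intro: real_distribution_alt)
qed

lemma qfun_measurable:
  assumes "\<nu> \<in> P2_marginal \<mu>"
  shows "(\<lambda>(u, x). qfun \<nu> u x) \<in> borel_measurable (borel \<Otimes>\<^sub>M borel)"
proof -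
  have "disintegration \<mu> \<nu> \<in> \<mu> \<rightarrow>\<^sub>M prob_algebra borel"
    using is_disintegration_disintegration[OF assms] by (auto simp: is_disintegration_def)
  from quantile_measurable_kernel[OF this] show ?thesis
    unfolding qfun_def using measurable_cong_sets[OF sets_pair_measure_cong[OF refl sets_\<mu>] refl] by blast
qed

lemma graph_law_qfun:
  assumes "\<nu> \<in> P2_marginal \<mu>" shows "graph_law (qfun \<nu>) = \<nu>"
proof (rule graph_law_eqI[symmetric, OF _ is_disintegration_disintegration[OF assms] qfun_measurable[OF assms]])
  show "AE x in \<mu>. disintegration \<mu> \<nu> x = distr unit_lborel borel (\<lambda>u. qfun \<nu> u x)"
    using distr_quantile[OF real_distribution_disintegration[OF assms]]
    by (auto simp: qfun_def)
qed (use assms in \<open>auto dest: P2_marginalD\<close>)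

lemma measurable_on_P:
  "(\<lambda>(u, x). q u x) \<in> borel_measurable (borel \<Otimes>\<^sub>M borel) \<Longrightarrow> (\<lambda>z. q (fst z) (snd z)) \<in> borel_measurable P"
  by (simp add: split_beta' measurable_cong_sets[OF sets_P refl])

lemma
  fixes f :: "real \<times> 'a \<Rightarrow> real"
  assumes q: "(\<lambda>(u, x). q u x) \<in> borel_measurable (borel \<Otimes>\<^sub>M borel)" and f: "f \<in> borel_measurable borel"
  shows integral_graph_law: "(LINT z|graph_law q. f z) = (LINT z|P. f (q (fst z) (snd z), snd z))"
    and integrable_graph_law: "integrable (graph_law q) f \<longleftrightarrow> integrable P (\<lambda>z. f (q (fst z) (snd z), snd z))"
  using integral_distr[OF measurable_graph[OF q] f] integrable_distr_eq[OF measurable_graph[OF q] f]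
  by (simp_all add: graph_law_def split_beta')

lemma fst_snd_borel [measurable]:
  "fst \<in> (borel :: (real \<times> 'a) measure) \<rightarrow>\<^sub>M borel" "snd \<in> (borel :: (real \<times> 'a) measure) \<rightarrow>\<^sub>M borel"
  by (auto intro!: borel_measurable_continuous_onI continuous_intros)

lemma integrable_fst_sq: assumes \<nu>: "\<nu> \<in> P2_marginal \<mu>" shows "integrable \<nu> (\<lambda>z. (fst z)\<^sup>2)"
proof -
  note [measurable_cong] = P2_marginalD(1)[OF \<nu>]
  show ?thesis
  proof (rule Bochner_Integration.integrable_bound[OF P2_marginalD(3)[OF \<nu>]])
    show "AE z in \<nu>. norm ((fst z)\<^sup>2) \<le> norm ((norm z)\<^sup>2)"
    proof (rule AE_I2)
      fix z :: "real \<times> 'a"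
      have "\<bar>fst z\<bar> \<le> norm z" using norm_fst_le[of "fst z" "snd z"] by simp
      then show "norm ((fst z)\<^sup>2) \<le> norm ((norm z)\<^sup>2)" by (simp add: abs_le_square_iff[symmetric])
    qed
  qed measurable
qed

lemma integrable_qfun_sq:
  assumes "\<nu> \<in> P2_marginal \<mu>" shows "integrable P (\<lambda>z. (qfun \<nu> (fst z) (snd z))\<^sup>2)"
  using integrable_fst_sq[OF assms] integrable_graph_law[OF qfun_measurable[OF assms], of "\<lambda>z. (fst z)\<^sup>2"]
  by (simp add: graph_law_qfun[OF assms])

lemma integrable_sq_diff:
  fixes f g :: "_ \<Rightarrow> real"
  assumes [measurable]: "f \<in> borel_measurable M" "g \<in> borel_measurable M"
    and f2: "integrable M (\<lambda>x. (f x)\<^sup>2)" and g2: "integrable M (\<lambda>x. (g x)\<^sup>2)"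
  shows "integrable M (\<lambda>x. (f x - g x)\<^sup>2)"
  unfolding power2_diff using Cauchy_Schwarz_integral(1)[OF assms] f2 g2
  by (auto simp: mult.assoc)

lemma integrable_qfun_diff_sq:
  assumes "\<nu>1 \<in> P2_marginal \<mu>" "\<nu>2 \<in> P2_marginal \<mu>"
  shows "integrable P (\<lambda>z. (qfun \<nu>1 (fst z) (snd z) - qfun \<nu>2 (fst z) (snd z))\<^sup>2)"
  using assms by (intro integrable_sq_diff integrable_qfun_sq measurable_on_P qfun_measurable)

lemma nn_integral_P_snd:
  assumes [measurable]: "f \<in> borel_measurable P"
  shows "(\<integral>\<^sup>+x. \<integral>\<^sup>+u. f (u, x) \<partial>unit_lborel \<partial>\<mu>) = (\<integral>\<^sup>+z. f z \<partial>P)"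
  by (rule P.nn_integral_snd) simp

text \<open>The quantile map embeds \<open>P2_marginal \<mu>\<close> isometrically into L^2 of
  \<open>P\<close>. Finiteness, symmetry and the comparison of second moments become facts about
  functions, without any argument on couplings.\<close>

lemma L2_d2_eq:
  assumes \<nu>: "\<nu>1 \<in> P2_marginal \<mu>" "\<nu>2 \<in> P2_marginal \<mu>"
  shows "L2_d2 \<mu> \<nu>1 \<nu>2 = sqrt (LINT z|P. (qfun \<nu>1 (fst z) (snd z) - qfun \<nu>2 (fst z) (snd z))\<^sup>2)"
proof -
  note [measurable] = measurable_on_P[OF qfun_measurable[OF \<nu>(1)]] measurable_on_P[OF qfun_measurable[OF \<nu>(2)]]
  have "(\<integral>\<^sup>+ x. wasserstein2_sq (disintegration \<mu> \<nu>1 x) (disintegration \<mu> \<nu>2 x) \<partial>\<mu>)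
     = (\<integral>\<^sup>+x. \<integral>\<^sup>+u. ennreal ((qfun \<nu>1 u x - qfun \<nu>2 u x)\<^sup>2) \<partial>unit_lborel \<partial>\<mu>)"
    by (simp add: wasserstein2_sq_quantile real_distribution_disintegration \<nu> qfun_def)
  also have "\<dots> = (\<integral>\<^sup>+z. ennreal ((qfun \<nu>1 (fst z) (snd z) - qfun \<nu>2 (fst z) (snd z))\<^sup>2) \<partial>P)"
    by (subst nn_integral_P_snd[symmetric]) simp_all
  also have "\<dots> = ennreal (LINT z|P. (qfun \<nu>1 (fst z) (snd z) - qfun \<nu>2 (fst z) (snd z))\<^sup>2)"
    by (rule nn_integral_eq_integral) (auto intro: integrable_qfun_diff_sq \<nu>)
  finally show ?thesis unfolding L2_d2_def by simp
qed

text \<open>Any two realisations on \<open>P\<close> couple the fibres over the same x, so they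
  bound the distance from above. The integrability hypothesis rules out the default value 0 of the
  integral on the right.\<close>

lemma L2_d2_le:
  assumes q1: "(\<lambda>(u, x). q1 u x) \<in> borel_measurable (borel \<Otimes>\<^sub>M borel)"
    and q2: "(\<lambda>(u, x). q2 u x) \<in> borel_measurable (borel \<Otimes>\<^sub>M borel)"
    and ae1: "AE x in \<mu>. disintegration \<mu> \<nu>1 x = distr unit_lborel borel (\<lambda>u. q1 u x)"
    and ae2: "AE x in \<mu>. disintegration \<mu> \<nu>2 x = distr unit_lborel borel (\<lambda>u. q2 u x)"
    and int: "integrable P (\<lambda>z. (q1 (fst z) (snd z) - q2 (fst z) (snd z))\<^sup>2)"
  shows "L2_d2 \<mu> \<nu>1 \<nu>2 \<le> sqrt (LINT z|P. (q1 (fst z) (snd z) - q2 (fst z) (snd z))\<^sup>2)"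
proof -
  note [measurable] = measurable_on_P[OF q1] measurable_on_P[OF q2]
  have m: "(\<lambda>u. q1 u x) \<in> borel_measurable borel" "(\<lambda>u. q2 u x) \<in> borel_measurable borel" for x
    using measurable_Pair1[OF q1] measurable_Pair1[OF q2] by simp_all
  have "(\<integral>\<^sup>+ x. wasserstein2_sq (disintegration \<mu> \<nu>1 x) (disintegration \<mu> \<nu>2 x) \<partial>\<mu>)
     \<le> (\<integral>\<^sup>+x. \<integral>\<^sup>+u. ennreal ((q1 u x - q2 u x)\<^sup>2) \<partial>unit_lborel \<partial>\<mu>)"
    by (rule nn_integral_mono_AE) (use ae1 ae2 in eventually_elim, simp add: wasserstein2_sq_le_unit m)
  also have "\<dots> = (\<integral>\<^sup>+z. ennreal ((q1 (fst z) (snd z) - q2 (fst z) (snd z))\<^sup>2) \<partial>P)"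
    by (subst nn_integral_P_snd[symmetric]) simp_all
  also have "\<dots> = ennreal (LINT z|P. (q1 (fst z) (snd z) - q2 (fst z) (snd z))\<^sup>2)"
    by (rule nn_integral_eq_integral) (auto intro: int)
  finally show ?thesis unfolding L2_d2_def
    by (intro real_sqrt_le_mono enn2real_leI) auto
qed

end

section \<open>Curves of fibred measures\<close>

text \<open>Time is clamped to [0,T], so the curve is constant outside. Measurability, continuity
  and moment bounds can then be stated on the whole real line, with two-sided limits.\<close>

locale marginal_curve = marginal_space +
  fixes T :: real and \<sigma> :: "real \<Rightarrow> (real \<times> 'a) measure"
  assumes T: "0 < T"
    and P2: "\<And>t. \<sigma> t \<in> P2_marginal \<mu>"
    and clamp: "\<And>t. \<sigma> t = \<sigma> (max 0 (min T t))"
    and cont: "\<And>t. ((\<lambda>s. L2_d2 \<mu> (\<sigma> s) (\<sigma> t)) \<longlongrightarrow> 0) (at t)"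
begin

abbreviation "Q t z \<equiv> qfun (\<sigma> t) (fst z) (snd z)"

sublocale S: prob_space "\<sigma> t" for t by (rule P2_marginalD(2)[OF P2])

lemma sets_\<sigma> [simp, measurable_cong]: "sets (\<sigma> t) = sets borel"
  by (rule P2_marginalD(1)[OF P2])

lemma space_\<sigma> [simp]: "space (\<sigma> t) = UNIV"
  using sets_eq_imp_space_eq[OF sets_\<sigma>] by simp

lemma Q_measurable [measurable]: "Q t \<in> borel_measurable P"
  by (rule measurable_on_P[OF qfun_measurable[OF P2]])

lemma integral_\<sigma>:
  fixes f :: "real \<times> 'a \<Rightarrow> real"
  shows "f \<in> borel_measurable borel \<Longrightarrow> (LINT z|\<sigma> t. f z) = (LINT z|P. f (Q t z, snd z))"
  using integral_graph_law[OF qfun_measurable[OF P2]] by (simp add: graph_law_qfun[OF P2])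

text \<open>By the L^2 isometry the second moment at t is at most twice that at s plus twice the
  squared distance, hence locally bounded; \<open>Bolzano\<close> extends this to the compact
  interval.\<close>

lemma moment_bound: "\<exists>M\<ge>0. \<forall>t. (LINT z|\<sigma> t. (fst z)\<^sup>2) \<le> M\<^sup>2"
proof -
  define m where "m t = (LINT z|P. (Q t z)\<^sup>2)" for t
  have m: "(LINT z|\<sigma> t. (fst z)\<^sup>2) = m t" for t by (simp add: integral_\<sigma> m_def)
  have m2: "m t \<le> 2 * m s + 2 * (L2_d2 \<mu> (\<sigma> t) (\<sigma> s))\<^sup>2" for s t
  proof -
    have "m t \<le> (LINT z|P. 2 * (Q s z)\<^sup>2 + 2 * (Q t z - Q s z)\<^sup>2)"
      unfolding m_def
    proof (rule integral_mono)
      fix z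
      have "(Q t z)\<^sup>2 = (Q s z + (Q t z - Q s z))\<^sup>2" by simp
      also have "\<dots> \<le> 2 * (Q s z)\<^sup>2 + 2 * (Q t z - Q s z)\<^sup>2"
        using sum_squares_bound[of "Q s z" "Q t z - Q s z"] by (subst power2_sum) linarith
      finally show "(Q t z)\<^sup>2 \<le> 2 * (Q s z)\<^sup>2 + 2 * (Q t z - Q s z)\<^sup>2" .
    qed (auto intro!: integrable_qfun_sq integrable_qfun_diff_sq P2)
    also have "\<dots> = 2 * m s + 2 * (L2_d2 \<mu> (\<sigma> t) (\<sigma> s))\<^sup>2"
      unfolding m_def L2_d2_eq[OF P2 P2]
      by (subst Bochner_Integration.integral_add) (auto intro!: integrable_qfun_sq integrable_qfun_diff_sq P2)
    finally show ?thesis .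
  qed
  have "\<exists>C. \<forall>t\<in>{0..T}. m t \<le> C"
  proof (rule Bolzano[of 0 T "\<lambda>a b. \<exists>C. \<forall>t\<in>{a..b}. m t \<le> C"])
    fix a b c assume "\<exists>C. \<forall>t\<in>{a..b}. m t \<le> C" "\<exists>C. \<forall>t\<in>{b..c}. m t \<le> C"
    then obtain C D where "\<forall>t\<in>{a..b}. m t \<le> C" "\<forall>t\<in>{b..c}. m t \<le> D" by blast
    then have "\<forall>t\<in>{a..c}. m t \<le> max C D" by (metis atLeastAtMost_iff le_max_iff_disj linorder_le_cases)
    then show "\<exists>C. \<forall>t\<in>{a..c}. m t \<le> C" by blast
  next
    fix s assume "0 \<le> s" "s \<le> T"
    have "\<forall>\<^sub>F t in at s. L2_d2 \<mu> (\<sigma> t) (\<sigma> s) < 1"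
      using cont[of s] by (rule order_tendstoD) simp
    then obtain d where d: "d > 0" "\<And>t. t \<noteq> s \<Longrightarrow> dist t s < d \<Longrightarrow> L2_d2 \<mu> (\<sigma> t) (\<sigma> s) < 1"
      by (auto simp: eventually_at)
    have "m t \<le> 2 * m s + 2" if "dist t s < d" for t
    proof (cases "t = s")
      case True
      have "0 \<le> m s" by (auto simp: m_def)
      then show ?thesis using True by simp
    next
      case False
      have "0 \<le> L2_d2 \<mu> (\<sigma> t) (\<sigma> s)" by (simp add: L2_d2_def)
      then have "(L2_d2 \<mu> (\<sigma> t) (\<sigma> s))\<^sup>2 \<le> 1" using d(2)[OF False that] by (simp add: power_le_one)
      then show ?thesis using m2[of t s] by linarith
    qed
    then have "\<forall>a b. a \<le> s \<and> s \<le> b \<and> b - a < d \<longrightarrow> (\<forall>t\<in>{a..b}. m t \<le> 2 * m s + 2)"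
      by (auto simp: dist_real_def)
    then show "\<exists>d>0. \<forall>a b. a \<le> s \<and> s \<le> b \<and> b - a < d \<longrightarrow> (\<exists>C. \<forall>t\<in>{a..b}. m t \<le> C)"
      using d(1) by blast
  qed (use T in simp)
  then obtain C where C: "\<And>t. t \<in> {0..T} \<Longrightarrow> m t \<le> C" by blast
  have "m t \<le> (sqrt (max C 0))\<^sup>2" for t
    using C[of "max 0 (min T t)"] T clamp[of t] by (auto simp: m_def)
  then show ?thesis by (intro exI[of _ "sqrt (max C 0)"]) (auto simp: m)
qed

lemma integrable_linear_growth:
  fixes f :: "real \<times> 'a \<Rightarrow> real"
  assumes [measurable]: "f \<in> borel_measurable borel" and f: "\<And>z. \<bar>f z\<bar> \<le> C + D * \<bar>fst z\<bar>"
  shows "integrable (\<sigma> t) f"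
proof (rule Bochner_Integration.integrable_bound)
  have "integrable (\<sigma> t) fst"
    by (rule S.integral_abs_le_sqrt) (auto intro: integrable_fst_sq P2)
  then show "integrable (\<sigma> t) (\<lambda>z. C + D * \<bar>fst z\<bar>)" by auto
  show "AE z in \<sigma> t. norm (f z) \<le> norm (C + D * \<bar>fst z\<bar>)"
    unfolding real_norm_def by (intro AE_I2 order_trans[OF f abs_ge_self])
qed auto

text \<open>The distance compares masses within a fibre only, so f has to be Lipschitz in \<xi> but
  merely measurable in x. The bound at \<xi> = 0 makes f integrable.\<close>

lemma integral_Lipschitz_diff:
  fixes f :: "real \<times> 'a \<Rightarrow> real"
  assumes [measurable]: "f \<in> borel_measurable borel"
    and L: "\<And>\<xi> \<zeta> x. \<bar>f (\<xi>, x) - f (\<zeta>, x)\<bar> \<le> L * \<bar>\<xi> - \<zeta>\<bar>" and C: "\<And>x. \<bar>f (0, x)\<bar> \<le> C"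
  shows "\<bar>(LINT z|\<sigma> s. f z) - (LINT z|\<sigma> t. f z)\<bar> \<le> L * L2_d2 \<mu> (\<sigma> s) (\<sigma> t)"
proof -
  have L0: "0 \<le> L" using order_trans[OF abs_ge_zero L[of 1 undefined 0]] by simp
  have bd: "\<bar>f z\<bar> \<le> C + L * \<bar>fst z\<bar>" for z
    using L[of "fst z" "snd z" 0] C[of "snd z"] by (simp add: abs_le_iff)
  have int: "integrable P (\<lambda>z. f (Q t z, snd z))" for t
    using integrable_linear_growth[OF _ bd, of t] integrable_graph_law[OF qfun_measurable[OF P2], of f t]
    by (simp add: graph_law_qfun[OF P2])
  have PP: "prob_space P" by unfold_locales
  have d: "integrable P (\<lambda>z. Q s z - Q t z)" "(LINT z|P. \<bar>Q s z - Q t z\<bar>) \<le> L2_d2 \<mu> (\<sigma> s) (\<sigma> t)"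
    using prob_space.integral_abs_le_sqrt[OF PP, of "\<lambda>z. Q s z - Q t z"] integrable_qfun_diff_sq[OF P2 P2]
    by (auto simp: L2_d2_eq[OF P2 P2])
  have "\<bar>(LINT z|\<sigma> s. f z) - (LINT z|\<sigma> t. f z)\<bar> = \<bar>LINT z|P. f (Q s z, snd z) - f (Q t z, snd z)\<bar>"
    by (simp add: integral_\<sigma> int)
  also have "\<dots> \<le> (LINT z|P. \<bar>f (Q s z, snd z) - f (Q t z, snd z)\<bar>)" by (rule integral_abs_bound)
  also have "\<dots> \<le> (LINT z|P. L * \<bar>Q s z - Q t z\<bar>)"
    using d(1) int L by (intro integral_mono) auto
  also have "\<dots> \<le> L * L2_d2 \<mu> (\<sigma> s) (\<sigma> t)" using d(2) L0 by (auto intro: mult_left_mono)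
  finally show ?thesis .
qed

lemma continuous_integral_Lipschitz:
  fixes f :: "real \<times> 'a \<Rightarrow> real"
  assumes "f \<in> borel_measurable borel"
    and "\<And>\<xi> \<zeta> x. \<bar>f (\<xi>, x) - f (\<zeta>, x)\<bar> \<le> L * \<bar>\<xi> - \<zeta>\<bar>" "\<And>x. \<bar>f (0, x)\<bar> \<le> C"
  shows "continuous_on UNIV (\<lambda>t. LINT z|\<sigma> t. f z)"
  unfolding continuous_on_def
proof
  fix t :: real
  have "((\<lambda>s. (LINT z|\<sigma> s. f z) - (LINT z|\<sigma> t. f z)) \<longlongrightarrow> 0) (at t)"
  proof (rule Lim_null_comparison)
    show "\<forall>\<^sub>F s in at t. norm ((LINT z|\<sigma> s. f z) - (LINT z|\<sigma> t. f z)) \<le> L * L2_d2 \<mu> (\<sigma> s) (\<sigma> t)"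
      using integral_Lipschitz_diff[OF assms] by simp
    show "((\<lambda>s. L * L2_d2 \<mu> (\<sigma> s) (\<sigma> t)) \<longlongrightarrow> 0) (at t)"
      using tendsto_mult[OF tendsto_const[of L] cont[of t]] by simp
  qed
  then show "((\<lambda>t. LINT z|\<sigma> t. f z) \<longlongrightarrow> (LINT z|\<sigma> t. f z)) (at t)"
    by (simp add: LIM_zero_iff)
qed

text \<open>Open rays times Borel sets generate the product. The indicator of a ray is the limit of
  the ramps in \<open>f n\<close>, which are Lipschitz in \<xi>, so their integrals are continuous
  in t by \<open>continuous_integral_Lipschitz\<close>; the cut-off in x may stay
  discontinuous.\<close>

lemma \<sigma>_kernel [measurable]: "\<sigma> \<in> borel \<rightarrow>\<^sub>M prob_algebra borel"
proof (rule measurable_prob_algebra_generated)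
  let ?G = "{a \<times> b |a b. a \<in> range greaterThan \<and> b \<in> sets (borel :: 'a measure)} :: (real \<times> 'a) set set"
  have "sets (borel \<Otimes>\<^sub>M borel) = sets (sigma (space borel \<times> space borel) ?G)"
  proof (rule sets_pair_eq)
    show "sets (borel :: real measure) = sigma_sets (space borel) (range greaterThan)"
      by (subst borel_Ioi) (simp add: sets_measure_of)
    show "range (\<lambda>n::nat. {- real n<..}) \<subseteq> range greaterThan" by auto
    show "\<Union> (range (\<lambda>n::nat. {- real n<..})) = space borel"
      by auto (metis minus_less_iff reals_Archimedean2)
    show "sets (borel :: 'a measure) = sigma_sets (space borel) (sets borel)"
      by (metis sets.sigma_sets_eq)
    show "{UNIV} \<subseteq> sets (borel :: 'a measure)" by auto
  qed auto
  then show "sets (borel :: (real \<times> 'a) measure) = sigma_sets UNIV ?G"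
    by (simp add: sets_borel_prod)
  show "Int_stable ?G"
  proof (rule Int_stableI, clarsimp)
    fix c d :: real and b b' :: "'a set" assume b: "b \<in> sets borel" "b' \<in> sets borel"
    have "{c<..} \<times> b \<inter> {d<..} \<times> b' = {max c d<..} \<times> (b \<inter> b')" by auto
    then show "\<exists>x y. {c<..} \<times> b \<inter> {d<..} \<times> b' = x \<times> y \<and> x \<in> range greaterThan \<and> y \<in> sets borel"
      using b by blast
  qed
  fix A assume "A \<in> ?G"
  then obtain c B where A: "A = {c<..} \<times> B" and B[measurable]: "B \<in> sets borel" by auto
  define f where "f n z = min 1 (max 0 (real n * (fst z - c))) * indicator B (snd z)" for n and z :: "real \<times> 'a"
  have [measurable]: "f n \<in> borel_measurable borel" for n unfolding f_def by measurable
  have "(\<lambda>t. LINT z|\<sigma> t. f n z) \<in> borel_measurable borel" for n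
  proof (rule borel_measurable_continuous_onI, rule continuous_integral_Lipschitz)
    fix \<xi> \<zeta> x
    have "\<bar>min 1 (max 0 (real n * (\<xi> - c))) - min 1 (max 0 (real n * (\<zeta> - c)))\<bar>
        \<le> \<bar>real n * (\<xi> - c) - real n * (\<zeta> - c)\<bar>" by linarith
    also have "\<dots> = real n * \<bar>\<xi> - \<zeta>\<bar>" by (simp add: abs_mult flip: right_diff_distrib)
    finally show "\<bar>f n (\<xi>, x) - f n (\<zeta>, x)\<bar> \<le> real n * \<bar>\<xi> - \<zeta>\<bar>"
      by (auto simp: f_def indicator_def)
    show "\<bar>f n (0, x)\<bar> \<le> 1" by (auto simp: f_def indicator_def)
  qed simp
  moreover have "(\<lambda>n. LINT z|\<sigma> t. f n z) \<longlonglongrightarrow> measure (\<sigma> t) A" for t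
  proof -
    have "(\<lambda>n. LINT z|\<sigma> t. f n z) \<longlonglongrightarrow> (LINT z|\<sigma> t. indicator A z)"
    proof (rule integral_dominated_convergence[where w="\<lambda>_. 1"])
      show "indicator A \<in> borel_measurable (\<sigma> t)"
        unfolding A by (intro borel_measurable_indicator) (simp add: sets_borel_prod[symmetric])
      show "AE z in \<sigma> t. (\<lambda>n. f n z) \<longlonglongrightarrow> indicator A z"
      proof (rule AE_I2)
        fix z
        show "(\<lambda>n. f n z) \<longlonglongrightarrow> indicator A z"
        proof (cases "z \<in> A")
          case True
          then have z: "0 < fst z - c" "snd z \<in> B" by (auto simp: A)
          obtain N :: nat where N: "1 / (fst z - c) < real N" using reals_Archimedean2 by blast
          have "f n z = 1" if "n \<ge> N" for n
          proof -
            have "1 / (fst z - c) < real n" using N that by linarith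
            then show ?thesis using z by (simp add: f_def field_simps)
          qed
          then have "\<forall>\<^sub>F n in sequentially. f n z = 1" by (auto simp: eventually_sequentially)
          then show ?thesis using True by (simp add: tendsto_eventually)
        next
          case False
          then have "snd z \<notin> B \<or> real n * (fst z - c) \<le> 0" for n
            by (cases z) (auto simp: A intro: mult_nonneg_nonpos)
          then have "f n z = 0" for n
            by (metis f_def indicator_simps(2) max.absorb1 min.absorb2 mult_zero_left mult_zero_right zero_le_one)
          then show ?thesis using False by simp
        qed
      qed
    qed (auto simp: f_def indicator_def)
    then show ?thesis by simp
  qed
  ultimately have "(\<lambda>t. measure (\<sigma> t) A) \<in> borel_measurable borel"
    by (rule borel_measurable_LIMSEQ_real[rotated])
  then show "(\<lambda>t. emeasure (\<sigma> t) A) \<in> borel_measurable borel"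
    by (simp add: S.emeasure_eq_measure)
qed (auto simp: S.prob_space_axioms)

end

section \<open>Characteristics\<close>

lemma set_integrable_const_Icc: "set_integrable lborel {a..b::real} (\<lambda>_. c::real)"
  by (rule borel_integrable_atLeastAtMost') auto

lemma LBINT_exp_le:
  fixes a t :: real
  assumes "0 < a" "0 \<le> t"
  shows "set_integrable lborel {0..t} (\<lambda>s. exp (a * s))" "(LBINT s:{0..t}. exp (a * s)) \<le> exp (a * t) / a"
proof -
  have *: "has_bochner_integral lborel (\<lambda>s. exp (a * s) * indicator {0..t} s) (exp (a * t) / a - exp (a * 0) / a)"
    by (rule has_bochner_integral_FTC_Icc_real[where F="\<lambda>s. exp (a * s) / a"])
       (use assms in \<open>auto intro!: derivative_eq_intros continuous_intros\<close>)
  then show "set_integrable lborel {0..t} (\<lambda>s. exp (a * s))"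
    by (simp add: set_integrable_def has_bochner_integral_iff mult.commute)
  have "(LBINT s:{0..t}. exp (a * s)) = exp (a * t) / a - 1 / a"
    using * by (simp add: set_lebesgue_integral_def has_bochner_integral_iff mult.commute)
  then show "(LBINT s:{0..t}. exp (a * s)) \<le> exp (a * t) / a" using assms by simp
qed

text \<open>Picard iteration in the norm weighted by \<open>exp (- 2 A t)\<close>, in which it contracts by \<open>1/2\<close>.\<close>

lemma caratheodory_flow:
  fixes g :: "real \<Rightarrow> real \<Rightarrow> 'w \<Rightarrow> real" and y0 :: "'w \<Rightarrow> real"
  assumes g[measurable]: "(\<lambda>(t, y, w). g t y w) \<in> borel_measurable (borel \<Otimes>\<^sub>M borel \<Otimes>\<^sub>M N)"
    and A: "1 \<le> A" and lip: "\<And>t y y' w. w \<in> space N \<Longrightarrow> \<bar>g t y w - g t y' w\<bar> \<le> A * \<bar>y - y'\<bar>"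
    and K: "\<And>t w. w \<in> space N \<Longrightarrow> \<bar>g t 0 w\<bar> \<le> K"
    and y0[measurable]: "y0 \<in> borel_measurable N"
  obtains Y where "(\<lambda>(t, w). Y t w) \<in> borel_measurable (borel \<Otimes>\<^sub>M N)"
    "\<And>t w. w \<in> space N \<Longrightarrow> 0 \<le> t \<Longrightarrow> set_integrable lborel {0..t} (\<lambda>s. g s (Y s w) w)"
    "\<And>t w. w \<in> space N \<Longrightarrow> 0 \<le> t \<Longrightarrow> Y t w = y0 w + (LBINT s:{0..t}. g s (Y s w) w)"
    "\<And>t w. w \<in> space N \<Longrightarrow> 0 \<le> t \<Longrightarrow> \<bar>Y t w\<bar> \<le> \<bar>y0 w\<bar> + 2 * (K + A * \<bar>y0 w\<bar>) * exp (2 * A * t)"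
proof -
  have gm[measurable (raw)]: "(\<lambda>x. g (a x) (b x) (c x)) \<in> borel_measurable L"
    if "a \<in> borel_measurable L" "b \<in> borel_measurable L" "c \<in> L \<rightarrow>\<^sub>M N" for a b c and L :: "'z measure"
    using measurable_compose[OF measurable_Pair[OF that(1) measurable_Pair[OF that(2,3)]] g] by simp
  define y where "y = rec_nat (\<lambda>t w. y0 w) (\<lambda>_ z t w. y0 w + (LBINT s:{0..t}. g s (z s w) w))"
  have yS: "y (Suc n) t w = y0 w + (LBINT s:{0..t}. g s (y n s w) w)" and y_0: "y 0 t w = y0 w" for n t w
    by (simp_all add: y_def)
  have ym[measurable]: "(\<lambda>(t, w). y n t w) \<in> borel_measurable (borel \<Otimes>\<^sub>M N)" for n
  proof (induction n)
    case 0
    then show ?case by (simp add: y_0)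
  next
    case (Suc n)
    note [measurable] = Suc
    have "(\<lambda>(t, w). y (Suc n) t w) = (\<lambda>(t, w). y0 w + (LINT s|lborel. (if 0 \<le> s \<and> s \<le> t then g s (y n s w) w else 0)))"
      by (auto simp: yS set_lebesgue_integral_def fun_eq_iff indicator_def intro!: Bochner_Integration.integral_cong)
    also have "\<dots> \<in> borel_measurable (borel \<Otimes>\<^sub>M N)" by measurable
    finally show ?case .
  qed
  \<comment> \<open>\<open>D w\<close> bounds g at the starting value, hence the slope of the first
    iterate. The increments are dominated by a geometric series of ratio 1/2, so all iterates stay
    below \<open>R\<close>, whose factor 2 is the sum of that series.\<close>
  define D where "D w = K + A * \<bar>y0 w\<bar>" for w
  have D0: "0 \<le> D w" if "w \<in> space N" for w
    using K[OF that, of 0] A by (auto simp: D_def intro!: add_nonneg_nonneg)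
  define R where "R t w = \<bar>y0 w\<bar> + 2 * D w * exp (2 * A * t)" for t w
  have growth: "\<bar>g t v w\<bar> \<le> K + A * \<bar>v\<bar>" if "w \<in> space N" for t v w
    using lip[OF that, of t v 0] K[OF that, of t] by simp
  have sec: "(\<lambda>s. z s w) \<in> borel_measurable borel" if z: "(\<lambda>(t, w). z t w) \<in> borel_measurable (borel \<Otimes>\<^sub>M N)" and w: "w \<in> space N" for z w
    using measurable_Pair1[OF z w] by simp
  have gsec: "(\<lambda>s. g s (z s) w) \<in> borel_measurable borel" if [measurable]: "z \<in> borel_measurable borel" and w[measurable]: "w \<in> space N" for z w
    by measurable
  have bnd: "\<bar>g s v w\<bar> \<le> K + A * R t w" if w: "w \<in> space N" and z: "\<bar>v\<bar> \<le> R s w" and s: "s \<le> t" for v s t w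
  proof -
    have "R s w \<le> R t w" unfolding R_def using s A D0[OF w] by (intro add_mono mult_left_mono) auto
    then have "A * \<bar>v\<bar> \<le> A * R t w" using z A by (intro mult_left_mono) auto
    then show ?thesis using growth[OF w, of s v] by linarith
  qed
  have integ: "set_integrable lborel {0..t} (\<lambda>s. g s (z s) w)"
    if w: "w \<in> space N" and [measurable]: "z \<in> borel_measurable borel" and z: "\<And>s. 0 \<le> s \<Longrightarrow> \<bar>z s\<bar> \<le> R s w" for z t w
  proof (rule set_integrable_bound[where f="\<lambda>_. K + A * R t w"])
    show "set_integrable lborel {0..t} (\<lambda>_. K + A * R t w)"
      by (rule set_integrable_const_Icc)
    show "set_borel_measurable lborel {0..t} (\<lambda>s. g s (z s) w)"
      using gsec[OF that(2) w] by (auto simp: set_borel_measurable_def)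
    have "norm (g s (z s) w) \<le> norm (K + A * R t w)" if "s \<in> {0..t}" for s
      using bnd[OF w z[of s], of t] that by auto
    then show "AE s in lborel. s \<in> {0..t} \<longrightarrow> norm (g s (z s) w) \<le> norm (K + A * R t w)" by simp
  qed
  have q0: "2 * D w * (1 - (1/2)^m) * exp (2 * A * s) \<le> 2 * D w * exp (2 * A * s)" if w: "w \<in> space N" for m s w
  proof -
    have "2 * D w * (1 - (1/2)^m) \<le> 2 * D w * 1" by (intro mult_left_mono) (use D0[OF w] in auto)
    then show ?thesis by (intro mult_right_mono) auto
  qed
  \<comment> \<open>Both bounds are proved together: the second gives the integrability that the
    increment estimate needs. The factor 1/2 arises because A times the integral of exp(2 A s) over
    [0,t] is at most exp(2 A t) / 2.\<close>
  have step: "\<bar>y (Suc n) t w - y n t w\<bar> \<le> D w * (1/2)^n * exp (2 * A * t) \<and>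
       \<bar>y n t w\<bar> \<le> \<bar>y0 w\<bar> + 2 * D w * (1 - (1/2)^n) * exp (2 * A * t)"
    if w: "w \<in> space N" and t: "0 \<le> t" for n t w
    using t
  proof (induction n arbitrary: t)
    case 0
    have i: "set_integrable lborel {0..t} (\<lambda>s. g s (y0 w) w)"
      by (rule integ[OF w]) (use D0[OF w] in \<open>auto simp: R_def\<close>)
    have "\<bar>y (Suc 0) t w - y 0 t w\<bar> \<le> (LBINT s:{0..t}. \<bar>g s (y0 w) w\<bar>)"
      unfolding yS y_0 set_lebesgue_integral_def
      by (auto simp: abs_mult intro!: order_trans[OF integral_abs_bound])
    also have "\<dots> \<le> (LBINT s:{0..t}. D w)"
      by (rule set_integral_mono) (use i growth[OF w] in \<open>auto simp: D_def set_integrable_abs set_integrable_const_Icc\<close>)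
    also have "\<dots> = D w * t" using 0 by (simp add: set_lebesgue_integral_def)
    also have "\<dots> \<le> D w * exp (2 * A * t)"
    proof (rule mult_left_mono)
      have "t \<le> 2 * A * t" using 0 A by (simp add: mult_le_cancel_right1)
      also have "\<dots> \<le> exp (2 * A * t)" using exp_ge_add_one_self[of "2 * A * t"] by linarith
      finally show "t \<le> exp (2 * A * t)" .
    qed (rule D0[OF w])
    finally show ?case by (simp add: y_0)
  next
    case (Suc n)
    note IH1 = Suc.IH[THEN conjunct1] and IH2 = Suc.IH[THEN conjunct2]
    note q = q0[OF w]
    have bn: "\<bar>y n s w\<bar> \<le> R s w" if "0 \<le> s" for s
      using IH2[OF that] q[of n s] by (simp add: R_def)
    have bS: "\<bar>y (Suc n) s w\<bar> \<le> \<bar>y0 w\<bar> + 2 * D w * (1 - (1/2)^Suc n) * exp (2 * A * s)" if "0 \<le> s" for s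
      using IH1[OF that] IH2[OF that] by (simp add: algebra_simps)
    have bS': "\<bar>y (Suc n) s w\<bar> \<le> R s w" if "0 \<le> s" for s
      using bS[OF that] q[of "Suc n" s] by (simp add: R_def)
    have i1: "set_integrable lborel {0..t} (\<lambda>s. g s (y n s w) w)" and i2: "set_integrable lborel {0..t} (\<lambda>s. g s (y (Suc n) s w) w)"
      by (rule integ[OF w sec[OF ym w]]; use bn bS' in simp)+
    have "\<bar>y (Suc (Suc n)) t w - y (Suc n) t w\<bar> = \<bar>LBINT s:{0..t}. g s (y (Suc n) s w) w - g s (y n s w) w\<bar>"
      unfolding yS[of "Suc n"] yS[of n t] by (simp add: set_integral_diff[OF i2 i1])
    also have "\<dots> \<le> (LBINT s:{0..t}. \<bar>g s (y (Suc n) s w) w - g s (y n s w) w\<bar>)"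
      unfolding set_lebesgue_integral_def by (auto simp: abs_mult intro!: order_trans[OF integral_abs_bound])
    also have "\<dots> \<le> (LBINT s:{0..t}. A * D w * (1/2)^n * exp (2 * A * s))"
    proof (rule set_integral_mono)
      show "set_integrable lborel {0..t} (\<lambda>s. \<bar>g s (y (Suc n) s w) w - g s (y n s w) w\<bar>)"
        by (intro set_integrable_abs set_integral_diff i1 i2)
      show "set_integrable lborel {0..t} (\<lambda>s. A * D w * (1/2)^n * exp (2 * A * s))"
        using LBINT_exp_le(1)[of "2 * A" t] A Suc.prems by auto
      fix s assume "s \<in> {0..t}"
      then have "A * \<bar>y (Suc n) s w - y n s w\<bar> \<le> A * (D w * (1/2)^n * exp (2 * A * s))"
        using IH1[of s] A by (intro mult_left_mono) auto
      then show "\<bar>g s (y (Suc n) s w) w - g s (y n s w) w\<bar> \<le> A * D w * (1/2)^n * exp (2 * A * s)"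
        using lip[OF w, of s "y (Suc n) s w" "y n s w"] by (simp add: mult.assoc)
    qed
    also have "\<dots> = A * D w * (1/2)^n * (LBINT s:{0..t}. exp (2 * A * s))" by simp
    also have "\<dots> \<le> A * D w * (1/2)^n * (exp (2 * A * t) / (2 * A))"
      using LBINT_exp_le(2)[of "2 * A" t] A Suc.prems D0[OF w] by (intro mult_left_mono) auto
    also have "\<dots> = D w * (1/2)^Suc n * exp (2 * A * t)" using A by (simp add: field_simps)
    finally show ?case using bS[OF Suc.prems] by blast
  qed
  have ybd: "\<bar>y n t w\<bar> \<le> R t w" if w: "w \<in> space N" and t: "0 \<le> t" for n t w
  proof -
    note q0[OF w, of n t]
    then show ?thesis using step[OF w t, of n] by (simp add: R_def)
  qed
  have conv: "convergent (\<lambda>n. y n t w)" if w: "w \<in> space N" for t w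
  proof (cases "0 \<le> t")
    case True
    have "summable (\<lambda>n. y (Suc n) t w - y n t w)"
    proof (rule summable_comparison_test)
      show "summable (\<lambda>n. D w * exp (2 * A * t) * (1/2)^n)" by (intro summable_mult summable_geometric) simp
      show "\<exists>N. \<forall>n\<ge>N. norm (y (Suc n) t w - y n t w) \<le> D w * exp (2 * A * t) * (1/2)^n"
        using step[OF w True] by (auto simp: mult_ac)
    qed
    from summable_LIMSEQ[OF this] have "(\<lambda>n. y n t w - y 0 t w) \<longlonglongrightarrow> (\<Sum>n. y (Suc n) t w - y n t w)"
      by (simp add: sum_lessThan_telescope[of "\<lambda>n. y n t w"])
    from tendsto_add[OF this tendsto_const[of "y 0 t w"]] show ?thesis by (auto simp: convergent_def)
  next
    case False
    then have "y n t w = y0 w" for n by (cases n) (auto simp: y_0 yS set_lebesgue_integral_def)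
    then show ?thesis by (simp add: convergent_const)
  qed
  define Y where "Y t w = lim (\<lambda>n. y n t w)" for t w
  have lim: "(\<lambda>n. y n t w) \<longlonglongrightarrow> Y t w" if "w \<in> space N" for t w
    using conv[OF that, of t] by (simp add: Y_def convergent_LIMSEQ_iff)
  have Ym: "(\<lambda>(t, w). Y t w) \<in> borel_measurable (borel \<Otimes>\<^sub>M N)"
    by (rule borel_measurable_LIMSEQ_real[where u="\<lambda>n (t, w). y n t w"]) (auto simp: space_pair_measure lim ym)
  have YR: "\<bar>Y t w\<bar> \<le> R t w" if w: "w \<in> space N" and t: "0 \<le> t" for t w
    by (rule LIMSEQ_le_const2[OF tendsto_rabs[OF lim[OF w]]]) (use ybd[OF w t] in auto)
  have Yi: "set_integrable lborel {0..t} (\<lambda>s. g s (Y s w) w)" if w: "w \<in> space N" for t w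
    by (rule integ[OF w sec[OF Ym w]]) (use YR[OF w] in simp)
  show thesis
  proof (rule that[OF Ym])
    fix t w assume w: "w \<in> space N" and t: "0 \<le> (t::real)"
    show "set_integrable lborel {0..t} (\<lambda>s. g s (Y s w) w)" by (rule Yi[OF w])
    show "\<bar>Y t w\<bar> \<le> \<bar>y0 w\<bar> + 2 * (K + A * \<bar>y0 w\<bar>) * exp (2 * A * t)"
      using YR[OF w t] by (simp add: R_def D_def)
    have "(\<lambda>n. LBINT s:{0..t}. g s (y n s w) w) \<longlonglongrightarrow> (LBINT s:{0..t}. g s (Y s w) w)"
      unfolding set_lebesgue_integral_def
    proof (rule integral_dominated_convergence[where w="\<lambda>s. indicator {0..t} s *\<^sub>R (K + A * R t w)"])
      show "(\<lambda>s. indicator {0..t} s *\<^sub>R g s (Y s w) w) \<in> borel_measurable lborel"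
        using gsec[OF sec[OF Ym w] w] by auto
      show "(\<lambda>s. indicator {0..t} s *\<^sub>R g s (y n s w) w) \<in> borel_measurable lborel" for n
        using gsec[OF sec[OF ym w] w] by auto
      show "integrable lborel (\<lambda>s. indicator {0..t} s *\<^sub>R (K + A * R t w))"
        using set_integrable_const_Icc by (simp add: set_integrable_def)
      show "AE s in lborel. norm (indicator {0..t} s *\<^sub>R g s (y n s w) w) \<le> indicator {0..t} s *\<^sub>R (K + A * R t w)" for n
        using bnd[OF w ybd[OF w]] by (auto simp: indicator_def)
      show "AE s in lborel. (\<lambda>n. indicator {0..t} s *\<^sub>R g s (y n s w) w) \<longlonglongrightarrow> indicator {0..t} s *\<^sub>R g s (Y s w) w"
      proof (rule AE_I2, rule tendsto_scaleR[OF tendsto_const])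
        fix s
        have "(\<lambda>n. g s (y n s w) w - g s (Y s w) w) \<longlonglongrightarrow> 0"
        proof (rule Lim_null_comparison)
          show "\<forall>\<^sub>F n in sequentially. norm (g s (y n s w) w - g s (Y s w) w) \<le> A * \<bar>y n s w - Y s w\<bar>"
            using lip[OF w] by simp
          show "(\<lambda>n. A * \<bar>y n s w - Y s w\<bar>) \<longlonglongrightarrow> 0"
            using tendsto_mult[OF tendsto_const[of A] tendsto_rabs_zero[OF LIM_zero[OF lim[OF w, of s]]]] by simp
        qed
        then show "(\<lambda>n. g s (y n s w) w) \<longlonglongrightarrow> g s (Y s w) w" by (simp add: LIM_zero_iff)
      qed
    qed
    then have "(\<lambda>n. y (Suc n) t w) \<longlonglongrightarrow> y0 w + (LBINT s:{0..t}. g s (Y s w) w)"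
      unfolding yS by (intro tendsto_add tendsto_const)
    moreover have "(\<lambda>n. y (Suc n) t w) \<longlonglongrightarrow> Y t w" using lim[OF w] by (rule LIMSEQ_Suc)
    ultimately show "Y t w = y0 w + (LBINT s:{0..t}. g s (Y s w) w)" by (metis LIMSEQ_unique)
  qed
qed

section \<open>Test functions\<close>

text \<open>A C^1 replacement for the indicator of the positive half-line. The rational profile is
  chosen because v times \<open>sstep' v\<close> is bounded and decays at infinity, which makes the
  error term in the conservation of mass disappear.\<close>

definition sstep :: "real \<Rightarrow> real" where "sstep v = (max 0 v)\<^sup>2 / (1 + (max 0 v)\<^sup>2)"
definition sstep' :: "real \<Rightarrow> real" where "sstep' v = 2 * max 0 v / (1 + (max 0 v)\<^sup>2)\<^sup>2"

lemma DERIV_sstep: "(sstep has_real_derivative sstep' v) (at v)"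
proof -
  have p: "((\<lambda>v::real. (max 0 v)\<^sup>2) has_real_derivative 2 * max 0 v) (at v)"
  proof (cases v "0::real" rule: linorder_cases)
    case less
    have "((\<lambda>_. 0) has_real_derivative 0) (at v)" by simp
    then have "((\<lambda>v::real. (max 0 v)\<^sup>2) has_real_derivative 0) (at v)"
      by (rule has_field_derivative_transform_within_open[where S="{..<0}"]) (use less in auto)
    then show ?thesis using less by simp
  next
    case greater
    have "((\<lambda>v. v\<^sup>2) has_real_derivative 2 * v) (at v)" by (auto intro!: derivative_eq_intros)
    then have "((\<lambda>v::real. (max 0 v)\<^sup>2) has_real_derivative 2 * v) (at v)"
      by (rule has_field_derivative_transform_within_open[where S="{0<..}"]) (use greater in auto)
    then show ?thesis using greater by simp
  next
    case equal
    have "((\<lambda>h. ((max 0 h)\<^sup>2) / h) \<longlongrightarrow> 0) (at (0::real))"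
    proof (rule Lim_null_comparison)
      show "\<forall>\<^sub>F h in at (0::real). norm ((max 0 h)\<^sup>2 / h) \<le> \<bar>h\<bar>"
        by (rule always_eventually) (auto simp: power2_eq_square max_def)
      show "((\<lambda>h. \<bar>h\<bar>) \<longlongrightarrow> 0) (at (0::real))" by (rule tendsto_rabs_zero) simp
    qed
    then show ?thesis using equal by (simp add: DERIV_def)
  qed
  have nz: "1 + (max 0 v)\<^sup>2 \<noteq> 0" by (simp add: add_nonneg_eq_0_iff)
  have "((\<lambda>v. (max 0 v)\<^sup>2 / (1 + (max 0 v)\<^sup>2)) has_real_derivative
      ((2 * max 0 v) * (1 + (max 0 v)\<^sup>2) - (max 0 v)\<^sup>2 * (0 + 2 * max 0 v)) / ((1 + (max 0 v)\<^sup>2) * (1 + (max 0 v)\<^sup>2))) (at v)"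
    by (rule DERIV_divide[OF p DERIV_add[OF DERIV_const p] nz])
  also have "((2 * max 0 v) * (1 + (max 0 v)\<^sup>2) - (max 0 v)\<^sup>2 * (0 + 2 * max 0 v)) / ((1 + (max 0 v)\<^sup>2) * (1 + (max 0 v)\<^sup>2))
      = sstep' v" by (simp add: sstep'_def power2_eq_square[of "1 + _"] algebra_simps)
  finally show ?thesis by (simp add: sstep_def[abs_def])
qed

lemma sstep_nonneg [simp]: "0 \<le> sstep v" and sstep_le_1 [simp]: "sstep v \<le> 1"
  by (auto simp: sstep_def divide_le_eq_1 add_pos_nonneg)

lemma sstep_pos_iff: "sstep v \<noteq> 0 \<longleftrightarrow> 0 < v"
  by (auto simp: sstep_def max_def add_nonneg_eq_0_iff)

lemma sstep'_bounds: "0 \<le> sstep' v" "sstep' v \<le> 2" "\<bar>v * sstep' v\<bar> \<le> 1"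
proof -
  let ?w = "max 0 v"
  have d: "1 \<le> (1 + ?w\<^sup>2)\<^sup>2" by (simp add: one_le_power)
  show "0 \<le> sstep' v" by (simp add: sstep'_def)
  have "2 * ?w \<le> 1 + ?w\<^sup>2" using zero_le_power2[of "?w - 1"] unfolding power2_diff by simp
  moreover have e: "1 + ?w\<^sup>2 \<le> (1 + ?w\<^sup>2)\<^sup>2" by (rule self_le_power) auto
  moreover have "0 \<le> 1 + ?w\<^sup>2" by simp
  ultimately have "2 * ?w \<le> 2 * (1 + ?w\<^sup>2)\<^sup>2" by linarith
  moreover have *: "2 * ?w\<^sup>2 \<le> (1 + ?w\<^sup>2)\<^sup>2" by (subst power2_sum) simp
  ultimately show "sstep' v \<le> 2" using d by (simp add: sstep'_def divide_le_eq)
  have "v * sstep' v = 2 * ?w\<^sup>2 / (1 + ?w\<^sup>2)\<^sup>2"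
    by (auto simp: sstep'_def max_def power2_eq_square)
  moreover have "2 * ?w\<^sup>2 / (1 + ?w\<^sup>2)\<^sup>2 \<le> 1" using * d by (simp add: divide_le_eq)
  ultimately show "\<bar>v * sstep' v\<bar> \<le> 1" by simp
qed

lemma continuous_sstep': "continuous_on S sstep'"
proof -
  have "(1 + (max 0 x)\<^sup>2)\<^sup>2 \<noteq> (0::real)" for x :: real by (simp add: add_nonneg_eq_0_iff)
  then show ?thesis unfolding sstep'_def by (intro continuous_intros) auto
qed

lemma continuous_sstep: "continuous_on S sstep"
  using DERIV_sstep by (meson DERIV_continuous_on has_field_derivative_at_within)

lemma sstep_borel [measurable]: "sstep \<in> borel_measurable borel" "sstep' \<in> borel_measurable borel"
  by (auto intro: borel_measurable_continuous_onI continuous_sstep continuous_sstep')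

text \<open>10 = 2 + 8, from the two terms of the derivative of h. Passing to the smooth h and
  clipping its argument with the 1-Lipschitz map max 0 avoids the corner of \<open>sstep'\<close> at
  0.\<close>

lemma sstep'_Lipschitz: "\<bar>sstep' v - sstep' w\<bar> \<le> 10 * \<bar>v - w\<bar>"
proof -
  define h where "h w = 2 * w / (1 + w\<^sup>2)\<^sup>2" for w :: real
  have d: "1 \<le> (1 + w\<^sup>2)" for w :: real by simp
  have hd: "(h has_real_derivative (2 / (1 + w\<^sup>2)\<^sup>2 - 8 * w\<^sup>2 / (1 + w\<^sup>2)^3)) (at w)" for w
  proof -
    have nz: "1 + w\<^sup>2 \<noteq> 0" using d[of w] by linarith
    define q where "q = 1 + w\<^sup>2"
    have "(h has_real_derivative (2 * q\<^sup>2 - 2 * w * (2 * q * (2 * w))) / (q\<^sup>2 * q\<^sup>2)) (at w)"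
      unfolding h_def by (rule derivative_eq_intros refl)+ (use nz in \<open>auto simp: q_def\<close>)
    moreover have "(2 * q\<^sup>2 - 2 * w * (2 * q * (2 * w))) / (q\<^sup>2 * q\<^sup>2) = 2 / q\<^sup>2 - 8 * w\<^sup>2 / q^3"
      using nz[folded q_def] by (simp add: field_simps power2_eq_square power3_eq_cube)
    ultimately show ?thesis by (simp add: q_def)
  qed
  have hb: "\<bar>2 / (1 + w\<^sup>2)\<^sup>2 - 8 * w\<^sup>2 / (1 + w\<^sup>2)^3\<bar> \<le> 10" for w :: real
  proof -
    have "2 / (1 + w\<^sup>2)\<^sup>2 \<le> 2" using one_le_power[OF d[of w], of 2] by (simp add: divide_le_eq)
    moreover have "w\<^sup>2 / (1 + w\<^sup>2)^3 \<le> 1"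
    proof -
      have "w\<^sup>2 \<le> (1 + w\<^sup>2) ^ 1" by simp
      also have "\<dots> \<le> (1 + w\<^sup>2)^3" using d by (intro power_increasing) auto
      finally show ?thesis by (subst divide_le_eq_1_pos) (auto simp: add_pos_nonneg)
    qed
    moreover have "0 \<le> 2 / (1 + w\<^sup>2)\<^sup>2" "0 \<le> w\<^sup>2 / (1 + w\<^sup>2)^3" using d[of w] by auto
    moreover have "8 * w\<^sup>2 / (1 + w\<^sup>2)^3 = 8 * (w\<^sup>2 / (1 + w\<^sup>2)^3)" by simp
    ultimately show ?thesis unfolding abs_le_iff by linarith
  qed
  have "\<bar>h a - h b\<bar> \<le> 10 * \<bar>a - b\<bar>" for a b
    using field_differentiable_bound[of UNIV h "\<lambda>w. 2 / (1 + w\<^sup>2)\<^sup>2 - 8 * w\<^sup>2 / (1 + w\<^sup>2)^3" 10 a b] hd hb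
    by auto
  from this[of "max 0 v" "max 0 w"] have "\<bar>sstep' v - sstep' w\<bar> \<le> 10 * \<bar>max 0 v - max 0 w\<bar>"
    by (simp add: sstep'_def h_def)
  moreover have "\<bar>max 0 v - max 0 w\<bar> \<le> \<bar>v - w\<bar>" by (auto simp: max_def abs_if)
  ultimately show ?thesis by linarith
qed

lemma sstep_scale_limit: "(\<lambda>n. sstep (real n * v)) \<longlonglongrightarrow> indicator {0<..} v"
proof (cases "0 < v")
  case True
  have "(\<lambda>n. 1 - 1 / (1 + (real n * v)\<^sup>2)) \<longlonglongrightarrow> 1 - 0"
  proof (intro tendsto_diff tendsto_const)
    have "filterlim (\<lambda>n. (real n * v)\<^sup>2) at_top sequentially"
      using True by (intro filterlim_pow_at_top filterlim_tendsto_pos_mult_at_top[OF tendsto_const]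
         filterlim_at_top_mult_tendsto_pos[OF tendsto_const] filterlim_real_sequentially) auto
    then have "filterlim (\<lambda>n. 1 + (real n * v)\<^sup>2) at_top sequentially"
      by (rule filterlim_tendsto_add_at_top[OF tendsto_const])
    then show "(\<lambda>n. 1 / (1 + (real n * v)\<^sup>2)) \<longlonglongrightarrow> 0"
      by (intro tendsto_divide_0[OF tendsto_const] filterlim_at_top_imp_at_infinity)
  qed
  moreover have "sstep (real n * v) = 1 - 1 / (1 + (real n * v)\<^sup>2)" for n
  proof -
    have "max 0 (real n * v) = real n * v" using True by simp
    moreover have "1 + (real n * v)\<^sup>2 \<noteq> 0" by (simp add: add_nonneg_eq_0_iff)
    ultimately show ?thesis unfolding sstep_def by (simp add: field_simps)
  qed
  ultimately show ?thesis using True by simp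
next
  case False
  then have "sstep (real n * v) = 0" for n
    using sstep_pos_iff[of "real n * v"] by (auto simp: zero_less_mult_iff)
  then show ?thesis using False by simp
qed

text \<open>For v > 0 and n > 0 the quantity is at most 2 / (n v)^2, and for v <= 0 it is
  identically zero. The limit therefore holds everywhere, including the characteristic itself, where
  v = 0.\<close>

lemma sstep'_scale_limit: "(\<lambda>n. real n * v * sstep' (real n * v)) \<longlonglongrightarrow> 0"
proof (cases "0 < v")
  case True
  show ?thesis
  proof (rule Lim_null_comparison)
    show "\<forall>\<^sub>F n in sequentially. norm (real n * v * sstep' (real n * v)) \<le> 2 / (real n * v)\<^sup>2"
      using eventually_gt_at_top[of 0]
    proof eventually_elim
      case (elim n)
      then have w: "0 < real n * v" using True by simp
      define w where "w = real n * v"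
      have "w * sstep' w = 2 * w\<^sup>2 / (1 + w\<^sup>2)\<^sup>2"
        using w by (simp add: sstep'_def w_def power2_eq_square)
      also have "\<dots> \<le> 2 * w\<^sup>2 / (w\<^sup>2)\<^sup>2"
        using w by (intro divide_left_mono power_mono) (auto simp: w_def add_nonneg_eq_0_iff intro!: mult_pos_pos zero_less_power add_pos_nonneg)
      also have "\<dots> = 2 / w\<^sup>2" using w by (simp add: w_def power2_eq_square)
      finally have "w * sstep' w \<le> 2 / w\<^sup>2" .
      moreover have "0 \<le> w * sstep' w" using w by (simp add: w_def sstep'_bounds(1))
      ultimately show ?case by (simp only: w_def real_norm_def abs_of_nonneg)
    qed
    have "filterlim (\<lambda>n. (real n * v)\<^sup>2) at_top sequentially"
      using True by (intro filterlim_pow_at_top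
         filterlim_at_top_mult_tendsto_pos[OF tendsto_const] filterlim_real_sequentially) auto
    then show "(\<lambda>n. 2 / (real n * v)\<^sup>2) \<longlonglongrightarrow> 0"
      by (intro tendsto_divide_0[OF tendsto_const] filterlim_at_top_imp_at_infinity)
  qed
next
  case False
  then have "real n * v \<le> 0" for n by (simp add: mult_nonneg_nonpos)
  then have "max 0 (real n * v) = 0" for n by (simp add: max_absorb1)
  then have "sstep' (real n * v) = 0" for n by (simp add: sstep'_def)
  then show ?thesis by simp
qed

section \<open>Test functions of product form\<close>

definition C1_on :: "'z::real_normed_vector set \<Rightarrow> ('z \<Rightarrow> real) \<Rightarrow> bool" where
  "C1_on S \<phi> \<longleftrightarrow> (\<exists>\<phi>' :: 'z \<Rightarrow> 'z \<Rightarrow>\<^sub>L real.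
     (\<forall>z\<in>S. (\<phi> has_derivative blinfun_apply (\<phi>' z)) (at z within S)) \<and> continuous_on S \<phi>')"

lemma C1_on_mult:
  assumes "C1_on S \<phi>" "C1_on S \<psi>" shows "C1_on S (\<lambda>z. \<phi> z * \<psi> z)"
proof -
  obtain \<phi>' \<psi>' where a: "\<And>z. z \<in> S \<Longrightarrow> (\<phi> has_derivative blinfun_apply (\<phi>' z)) (at z within S)" "continuous_on S \<phi>'"
    and b: "\<And>z. z \<in> S \<Longrightarrow> (\<psi> has_derivative blinfun_apply (\<psi>' z)) (at z within S)" "continuous_on S \<psi>'"
    using assms unfolding C1_on_def by blast
  have c: "continuous_on S \<phi>" "continuous_on S \<psi>"
    using has_derivative_continuous_on[OF a(1)] has_derivative_continuous_on[OF b(1)] by auto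
  show ?thesis unfolding C1_on_def
  proof (intro exI[of _ "\<lambda>z. \<phi> z *\<^sub>R \<psi>' z + \<psi> z *\<^sub>R \<phi>' z"] conjI ballI)
    fix z assume z: "z \<in> S"
    show "((\<lambda>z. \<phi> z * \<psi> z) has_derivative blinfun_apply (\<phi> z *\<^sub>R \<psi>' z + \<psi> z *\<^sub>R \<phi>' z)) (at z within S)"
      by (rule has_derivative_eq_rhs[OF has_derivative_mult[OF a(1)[OF z] b(1)[OF z]]])
         (auto simp: plus_blinfun.rep_eq scaleR_blinfun.rep_eq)
  qed (intro continuous_intros a b c)
qed

lemma C1_on_const: "C1_on S (\<lambda>_. c)"
  unfolding C1_on_def by (intro exI[of _ "\<lambda>_. 0"]) (auto simp: zero_blinfun.rep_eq)

lemma C1_on_prod: "(\<And>i. i \<in> I \<Longrightarrow> C1_on S (\<phi> i)) \<Longrightarrow> C1_on S (\<lambda>z. \<Prod>i\<in>I. \<phi> i z)"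
  by (induction I rule: infinite_finite_induct) (auto intro: C1_on_const C1_on_mult)

text \<open>The derivative of f is taken within the image of S under l, so that the time factor may
  have one-sided derivatives at 0 and T.\<close>

lemma C1_on_linear:
  fixes f :: "real \<Rightarrow> real"
  assumes l: "bounded_linear l" and f: "\<And>y. y \<in> l ` S \<Longrightarrow> (f has_real_derivative f' y) (at y within l ` S)"
    and c: "continuous_on (l ` S) f'"
  shows "C1_on S (\<lambda>z. f (l z))"
  unfolding C1_on_def
proof (intro exI[of _ "\<lambda>z. f' (l z) *\<^sub>R Blinfun l"] conjI ballI)
  fix z assume z: "z \<in> S"
  have "((\<lambda>z. f (l z)) has_derivative (\<lambda>h. f' (l z) * l h)) (at z within S)"
  proof (rule has_derivative_in_compose[where f=l and f'=l and g=f and g'="(*) (f' (l z))"])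
    show "(l has_derivative l) (at z within S)" by (rule bounded_linear_imp_has_derivative[OF l])
    show "(f has_derivative (*) (f' (l z))) (at (l z) within l ` S)"
      using f[of "l z"] z by (simp add: has_field_derivative_def)
  qed
  then show "((\<lambda>z. f (l z)) has_derivative blinfun_apply (f' (l z) *\<^sub>R Blinfun l)) (at z within S)"
    by (simp add: scaleR_blinfun.rep_eq bounded_linear_Blinfun_apply[OF l])
next
  show "continuous_on S (\<lambda>z. f' (l z) *\<^sub>R Blinfun l)"
    by (intro continuous_intros continuous_on_compose2[OF c] linear_continuous_on l) auto
qed

definition bump :: "nat \<Rightarrow> real \<Rightarrow> real \<Rightarrow> real \<Rightarrow> real" where
  "bump n l u y = sstep (real n * (y - l)) * sstep (real n * (u - y))"

definition bump' :: "nat \<Rightarrow> real \<Rightarrow> real \<Rightarrow> real \<Rightarrow> real" where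
  "bump' n l u y = real n * (sstep' (real n * (y - l)) * sstep (real n * (u - y))
      - sstep (real n * (y - l)) * sstep' (real n * (u - y)))"

lemma DERIV_bump: "(bump n l u has_real_derivative bump' n l u y) (at y)"
  unfolding bump_def bump'_def
  by (auto intro!: derivative_eq_intros DERIV_chain2[OF DERIV_sstep] simp: algebra_simps)

lemma continuous_bump': "continuous_on S (bump' n l u)"
proof -
  have l: "continuous_on S (\<lambda>y. real n * (y - l))" "continuous_on S (\<lambda>y. real n * (u - y))"
    by (intro continuous_intros)+
  note 1 = continuous_on_compose2[OF continuous_sstep[of UNIV] l(1)] continuous_on_compose2[OF continuous_sstep[of UNIV] l(2)]
    and 2 = continuous_on_compose2[OF continuous_sstep'[of UNIV] l(1)] continuous_on_compose2[OF continuous_sstep'[of UNIV] l(2)]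
  show ?thesis
    unfolding bump'_def
    by (intro continuous_on_mult continuous_on_diff continuous_on_const 1 2) auto
qed

lemma bump_support: "bump n l u y \<noteq> 0 \<Longrightarrow> l \<le> y \<and> y \<le> u"
  by (auto simp: bump_def sstep_pos_iff zero_less_mult_iff)

definition box_bump :: "nat \<Rightarrow> 'a::euclidean_space \<Rightarrow> 'a \<Rightarrow> 'a \<Rightarrow> real" where
  "box_bump n l u x = (\<Prod>i\<in>Basis. bump n (l \<bullet> i) (u \<bullet> i) (x \<bullet> i))"

lemma bump_bounds: "0 \<le> bump n l u y" "bump n l u y \<le> 1"
  by (auto simp: bump_def mult_le_one)

lemma box_bump_bounds: "0 \<le> box_bump n l u x" "box_bump n l u x \<le> 1"
  by (auto simp: box_bump_def bump_bounds intro!: prod_nonneg prod_le_1)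

lemma box_bump_limit: "(\<lambda>n. box_bump n l u x) \<longlonglongrightarrow> indicator (box l u) x"
proof -
  have "(\<lambda>n. box_bump n l u x) \<longlonglongrightarrow>
     (\<Prod>i\<in>Basis. indicator {0<..} (x \<bullet> i - l \<bullet> i) * indicator {0<..} (u \<bullet> i - x \<bullet> i))"
    unfolding box_bump_def bump_def
    by (intro tendsto_prod tendsto_mult sstep_scale_limit)
  also have "(\<Prod>i\<in>Basis. indicator {0<..} (x \<bullet> i - l \<bullet> i) * indicator {0<..} (u \<bullet> i - x \<bullet> i))
      = (indicator (box l u) x :: real)"
  proof (cases "x \<in> box l u")
    case True
    then show ?thesis by (auto simp: mem_box intro!: prod.neutral)
  next
    case False
    then obtain i where "i \<in> Basis" "x \<bullet> i \<le> l \<bullet> i \<or> u \<bullet> i \<le> x \<bullet> i" by (force simp: mem_box)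
    then show ?thesis using False by (auto simp: prod_zero_iff intro!: bexI[of _ i])
  qed
  finally show ?thesis .
qed

lemma box_bump_borel [measurable]: "box_bump n l u \<in> borel_measurable borel"
  unfolding box_bump_def bump_def by measurable

text \<open>The time factor is differentiable only within [0,T], which is all that
  \<open>C1c_test\<close> demands; the support is confined by \<open>R\<close> in \<xi> and by
  \<open>box_bump\<close> in x.\<close>

lemma C1c_test_product:
  fixes a a' f f' :: "real \<Rightarrow> real" and l u :: "'a::euclidean_space"
  assumes a: "\<And>t. t \<in> {0..T} \<Longrightarrow> (a has_real_derivative a' t) (at t within {0..T})" "continuous_on {0..T} a'"
    and f: "\<And>y. (f has_real_derivative f' y) (at y)" "continuous_on UNIV f'"
    and R: "\<And>y. f y \<noteq> 0 \<Longrightarrow> \<bar>y\<bar> \<le> R"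
  shows "(\<lambda>(t, \<xi>, x). a t * (f \<xi> * box_bump n l u x)) \<in> C1c_test T"
proof -
  let ?S = "{0..T} \<times> (UNIV :: (real \<times> 'a) set)"
  let ?\<phi> = "\<lambda>z :: real \<times> real \<times> 'a. a (fst z) * (f (fst (snd z)) * box_bump n l u (snd (snd z)))"
  have "fst ` ?S = {0..T}" by force
  then have 1: "C1_on ?S (\<lambda>z. a (fst z))"
    by (intro C1_on_linear[where f'=a']) (use a in \<open>auto intro: bounded_linear_fst\<close>)
  have 2: "C1_on ?S (\<lambda>z. f (fst (snd z)))"
    by (rule C1_on_linear[where f'=f' and l="\<lambda>z. fst (snd z)"])
       (use f in \<open>auto intro!: bounded_linear_intros intro: has_field_derivative_at_within continuous_on_subset\<close>)
  have 3: "C1_on ?S (\<lambda>z. box_bump n l u (snd (snd z)))"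
    unfolding box_bump_def
  proof (rule C1_on_prod)
    fix i :: 'a
    show "C1_on ?S (\<lambda>z. bump n (l \<bullet> i) (u \<bullet> i) (snd (snd z) \<bullet> i))"
      by (rule C1_on_linear[where f'="bump' n (l \<bullet> i) (u \<bullet> i)" and l="\<lambda>z. snd (snd z) \<bullet> i"])
         (auto intro!: bounded_linear_intros has_field_derivative_at_within[OF DERIV_bump] continuous_bump')
  qed
  have "C1_on ?S ?\<phi>" by (intro C1_on_mult 1 2 3)
  moreover have "compact (closure {z \<in> ?S. ?\<phi> z \<noteq> 0})"
  proof -
    have "{z \<in> ?S. ?\<phi> z \<noteq> 0} \<subseteq> {0..T} \<times> {-R..R} \<times> cbox l u"
    proof
      fix z assume "z \<in> {z \<in> ?S. ?\<phi> z \<noteq> 0}"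
      then have z: "fst z \<in> {0..T}" "f (fst (snd z)) \<noteq> 0" "box_bump n l u (snd (snd z)) \<noteq> 0" by auto
      have "snd (snd z) \<in> cbox l u" unfolding mem_box
        using z(3) bump_support unfolding box_bump_def by (auto simp: prod_zero_iff)
      then show "z \<in> {0..T} \<times> {-R..R} \<times> cbox l u" using z R[of "fst (snd z)"] by (cases z) (auto simp: abs_le_iff)
    qed
    moreover have "bounded ({0..T} \<times> {-R..R} \<times> cbox l u)" by (intro bounded_Times) auto
    ultimately show ?thesis using bounded_subset by auto
  qed
  ultimately show ?thesis unfolding C1c_test_def C1_on_def by (auto simp: case_prod_beta')
qed

section \<open>The linear continuity equation in one variable with a parameter\<close>

text \<open>Pushing \<open>L x\<close> forward by \<open>f x\<close> reduces the claim to the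
  integral of the identity over elements of \<open>subprob_algebra borel\<close>, where the
  integrand no longer depends on x.\<close>

lemma integral_kernel_measurable:
  fixes f :: "'b \<Rightarrow> 'c \<Rightarrow> real"
  assumes f: "(\<lambda>(x, y). f x y) \<in> borel_measurable (M \<Otimes>\<^sub>M N)" and L: "L \<in> M \<rightarrow>\<^sub>M prob_algebra N"
  shows "(\<lambda>x. LINT y|L x. f x y) \<in> borel_measurable M"
proof -
  have "(\<lambda>x. distr (L x) borel (f x)) \<in> M \<rightarrow>\<^sub>M subprob_algebra borel"
    by (rule measurable_distr2[OF f measurable_prob_algebraD[OF L]])
  from measurable_compose[OF this integral_measurable_subprob_algebra[of "\<lambda>v. v" borel]]
  have "(\<lambda>x. LINT v|distr (L x) borel (f x). v) \<in> borel_measurable M" by simp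
  then show ?thesis
  proof (rule measurable_cong[THEN iffD1, rotated])
    fix x assume x: "x \<in> space M"
    have "sets (L x) = sets N" using measurable_space[OF L x] by (auto simp: space_prob_algebra)
    moreover have "f x \<in> borel_measurable N" using measurable_Pair2[OF f x] by simp
    ultimately have "f x \<in> borel_measurable (L x)" by (subst measurable_cong_sets[OF _ refl])
    then show "(LINT v|distr (L x) borel (f x). v) = (LINT y|L x. f x y)" by (simp add: integral_distr)
  qed
qed

lemma set_integrable_bounded_Icc:
  fixes k :: "real \<Rightarrow> real"
  assumes [measurable]: "k \<in> borel_measurable borel" and "\<And>s. s \<in> {a..b} \<Longrightarrow> \<bar>k s\<bar> \<le> C"
  shows "set_integrable lborel {a..b} k"
proof (rule set_integrable_bound[OF set_integrable_const_Icc[of a b C]])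
  show "set_borel_measurable lborel {a..b} k" by (simp add: set_borel_measurable_def)
  show "AE s in lborel. s \<in> {a..b} \<longrightarrow> norm (k s) \<le> norm C"
    unfolding real_norm_def by (intro AE_I2 impI order_trans[OF assms(2) abs_ge_self])
qed

text \<open>The global bound \<open>B\<close> secures integrability; only the local bound
  \<open>C\<close> between s and t enters the estimate, so the result can be small compared with |t
  - s|.\<close>

lemma LBINT_Icc_diff:
  fixes k :: "real \<Rightarrow> real"
  assumes k: "k \<in> borel_measurable borel" "\<And>s. \<bar>k s\<bar> \<le> B" and st: "0 \<le> s" "0 \<le> t"
    and C: "\<And>\<tau>. \<tau> \<in> {min s t..max s t} \<Longrightarrow> \<bar>k \<tau>\<bar> \<le> C"
  shows "\<bar>(LBINT \<tau>:{0..t}. k \<tau>) - (LBINT \<tau>:{0..s}. k \<tau>)\<bar> \<le> C * \<bar>t - s\<bar>"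
proof -
  have *: "\<bar>(LBINT \<tau>:{0..t}. k \<tau>) - (LBINT \<tau>:{0..s}. k \<tau>)\<bar> \<le> C * (t - s)"
    if "0 \<le> s" "s \<le> t" "\<And>\<tau>. \<tau> \<in> {s..t} \<Longrightarrow> \<bar>k \<tau>\<bar> \<le> C" for s t
  proof -
    have i: "set_integrable lborel {a..b} k" for a b
      by (rule set_integrable_bounded_Icc[OF k(1)]) (use k(2) in auto)
    have "(LBINT \<tau>:{0..t}. k \<tau>) = integral {0..t} k" "(LBINT \<tau>:{0..s}. k \<tau>) = integral {0..s} k"
      by (auto intro: set_borel_integral_eq_integral(2)[OF i])
    moreover have "integral {0..s} k + integral {s..t} k = integral {0..t} k"
      by (rule Henstock_Kurzweil_Integration.integral_combine)
         (use that set_borel_integral_eq_integral(1)[OF i] in auto)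
    moreover have "norm (integral (cbox s t) k) \<le> C * measure lborel (cbox s t)"
    proof (rule integrable_bound)
      show "0 \<le> C" using that(2) that(3)[of s] by auto
    qed (use that set_borel_integral_eq_integral(1)[OF i] in auto)
    ultimately show ?thesis using that by simp
  qed
  show ?thesis
  proof (cases "s \<le> t")
    case True
    then show ?thesis using *[of s t] C st by simp
  next
    case False
    then show ?thesis using *[of t s] C st by (simp add: abs_minus_commute)
  qed
qed

text \<open>Exchange of the order of integration over the triangle s <= t. It takes the place of an
  integration by parts in time for the merely measurable k.\<close>

lemma LBINT_Fubini_triangle:
  fixes k d :: "real \<Rightarrow> real"
  assumes [measurable]: "k \<in> borel_measurable borel" "d \<in> borel_measurable borel"
    and kB: "\<And>s. \<bar>k s\<bar> \<le> B" and dB: "\<And>s. \<bar>d s\<bar> \<le> B'" and "0 \<le> T"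
  shows "(LBINT t:{0..T}. d t * (LBINT s:{0..t}. k s)) = (LBINT s:{0..T}. k s * (LBINT t:{s..T}. d t))"
proof -
  let ?h = "\<lambda>t s. (if 0 \<le> s \<and> s \<le> t \<and> t \<le> T then d t * k s else 0)"
  have "integrable (lborel \<Otimes>\<^sub>M lborel) (\<lambda>(t, s). ?h t s)"
  proof (rule Bochner_Integration.integrable_bound)
    show "integrable (lborel \<Otimes>\<^sub>M lborel) (\<lambda>z. (B' * B) * indicator ({0..T} \<times> {0..T}) z :: real)"
      by (intro integrable_mult_right integrable_real_indicator)
         (use \<open>0 \<le> T\<close> in \<open>auto simp: lborel.emeasure_pair_measure_Times less_top[symmetric] ennreal_mult_eq_top_iff\<close>)
    show "AE z in lborel \<Otimes>\<^sub>M lborel. norm (case z of (t, s) \<Rightarrow> ?h t s) \<le> norm ((B' * B) * indicator ({0..T} \<times> {0..T}) z)"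
    proof (rule AE_I2)
      fix z :: "real \<times> real"
      obtain t s where z: "z = (t, s)" by (cases z)
      have "\<bar>d t * k s\<bar> \<le> \<bar>B'\<bar> * \<bar>B\<bar>"
        unfolding abs_mult by (intro mult_mono order_trans[OF dB abs_ge_self] order_trans[OF kB abs_ge_self]) auto
      then show "norm (case z of (t, s) \<Rightarrow> ?h t s) \<le> norm ((B' * B) * indicator ({0..T} \<times> {0..T}) z)"
        by (auto simp: z abs_mult indicator_def)
    qed
  qed measurable
  from lborel_pair.Fubini_integral[OF this]
  have "(LINT t|lborel. LINT s|lborel. ?h t s) = (LINT s|lborel. LINT t|lborel. ?h t s)" by simp
  moreover have "(LINT s|lborel. ?h t s) = indicator {0..T} t *\<^sub>R (d t * (LBINT s:{0..t}. k s))" for t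
  proof -
    have "(LINT s|lborel. ?h t s) = (LINT s|lborel. (indicator {0..T} t * d t) * (indicator {0..t} s * k s))"
      by (intro Bochner_Integration.integral_cong) (auto simp: indicator_def)
    then show ?thesis by (simp add: set_lebesgue_integral_def)
  qed
  moreover have "(LINT t|lborel. ?h t s) = indicator {0..T} s *\<^sub>R (k s * (LBINT t:{s..T}. d t))" for s
  proof -
    have "(LINT t|lborel. ?h t s) = (LINT t|lborel. (indicator {0..T} s * k s) * (indicator {s..T} t * d t))"
      by (intro Bochner_Integration.integral_cong) (auto simp: indicator_def)
    then show ?thesis by (simp add: set_lebesgue_integral_def)
  qed
  ultimately show ?thesis by (simp add: set_lebesgue_integral_def)
qed

lemma (in marginal_curve) prob_\<sigma>_UNIV [simp]: "measure (\<sigma> t) UNIV = 1"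
  using S.prob_space[of t] by simp

text \<open>\<open>b\<close> is treated as a given field although it will be the velocity generated
  by \<sigma> itself: once the solution is fixed, only the regularity of \<open>b\<close> matters.
  The bounds give linear growth in \<xi>, which is matched by the moments of \<sigma>.\<close>

locale linear_equation = marginal_curve +
  fixes b :: "real \<Rightarrow> real \<Rightarrow> 'a \<Rightarrow> real" and A K :: real
  assumes b_borel: "(\<lambda>(t, \<xi>, x). b t \<xi> x) \<in> borel_measurable (borel \<Otimes>\<^sub>M borel \<Otimes>\<^sub>M borel)"
    and A1: "1 \<le> A" and b_lip: "\<And>t \<xi> \<zeta> x. \<bar>b t \<xi> x - b t \<zeta> x\<bar> \<le> A * \<bar>\<xi> - \<zeta>\<bar>"
    and b_0: "\<And>t x. \<bar>b t 0 x\<bar> \<le> K"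
    and weak: "\<And>\<phi>. \<phi> \<in> C1c_test T \<Longrightarrow>
        (LBINT t:{0..T}. LINT (\<xi>, x)|\<sigma> t. vector_derivative (\<lambda>s. \<phi> (s, \<xi>, x)) (at t within {0..T}))
        + (LINT (\<xi>, x)|\<sigma> 0. \<phi> (0, \<xi>, x)) - (LINT (\<xi>, x)|\<sigma> T. \<phi> (T, \<xi>, x))
        = - (LBINT t:{0..T}. LINT (\<xi>, x)|\<sigma> t. deriv (\<lambda>\<zeta>. \<phi> (t, \<zeta>, x)) \<xi> * b t \<xi> x)"
begin

lemma b_measurable [measurable (raw)]:
  assumes "f \<in> borel_measurable L" "g \<in> borel_measurable L" "h \<in> L \<rightarrow>\<^sub>M borel"
  shows "(\<lambda>z. b (f z) (g z) (h z)) \<in> borel_measurable L"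
  using measurable_compose[OF measurable_Pair[OF assms(1) measurable_Pair[OF assms(2,3)]] b_borel] by simp

lemma b_growth: "\<bar>b t \<xi> x\<bar> \<le> K + A * \<bar>\<xi>\<bar>"
  using b_lip[of t \<xi> x 0] b_0[of t x] by simp

lemma K0: "0 \<le> K" using b_0[of 0 undefined] by simp

definition flux :: "(real \<times> 'a \<Rightarrow> real) \<Rightarrow> real \<Rightarrow> real" where
  "flux \<psi> s = (LINT z|\<sigma> s. \<psi> z * b s (fst z) (snd z))"

lemma flux_measurable [measurable]: "\<psi> \<in> borel_measurable borel \<Longrightarrow> flux \<psi> \<in> borel_measurable borel"
proof -
  assume [measurable]: "\<psi> \<in> borel_measurable borel"
  have "(\<lambda>(s, z). \<psi> z * b s (fst z) (snd z)) \<in> borel_measurable (borel \<Otimes>\<^sub>M borel)" by measurable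
  from integral_kernel_measurable[OF this \<sigma>_kernel] show ?thesis by (simp add: flux_def[abs_def])
qed

lemma integrable_flux:
  assumes [measurable]: "\<psi> \<in> borel_measurable borel" and C: "\<And>z. \<bar>\<psi> z\<bar> \<le> C"
  shows "integrable (\<sigma> s) (\<lambda>z. \<psi> z * b s (fst z) (snd z))"
proof (rule integrable_linear_growth)
  fix z :: "real \<times> 'a"
  have "\<bar>\<psi> z * b s (fst z) (snd z)\<bar> \<le> C * (K + A * \<bar>fst z\<bar>)"
    unfolding abs_mult using C[of z] by (intro mult_mono b_growth C) auto
  then show "\<bar>\<psi> z * b s (fst z) (snd z)\<bar> \<le> C * K + (C * A) * \<bar>fst z\<bar>" by (simp add: algebra_simps)
qed measurable

lemma first_moment: obtains M where "0 \<le> M" "\<And>t. (LINT z|\<sigma> t. \<bar>fst z\<bar>) \<le> M"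
proof -
  obtain M where M: "0 \<le> M" "\<And>t. (LINT z|\<sigma> t. (fst z)\<^sup>2) \<le> M\<^sup>2" using moment_bound by blast
  have "(LINT z|\<sigma> t. \<bar>fst z\<bar>) \<le> M" for t
  proof -
    have "(LINT z|\<sigma> t. \<bar>fst z\<bar>) \<le> sqrt (LINT z|\<sigma> t. (fst z)\<^sup>2)"
      by (rule S.integral_abs_le_sqrt) (auto intro: integrable_fst_sq P2)
    also have "\<dots> \<le> M" using M by (simp add: real_le_lsqrt)
    finally show ?thesis .
  qed
  then show ?thesis using that M(1) by blast
qed

text \<open>The order of the quantifiers matters: one \<open>B\<close>, namely K plus A times a
  bound of the first moments, serves for all times and all \<psi>. It will also be applied to small
  differences of test functions.\<close>

lemma flux_bound: obtains B where "0 \<le> B" "\<And>\<psi> C s. \<psi> \<in> borel_measurable borel \<Longrightarrow> (\<And>z. \<bar>\<psi> z\<bar> \<le> C) \<Longrightarrow> \<bar>flux \<psi> s\<bar> \<le> C * B"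
proof -
  obtain M where M: "0 \<le> M" "\<And>t. (LINT z|\<sigma> t. \<bar>fst z\<bar>) \<le> M" using first_moment by blast
  have "\<bar>flux \<psi> s\<bar> \<le> C * (K + A * M)" if [measurable]: "\<psi> \<in> borel_measurable borel" and C: "\<And>z. \<bar>\<psi> z\<bar> \<le> C" for \<psi> C s
  proof -
    have C0: "0 \<le> C" using order_trans[OF abs_ge_zero C] .
    have "\<bar>flux \<psi> s\<bar> \<le> (LINT z|\<sigma> s. \<bar>\<psi> z * b s (fst z) (snd z)\<bar>)"
      unfolding flux_def by (rule integral_abs_bound)
    also have "\<dots> \<le> (LINT z|\<sigma> s. C * (K + A * \<bar>fst z\<bar>))"
    proof (rule integral_mono)
      show "integrable (\<sigma> s) (\<lambda>z. \<bar>\<psi> z * b s (fst z) (snd z)\<bar>)"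
        using integrable_flux[OF that(1) C] by (rule integrable_abs)
      show "integrable (\<sigma> s) (\<lambda>z. C * (K + A * \<bar>fst z\<bar>))"
        by (rule integrable_linear_growth[of _ "C * K" "C * A"])
           (use C0 K0 A1 in \<open>auto simp: abs_mult algebra_simps abs_of_nonneg add_nonneg_nonneg\<close>)
      show "\<bar>\<psi> z * b s (fst z) (snd z)\<bar> \<le> C * (K + A * \<bar>fst z\<bar>)" for z
        unfolding abs_mult using C[of z] by (intro mult_mono b_growth C) auto
    qed
    also have "\<dots> = C * (K + A * (LINT z|\<sigma> s. \<bar>fst z\<bar>))"
      using integrable_linear_growth[of "\<lambda>z. \<bar>fst z\<bar>" 0 1 s] by simp
    also have "\<dots> \<le> C * (K + A * M)" using M(2)[of s] C0 A1 by (intro mult_left_mono add_left_mono) auto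
    finally show ?thesis .
  qed
  then show ?thesis using that[of "K + A * M"] K0 A1 M(1) by auto
qed

text \<open>Integrated form of the equation for a pair, where \<phi>' plays the role of the
  \<xi>-derivative of \<phi>. The link between the two is deliberately left out: a relation between
  plain functions survives bounded pointwise limits, in which \<phi> loses its regularity in
  x.\<close>

definition transported :: "(real \<times> 'a \<Rightarrow> real) \<Rightarrow> (real \<times> 'a \<Rightarrow> real) \<Rightarrow> bool" where
  "transported \<phi> \<phi>' \<longleftrightarrow> (\<forall>t\<in>{0..T}. (LINT z|\<sigma> t. \<phi> z) - (LINT z|\<sigma> 0. \<phi> z) = (LBINT s:{0..t}. flux \<phi>' s))"

text \<open>Testing with \<open>a(t) f(\<xi>) \<chi>(x)\<close>, where \<open>a\<close> is the primitive, vanishing at \<open>T\<close>, of the defect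
  \<open>D\<close> of the integrated equation, gives \<open>\<integral> D\<^sup>2 = 0\<close>.\<close>

lemma transported_box_bump:
  fixes f f' :: "real \<Rightarrow> real"
  assumes f: "\<And>y. (f has_real_derivative f' y) (at y)" "continuous_on UNIV f'"
    and R: "\<And>y. f y \<noteq> 0 \<Longrightarrow> \<bar>y\<bar> \<le> R" and C: "\<And>y. \<bar>f' y\<bar> \<le> C"
  shows "transported (\<lambda>z. f (fst z) * box_bump n l u (snd z)) (\<lambda>z. f' (fst z) * box_bump n l u (snd z))"
proof -
  have cf: "continuous_on UNIV f" using f(1) by (meson DERIV_continuous_on)
  have [measurable]: "f \<in> borel_measurable borel" "f' \<in> borel_measurable borel"
    using cf f(2) by (auto intro: borel_measurable_continuous_onI)
  let ?\<phi> = "\<lambda>z. f (fst z) * box_bump n l u (snd z)" and ?\<psi> = "\<lambda>z. f' (fst z) * box_bump n l u (snd z)"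
  define m where "m t = (LINT z|\<sigma> t. ?\<phi> z)" for t
  define k where "k = flux ?\<psi>"
  have C0: "0 \<le> C" using order_trans[OF abs_ge_zero C] .
  have \<psi>C: "\<bar>?\<psi> z\<bar> \<le> C" for z
    using mult_mono[OF C[of "fst z"] box_bump_bounds(2)[of n l u "snd z"]] C0 by (simp add: abs_mult box_bump_bounds)
  obtain B where B: "0 \<le> B" "\<And>\<psi> C s. \<psi> \<in> borel_measurable borel \<Longrightarrow> (\<And>z. \<bar>\<psi> z\<bar> \<le> C) \<Longrightarrow> \<bar>flux \<psi> s\<bar> \<le> C * B"
    using flux_bound by blast
  have kB: "\<bar>k s\<bar> \<le> C * B" for s unfolding k_def by (rule B(2)) (use \<psi>C in auto)
  have [measurable]: "k \<in> borel_measurable borel" unfolding k_def by measurable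
  have flip: "\<bar>f \<xi> - f \<zeta>\<bar> \<le> C * \<bar>\<xi> - \<zeta>\<bar>" for \<xi> \<zeta>
    using field_differentiable_bound[of UNIV f f' C \<xi> \<zeta>] f(1) C by auto
  have mc: "continuous_on UNIV m"
    unfolding m_def
  proof (rule continuous_integral_Lipschitz[where L=C and C="\<bar>f 0\<bar>"])
    fix \<xi> \<zeta> x
    have "\<bar>f \<xi> - f \<zeta>\<bar> * \<bar>box_bump n l u x\<bar> \<le> (C * \<bar>\<xi> - \<zeta>\<bar>) * 1"
      using flip[of \<xi> \<zeta>] by (intro mult_mono) (auto simp: box_bump_bounds C0)
    then show "\<bar>?\<phi> (\<xi>, x) - ?\<phi> (\<zeta>, x)\<bar> \<le> C * \<bar>\<xi> - \<zeta>\<bar>" by (simp add: abs_mult flip: left_diff_distrib)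
    show "\<bar>?\<phi> (0, x)\<bar> \<le> \<bar>f 0\<bar>"
      using mult_left_mono[OF box_bump_bounds(2)[of n l u x], of "\<bar>f 0\<bar>"] by (simp add: abs_mult box_bump_bounds)
  qed measurable
  define D where "D t = m t - m 0 - (LBINT s:{0..t}. k s)" for t
  have Kc: "continuous_on {0..T} (\<lambda>t. LBINT s:{0..t}. k s)"
  proof -
    have i: "set_integrable lborel {a..b} k" for a b
      by (rule set_integrable_bounded_Icc) (use kB in auto)
    have "(LBINT s:{0..t}. k s) = integral {0..t} k" for t by (rule set_borel_integral_eq_integral(2)[OF i])
    then show ?thesis using indefinite_integral_continuous_1[OF set_borel_integral_eq_integral(1)[OF i[of 0 T]]] by simp
  qed
  have Dc: "continuous_on {0..T} D"
    unfolding D_def by (intro continuous_intros Kc continuous_on_subset[OF mc]) auto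
  define a where "a t = - integral {t..T} D" for t
  have ad: "(a has_real_derivative D t) (at t within {0..T})" if "t \<in> {0..T}" for t
    unfolding a_def using DERIV_minus[OF integral_has_real_derivative'[OF Dc that]] by simp
  have aT: "a T = 0" by (simp add: a_def)
  let ?T = "\<lambda>(t, \<xi>, x). a t * (f \<xi> * box_bump n l u x)"
  have "?T \<in> C1c_test T" by (rule C1c_test_product[where a'=D and f'=f' and R=R]) (use ad Dc f R in auto)
  from weak[OF this] have w0:
    "(LBINT t:{0..T}. LINT (\<xi>, x)|\<sigma> t. vector_derivative (\<lambda>s. a s * (f \<xi> * box_bump n l u x)) (at t within {0..T}))
        + (LINT (\<xi>, x)|\<sigma> 0. a 0 * (f \<xi> * box_bump n l u x)) - (LINT (\<xi>, x)|\<sigma> T. a T * (f \<xi> * box_bump n l u x))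
        = - (LBINT t:{0..T}. LINT (\<xi>, x)|\<sigma> t. deriv (\<lambda>\<zeta>. a t * (f \<zeta> * box_bump n l u x)) \<xi> * b t \<xi> x)"
    by simp
  have vd: "vector_derivative (\<lambda>s. a s * c) (at t within {0..T}) = D t * c" if "t \<in> {0..T}" for t c
  proof (rule vector_derivative_within_closed_interval[OF T that])
    show "((\<lambda>s. a s * c) has_vector_derivative D t * c) (at t within {0..T})"
      using DERIV_cmult_right[OF ad[OF that], of c] by (simp add: has_real_derivative_iff_has_vector_derivative)
  qed
  have dd: "deriv (\<lambda>\<zeta>. a t * (f \<zeta> * c)) \<xi> = a t * (f' \<xi> * c)" for t c \<xi>
    by (rule DERIV_imp_deriv) (auto intro!: derivative_eq_intros f(1))
  have 1: "(LBINT t:{0..T}. LINT (\<xi>, x)|\<sigma> t. vector_derivative (\<lambda>s. a s * (f \<xi> * box_bump n l u x)) (at t within {0..T}))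
     = (LBINT t:{0..T}. D t * m t)"
    by (rule set_lebesgue_integral_cong) (auto simp: vd m_def case_prod_beta')
  have 2: "(LBINT t:{0..T}. LINT (\<xi>, x)|\<sigma> t. deriv (\<lambda>\<zeta>. a t * (f \<zeta> * box_bump n l u x)) \<xi> * b t \<xi> x)
     = (LBINT t:{0..T}. a t * k t)"
    by (simp add: dd k_def flux_def case_prod_beta' mult.assoc)
  have 3: "(LINT (\<xi>, x)|\<sigma> 0. a 0 * (f \<xi> * box_bump n l u x)) = a 0 * m 0"
    by (simp add: m_def case_prod_beta')
  have w: "(LBINT t:{0..T}. D t * m t) + a 0 * m 0 = - (LBINT t:{0..T}. a t * k t)"
    using w0 unfolding 1 2 3 by (simp add: aT case_prod_beta')
  \<comment> \<open>D is extended by zero because the Fubini lemma is stated for globally bounded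
    measurable functions.\<close>
  define d where "d t = (if t \<in> {0..T} then D t else 0)" for t
  have dm[measurable]: "d \<in> borel_measurable borel"
    unfolding d_def by (rule borel_measurable_continuous_on_if) (use Dc in auto)
  obtain B' where B': "\<And>t. \<bar>d t\<bar> \<le> B'"
  proof -
    have "bounded (D ` {0..T})" by (intro compact_imp_bounded compact_continuous_image Dc) auto
    then obtain B' where "\<forall>t\<in>{0..T}. \<bar>D t\<bar> \<le> B'" by (auto simp: bounded_iff)
    then have "\<bar>d t\<bar> \<le> max B' 0" for t by (auto simp: d_def le_max_iff_disj)
    then show ?thesis by (rule that)
  qed
  have si: "set_integrable lborel {s..t} g" if "continuous_on {s..t} g" for g :: "real \<Rightarrow> real" and s t
    using that by (rule borel_integrable_atLeastAtMost')
  have F: "(LBINT t:{0..T}. D t * (LBINT s:{0..t}. k s)) = - (LBINT s:{0..T}. a s * k s)"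
  proof -
    have "(LBINT t:{0..T}. D t * (LBINT s:{0..t}. k s)) = (LBINT t:{0..T}. d t * (LBINT s:{0..t}. k s))"
      by (rule set_lebesgue_integral_cong) (auto simp: d_def)
    also have "\<dots> = (LBINT s:{0..T}. k s * (LBINT t:{s..T}. d t))"
      by (rule LBINT_Fubini_triangle) (use kB B' T in auto)
    also have "\<dots> = (LBINT s:{0..T}. - (a s * k s))"
    proof (rule set_lebesgue_integral_cong, simp, intro allI impI)
      fix s assume s: "s \<in> {0..T}"
      have "(LBINT t:{s..T}. d t) = (LBINT t:{s..T}. D t)"
        by (rule set_lebesgue_integral_cong) (use s in \<open>auto simp: d_def\<close>)
      also have "\<dots> = integral {s..T} D"
        by (rule set_borel_integral_eq_integral(2), rule si, rule continuous_on_subset[OF Dc]) (use s in auto)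
      finally show "k s * (LBINT t:{s..T}. d t) = - (a s * k s)" by (simp add: a_def)
    qed
    finally show ?thesis by (simp add: set_lebesgue_integral_def)
  qed
  \<comment> \<open>Expanding one factor D gives three integrals. Since the integral of D is - a(0),
    the Fubini identity \<open>F\<close> turns their combination into the weak formulation
    \<open>w\<close>, so it is zero.\<close>
  have "(LBINT t:{0..T}. D t * D t) = (LBINT t:{0..T}. D t * m t) - (LBINT t:{0..T}. D t * m 0) - (LBINT t:{0..T}. D t * (LBINT s:{0..t}. k s))"
  proof -
    have c: "continuous_on {0..T} (\<lambda>t. D t * m t)" "continuous_on {0..T} (\<lambda>t. D t * m 0)" "continuous_on {0..T} (\<lambda>t. D t * (LBINT s:{0..t}. k s))"
      by (intro continuous_on_mult Dc Kc continuous_on_const continuous_on_subset[OF mc] subset_UNIV)+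
    have "(LBINT t:{0..T}. D t * D t) = (LBINT t:{0..T}. D t * m t - D t * m 0 - D t * (LBINT s:{0..t}. k s))"
      by (intro set_lebesgue_integral_cong) (auto simp: D_def right_diff_distrib)
    then show ?thesis by (simp add: set_integral_diff si c)
  qed
  also have "(LBINT t:{0..T}. D t * m 0) = - a 0 * m 0"
    using set_borel_integral_eq_integral(2)[OF si[OF Dc]] by (simp add: a_def)
  finally have "(LBINT t:{0..T}. D t * D t) = 0" using w F by simp
  moreover have "(LBINT t:{0..T}. D t * D t) = integral {0..T} (\<lambda>t. D t * D t)"
    by (rule set_borel_integral_eq_integral(2), rule si) (intro continuous_intros Dc)
  ultimately have "\<forall>t\<in>{0..T}. D t * D t = 0"
    using integral_eq_0_iff[OF continuous_on_mult[OF Dc Dc] T] by simp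
  then show ?thesis unfolding transported_def by (auto simp: D_def m_def k_def)
qed

text \<open>Dominated convergence is used at fixed time, with a majorant of linear growth in \<xi>
  that the moments make integrable, and then in time, with the constant from
  \<open>flux_bound\<close>.\<close>

lemma transported_limit:
  assumes tr: "\<And>n::nat. transported (\<phi> n) (\<psi> n)"
    and [measurable]: "\<And>n. \<phi> n \<in> borel_measurable borel" "\<And>n. \<psi> n \<in> borel_measurable borel"
    and lim: "\<And>z. (\<lambda>n. \<phi> n z) \<longlonglongrightarrow> \<Phi> z" "\<And>z. (\<lambda>n. \<psi> n z) \<longlonglongrightarrow> \<Psi> z"
    and bd: "\<And>n z. \<bar>\<phi> n z\<bar> \<le> C" "\<And>n z. \<bar>\<psi> n z\<bar> \<le> C"
  shows "transported \<Phi> \<Psi>"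
  unfolding transported_def
proof
  fix t assume t: "t \<in> {0..T}"
  have [measurable]: "\<Phi> \<in> borel_measurable borel" "\<Psi> \<in> borel_measurable borel"
    by (auto intro: borel_measurable_LIMSEQ_real lim)
  obtain B where B: "0 \<le> B" "\<And>\<psi> C s. \<psi> \<in> borel_measurable borel \<Longrightarrow> (\<And>z. \<bar>\<psi> z\<bar> \<le> C) \<Longrightarrow> \<bar>flux \<psi> s\<bar> \<le> C * B"
    using flux_bound by blast
  have m: "(\<lambda>n. LINT z|\<sigma> s. \<phi> n z) \<longlonglongrightarrow> (LINT z|\<sigma> s. \<Phi> z)" for s
    by (rule integral_dominated_convergence[where w="\<lambda>_. C"]) (use lim bd in auto)
  have k: "(\<lambda>n. flux (\<psi> n) s) \<longlonglongrightarrow> flux \<Psi> s" for s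
    unfolding flux_def
  proof (rule integral_dominated_convergence[where w="\<lambda>z. C * (K + A * \<bar>fst z\<bar>)"])
    have C0: "0 \<le> C" using order_trans[OF abs_ge_zero bd(1)[of 0 undefined]] .
    show "integrable (\<sigma> s) (\<lambda>z. C * (K + A * \<bar>fst z\<bar>))"
      by (rule integrable_linear_growth[of _ "C * K" "C * A"])
         (use C0 K0 A1 in \<open>auto simp: abs_mult algebra_simps abs_of_nonneg add_nonneg_nonneg\<close>)
    show "AE z in \<sigma> s. norm (\<psi> n z * b s (fst z) (snd z)) \<le> C * (K + A * \<bar>fst z\<bar>)" for n
      using C0 by (auto simp: abs_mult intro!: mult_mono b_growth bd)
    show "AE z in \<sigma> s. (\<lambda>n. \<psi> n z * b s (fst z) (snd z)) \<longlonglongrightarrow> \<Psi> z * b s (fst z) (snd z)"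
      by (auto intro!: tendsto_mult lim)
  qed measurable
  have "(\<lambda>n. LBINT s:{0..t}. flux (\<psi> n) s) \<longlonglongrightarrow> (LBINT s:{0..t}. flux \<Psi> s)"
    unfolding set_lebesgue_integral_def
  proof (rule integral_dominated_convergence[where w="\<lambda>s. indicator {0..t} s *\<^sub>R (C * B)"])
    show "integrable lborel (\<lambda>s. indicator {0..t} s *\<^sub>R (C * B))"
      using set_integrable_const_Icc by (simp add: set_integrable_def)
    show "AE s in lborel. (\<lambda>n. indicator {0..t} s *\<^sub>R flux (\<psi> n) s) \<longlonglongrightarrow> indicator {0..t} s *\<^sub>R flux \<Psi> s"
      by (intro AE_I2 tendsto_scaleR tendsto_const k)
    show "AE s in lborel. norm (indicator {0..t} s *\<^sub>R flux (\<psi> n) s) \<le> indicator {0..t} s *\<^sub>R (C * B)" for n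
      using B(2)[of "\<psi> n" C] bd by (auto simp: indicator_def)
  qed measurable
  moreover have "(\<lambda>n. LBINT s:{0..t}. flux (\<psi> n) s) = (\<lambda>n. (LINT z|\<sigma> t. \<phi> n z) - (LINT z|\<sigma> 0. \<phi> n z))"
    using tr t by (auto simp: transported_def)
  moreover have "(\<lambda>n. (LINT z|\<sigma> t. \<phi> n z) - (LINT z|\<sigma> 0. \<phi> n z)) \<longlonglongrightarrow> (LINT z|\<sigma> t. \<Phi> z) - (LINT z|\<sigma> 0. \<Phi> z)"
    by (intro tendsto_diff m)
  ultimately show "(LINT z|\<sigma> t. \<Phi> z) - (LINT z|\<sigma> 0. \<Phi> z) = (LBINT s:{0..t}. flux \<Psi> s)"
    using LIMSEQ_unique by auto
qed

lemma transported_add: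
  assumes tr: "transported \<phi>1 \<psi>1" "transported \<phi>2 \<psi>2"
    and [measurable]: "\<phi>1 \<in> borel_measurable borel" "\<psi>1 \<in> borel_measurable borel" "\<phi>2 \<in> borel_measurable borel" "\<psi>2 \<in> borel_measurable borel"
    and bd: "\<And>z. \<bar>\<phi>1 z\<bar> \<le> C" "\<And>z. \<bar>\<psi>1 z\<bar> \<le> C" "\<And>z. \<bar>\<phi>2 z\<bar> \<le> C" "\<And>z. \<bar>\<psi>2 z\<bar> \<le> C"
  shows "transported (\<lambda>z. \<phi>1 z + c * \<phi>2 z) (\<lambda>z. \<psi>1 z + c * \<psi>2 z)"
  unfolding transported_def
proof
  fix t assume t: "t \<in> {0..T}"
  obtain B where B: "0 \<le> B" "\<And>\<psi> C s. \<psi> \<in> borel_measurable borel \<Longrightarrow> (\<And>z. \<bar>\<psi> z\<bar> \<le> C) \<Longrightarrow> \<bar>flux \<psi> s\<bar> \<le> C * B"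
    using flux_bound by blast
  have i: "integrable (\<sigma> s) \<phi>1" "integrable (\<sigma> s) \<phi>2" for s
    by (auto intro!: integrable_linear_growth[of _ C 0] bd simp: bd)
  have fl: "flux (\<lambda>z. \<psi>1 z + c * \<psi>2 z) s = flux \<psi>1 s + c * flux \<psi>2 s" for s
    using integrable_flux[of \<psi>1 C s] integrable_flux[of \<psi>2 C s] bd
    by (simp add: flux_def distrib_right mult.assoc)
  have fi: "set_integrable lborel {0..t} (flux \<psi>1)" "set_integrable lborel {0..t} (flux \<psi>2)"
    by (rule set_integrable_bounded_Icc[where C="C * B"]; use B(2) bd in simp)+
  show "(LINT z|\<sigma> t. \<phi>1 z + c * \<phi>2 z) - (LINT z|\<sigma> 0. \<phi>1 z + c * \<phi>2 z) = (LBINT s:{0..t}. flux (\<lambda>z. \<psi>1 z + c * \<psi>2 z) s)"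
  proof -
    have "(LINT z|\<sigma> t. \<phi>1 z + c * \<phi>2 z) - (LINT z|\<sigma> 0. \<phi>1 z + c * \<phi>2 z)
       = ((LINT z|\<sigma> t. \<phi>1 z) - (LINT z|\<sigma> 0. \<phi>1 z)) + c * ((LINT z|\<sigma> t. \<phi>2 z) - (LINT z|\<sigma> 0. \<phi>2 z))"
      by (simp add: i right_diff_distrib)
    moreover have "(LBINT s:{0..t}. flux (\<lambda>z. \<psi>1 z + c * \<psi>2 z) s) = (LBINT s:{0..t}. flux \<psi>1 s) + c * (LBINT s:{0..t}. flux \<psi>2 s)"
      unfolding fl by (subst set_integral_add) (use fi in auto)
    ultimately show ?thesis using tr t by (simp add: transported_def)
  qed
qed

lemma transported_sum:
  assumes "finite I"
    and "\<And>i. i \<in> I \<Longrightarrow> transported (\<phi> i) (\<psi> i)" "\<And>i. i \<in> I \<Longrightarrow> \<phi> i \<in> borel_measurable borel" "\<And>i. i \<in> I \<Longrightarrow> \<psi> i \<in> borel_measurable borel"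
    and "\<And>i z. i \<in> I \<Longrightarrow> \<bar>\<phi> i z\<bar> \<le> C" "\<And>i z. i \<in> I \<Longrightarrow> \<bar>\<psi> i z\<bar> \<le> C"
  shows "transported (\<lambda>z. \<Sum>i\<in>I. \<phi> i z) (\<lambda>z. \<Sum>i\<in>I. \<psi> i z)"
  using assms
proof (induction I rule: finite_induct)
  case empty
  then show ?case by (simp add: transported_def flux_def set_lebesgue_integral_def)
next
  case (insert i I)
  have sb: "\<bar>\<Sum>j\<in>I. g j z\<bar> \<le> real (card I) * C" if "\<And>j. j \<in> I \<Longrightarrow> \<bar>g j z\<bar> \<le> C" for g :: "_ \<Rightarrow> real \<times> 'a \<Rightarrow> real" and z
    using order_trans[OF sum_abs sum_bounded_above[of I "\<lambda>j. \<bar>g j z\<bar>" C]] that by simp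
  have C0: "0 \<le> C" using order_trans[OF abs_ge_zero insert.prems(4)[of i undefined]] by simp
  have c: "C \<le> (1 + real (card I)) * C" "real (card I) * C \<le> (1 + real (card I)) * C"
    using C0 by (auto simp: distrib_right)
  have "transported (\<lambda>z. \<phi> i z + 1 * (\<Sum>i\<in>I. \<phi> i z)) (\<lambda>z. \<psi> i z + 1 * (\<Sum>i\<in>I. \<psi> i z))"
  proof (rule transported_add[where C="(1 + real (card I)) * C"])
    show "transported (\<lambda>z. \<Sum>i\<in>I. \<phi> i z) (\<lambda>z. \<Sum>i\<in>I. \<psi> i z)" using insert by auto
  qed (use insert.prems in \<open>auto intro!: order_trans[OF _ c(1)] order_trans[OF sb c(2)] borel_measurable_sum\<close>)
  then show ?case using insert by simp
qed

lemma transported_box: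
  fixes f f' :: "real \<Rightarrow> real"
  assumes f: "\<And>y. (f has_real_derivative f' y) (at y)" "continuous_on UNIV f'"
    and R: "\<And>y. f y \<noteq> 0 \<Longrightarrow> \<bar>y\<bar> \<le> R" and C: "\<And>y. \<bar>f y\<bar> \<le> C" "\<And>y. \<bar>f' y\<bar> \<le> C"
  shows "transported (\<lambda>z. f (fst z) * indicator (box l u) (snd z)) (\<lambda>z. f' (fst z) * indicator (box l u) (snd z))"
proof (rule transported_limit[where C=C and \<phi>="\<lambda>n z. f (fst z) * box_bump n l u (snd z)" and \<psi>="\<lambda>n z. f' (fst z) * box_bump n l u (snd z)"])
  have cf: "continuous_on UNIV f" using f(1) by (meson DERIV_continuous_on)
  have [measurable]: "f \<in> borel_measurable borel" "f' \<in> borel_measurable borel"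
    using cf f(2) by (auto intro: borel_measurable_continuous_onI)
  show "transported (\<lambda>z. f (fst z) * box_bump n l u (snd z)) (\<lambda>z. f' (fst z) * box_bump n l u (snd z))" for n
    by (rule transported_box_bump) (use assms in auto)
  have C0: "0 \<le> C" using order_trans[OF abs_ge_zero C(1)] .
  show "\<bar>f (fst z) * box_bump n l u (snd z)\<bar> \<le> C" "\<bar>f' (fst z) * box_bump n l u (snd z)\<bar> \<le> C" for n z
    using mult_mono[OF C(1)[of "fst z"] box_bump_bounds(2)[of n l u "snd z"]] mult_mono[OF C(2)[of "fst z"] box_bump_bounds(2)[of n l u "snd z"]] C0
    by (simp_all add: abs_mult box_bump_bounds)
  show "(\<lambda>z. f (fst z) * box_bump n l u (snd z)) \<in> borel_measurable borel"
    "(\<lambda>z. f' (fst z) * box_bump n l u (snd z)) \<in> borel_measurable borel" for n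
    by measurable
qed (auto intro!: tendsto_mult box_bump_limit)

text \<open>Dynkin argument in x: open boxes are stable under intersection, complements follow by
  linearity from the whole space, and disjoint unions by bounded limits.\<close>

lemma transported_indicator:
  fixes f f' :: "real \<Rightarrow> real"
  assumes f: "\<And>y. (f has_real_derivative f' y) (at y)" "continuous_on UNIV f'"
    and R: "\<And>y. f y \<noteq> 0 \<Longrightarrow> \<bar>y\<bar> \<le> R" and C: "\<And>y. \<bar>f y\<bar> \<le> C" "\<And>y. \<bar>f' y\<bar> \<le> C"
    and B: "B \<in> sets borel"
  shows "transported (\<lambda>z. f (fst z) * indicator B (snd z)) (\<lambda>z. f' (fst z) * indicator B (snd z))"
proof -
  have cf: "continuous_on UNIV f" using f(1) by (meson DERIV_continuous_on)
  have [measurable]: "f \<in> borel_measurable borel" "f' \<in> borel_measurable borel"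
    using cf f(2) by (auto intro: borel_measurable_continuous_onI)
  have C0: "0 \<le> C" using order_trans[OF abs_ge_zero C(1)] .
  have bd: "\<bar>f y * indicator X x\<bar> \<le> C" "\<bar>f' y * indicator X x\<bar> \<le> C" for y x and X :: "'a set"
    using C(1)[of y] C(2)[of y] C0 by (auto simp: indicator_def)
  let ?tr = "\<lambda>B. transported (\<lambda>z. f (fst z) * indicator B (snd z)) (\<lambda>z. f' (fst z) * indicator B (snd z))"
  have lim: "?tr X" if "\<And>n::nat. ?tr (X' n)" "\<And>n. X' n \<in> sets borel"
    "\<And>x. (\<lambda>n. indicator (X' n) x :: real) \<longlonglongrightarrow> indicator X x" for X' X
    by (rule transported_limit[where C=C, OF that(1)])
       (use that in \<open>auto intro!: tendsto_mult bd\<close>)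
  \<comment> \<open>\<open>UNIV\<close> is not itself a box and is reached through an increasing
    sequence of boxes; the complement step below subtracts from it.\<close>
  have univ: "?tr UNIV"
  proof (rule lim)
    show "?tr (box (- (real n *\<^sub>R One)) (real n *\<^sub>R One))" for n :: nat
      by (rule transported_box[OF f R C])
    fix x :: 'a
    have "incseq (\<lambda>n::nat. box (- (real n *\<^sub>R One)) (real n *\<^sub>R One) :: 'a set)"
      by (force simp: incseq_def mem_box)
    from LIMSEQ_indicator_incseq[OF this, of x]
    show "(\<lambda>n. indicator (box (- (real n *\<^sub>R One)) (real n *\<^sub>R One)) x :: real) \<longlonglongrightarrow> indicator UNIV x"
      by (simp add: UN_box_eq_UNIV)
  qed auto
  have "box p q \<in> range (\<lambda>(a, b). box a b :: 'a set)" for p q :: 'a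
    by (rule range_eqI[of _ _ "(p, q)"]) simp
  then have "Int_stable (range (\<lambda>(a, b). box a b :: 'a set))"
    by (intro Int_stableI) (auto simp: box_Int_box)
  moreover have "range (\<lambda>(a, b). box a b :: 'a set) \<subseteq> Pow UNIV" by simp
  moreover have "B \<in> sigma_sets UNIV (range (\<lambda>(a, b). box a b :: 'a set))"
    using B by (subst (asm) borel_eq_box) (simp add: sets_measure_of)
  ultimately show ?thesis
  proof (induction B rule: sigma_sets_induct_disjoint)
    case (basic A)
    then show ?case using transported_box[OF f R C] by auto
  next
    case empty
    then show ?case by (simp add: transported_def flux_def set_lebesgue_integral_def)
  next
    case (compl A)
    have A: "A \<in> sets borel" using compl(1) by (subst borel_eq_box) (simp add: sets_measure_of)
    have "transported (\<lambda>z. f (fst z) * indicator UNIV (snd z) + (-1) * (f (fst z) * indicator A (snd z)))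
        (\<lambda>z. f' (fst z) * indicator UNIV (snd z) + (-1) * (f' (fst z) * indicator A (snd z)))"
      by (rule transported_add[OF univ compl(2), where C=C]) (use A bd C in auto)
    moreover have "f (fst z) * indicator UNIV (snd z) + (-1) * (f (fst z) * indicator A (snd z)) = f (fst z) * indicator (UNIV - A) (snd z)"
      "f' (fst z) * indicator UNIV (snd z) + (-1) * (f' (fst z) * indicator A (snd z)) = f' (fst z) * indicator (UNIV - A) (snd z)" for z
      by (auto simp: indicator_def)
    ultimately show ?case by simp
  next
    case (union A)
    have A: "A n \<in> sets borel" for n using union(2) by (subst borel_eq_box) (auto simp: sets_measure_of)
    have fin: "?tr (\<Union>i<n. A i)" for n
    proof (induction n)
      case 0
      then show ?case by (simp add: transported_def flux_def set_lebesgue_integral_def)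
    next
      case (Suc n)
      have [measurable]: "(\<Union>i<n. A i) \<in> sets borel" "A n \<in> sets borel" using A by auto
      have "transported (\<lambda>z. f (fst z) * indicator (\<Union>i<n. A i) (snd z) + 1 * (f (fst z) * indicator (A n) (snd z)))
        (\<lambda>z. f' (fst z) * indicator (\<Union>i<n. A i) (snd z) + 1 * (f' (fst z) * indicator (A n) (snd z)))"
        by (rule transported_add[OF Suc union(3), where C=C]) (use A bd C in auto)
      moreover have "indicator (\<Union>i<n. A i) x + indicator (A n) x = (indicator (\<Union>i<Suc n. A i) x :: real)" for x
      proof -
        have "(\<Union>i<n. A i) \<inter> A n = {}" using union(1) by (auto simp: disjoint_family_on_def) (metis disjoint_iff order_less_irrefl)
        then have "indicator ((\<Union>i<n. A i) \<union> A n) x = indicator (\<Union>i<n. A i) x + (indicator (A n) x :: real)"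
          by (simp add: indicator_def) blast
        then show ?thesis by (simp add: lessThan_Suc Un_commute)
      qed
      ultimately show ?case by (simp flip: distrib_left)
    qed
    show ?case by (rule lim[OF fin]) (use A in \<open>auto intro!: LIMSEQ_indicator_UN\<close>)
  qed
qed

text \<open>Removes the compact support in \<xi> by the cut-off k(y / (n + 1)); the extra term from
  its derivative is O(1/n). The translation by a constant c prepares the shift by a function of
  x.\<close>

lemma transported_translate:
  fixes \<theta> \<theta>' :: "real \<Rightarrow> real"
  assumes \<theta>: "\<And>y. (\<theta> has_real_derivative \<theta>' y) (at y)" "continuous_on UNIV \<theta>'"
    and C: "\<And>y. \<bar>\<theta> y\<bar> \<le> C" "\<And>y. \<bar>\<theta>' y\<bar> \<le> C" and B: "B \<in> sets borel"
  shows "transported (\<lambda>z. \<theta> (fst z - c) * indicator B (snd z)) (\<lambda>z. \<theta>' (fst z - c) * indicator B (snd z))"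
proof -
  have c\<theta>: "continuous_on UNIV \<theta>" using \<theta>(1) by (meson DERIV_continuous_on)
  have [measurable]: "\<theta> \<in> borel_measurable borel" "\<theta>' \<in> borel_measurable borel"
    using c\<theta> \<theta>(2) by (auto intro: borel_measurable_continuous_onI)
  have C0: "0 \<le> C" using order_trans[OF abs_ge_zero C(1)] .
  \<comment> \<open>\<open>bump 1 (-1) 1 0\<close> equals 1/4, so the factor 4 normalises k(0) =
    1.\<close>
  define k where "k y = 4 * bump 1 (-1) 1 y" for y
  define k' where "k' y = 4 * bump' 1 (-1) 1 y" for y
  have kd: "(k has_real_derivative k' y) (at y)" for y
    unfolding k_def k'_def by (intro DERIV_cmult DERIV_bump)
  have kc: "continuous_on UNIV k'" unfolding k'_def by (intro continuous_intros continuous_bump')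
  have kc0: "continuous_on UNIV k" using kd by (meson DERIV_continuous_on)
  have [measurable]: "k \<in> borel_measurable borel" "k' \<in> borel_measurable borel"
    using kc kc0 by (auto intro: borel_measurable_continuous_onI)
  have kb: "\<bar>k y\<bar> \<le> 4" for y using bump_bounds[of 1 "-1" 1 y] by (simp add: k_def)
  have k'b: "\<bar>k' y\<bar> \<le> 16" for y
  proof -
    have "0 \<le> sstep' (y + 1) * sstep (1 - y)" "sstep' (y + 1) * sstep (1 - y) \<le> 2 * 1"
      "0 \<le> sstep (y + 1) * sstep' (1 - y)" "sstep (y + 1) * sstep' (1 - y) \<le> 1 * 2"
      by (intro mult_nonneg_nonneg mult_mono; simp add: sstep'_bounds)+
    then show ?thesis by (simp add: k'_def bump'_def abs_le_iff)
  qed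
  have k0: "k 0 = 1" by (simp add: k_def bump_def sstep_def)
  define F where "F n y = \<theta> (y - c) * k (y / real (Suc n))" for n y
  define F' where "F' n y = \<theta>' (y - c) * k (y / real (Suc n)) + \<theta> (y - c) * (k' (y / real (Suc n)) / real (Suc n))" for n y
  have FD: "(F n has_real_derivative F' n y) (at y)" for n y
  proof -
    have 1: "((\<lambda>y. \<theta> (y - c)) has_real_derivative \<theta>' (y - c) * 1) (at y)"
      by (rule DERIV_chain2[OF \<theta>(1)]) (auto intro!: derivative_eq_intros)
    have 2: "((\<lambda>y. k (y / real (Suc n))) has_real_derivative k' (y / real (Suc n)) * (1 / real (Suc n))) (at y)"
      by (rule DERIV_chain2[OF kd]) (auto intro!: derivative_eq_intros)
    show ?thesis unfolding F_def F'_def by (rule DERIV_cong[OF DERIV_mult[OF 1 2]]) (simp add: mult_ac)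
  qed
  have Fc: "continuous_on UNIV (F' n)" for n
    unfolding F'_def
    by (intro continuous_intros continuous_on_compose2[OF \<theta>(2)] continuous_on_compose2[OF c\<theta>] continuous_on_compose2[OF kc] continuous_on_compose2[OF kc0]) auto
  have Fb: "\<bar>F n y\<bar> \<le> 20 * C" for n y
  proof -
    have "\<bar>F n y\<bar> \<le> C * 4" unfolding F_def abs_mult by (intro mult_mono C kb C0) auto
    then show ?thesis using C0 by linarith
  qed
  have F'b: "\<bar>F' n y\<bar> \<le> 20 * C" for n y
  proof -
    have "\<bar>\<theta>' (y - c) * k (y / real (Suc n))\<bar> \<le> C * 4" unfolding abs_mult by (intro mult_mono C kb C0) auto
    moreover have "\<bar>k' (y / real (Suc n)) / real (Suc n)\<bar> \<le> 16"
      using k'b[of "y / real (Suc n)"] by (simp add: divide_le_eq)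
    then have "\<bar>\<theta> (y - c) * (k' (y / real (Suc n)) / real (Suc n))\<bar> \<le> C * 16"
      unfolding abs_mult[of "\<theta> _"] by (intro mult_mono C C0) auto
    ultimately show ?thesis unfolding F'_def by linarith
  qed
  have sn: "(\<lambda>n. y / real (Suc n)) \<longlonglongrightarrow> 0" for y :: real
    using LIMSEQ_Suc[OF lim_const_over_n[of y]] by simp
  have kl: "(\<lambda>n. k (y / real (Suc n))) \<longlonglongrightarrow> 1" for y
    using continuous_on_tendsto_compose[OF kc0 sn[of y]] k0 by simp
  have k'l: "(\<lambda>n. k' (y / real (Suc n)) / real (Suc n)) \<longlonglongrightarrow> 0" for y
  proof (rule Lim_null_comparison[OF _ sn[of 16]])
    show "\<forall>\<^sub>F n in sequentially. norm (k' (y / real (Suc n)) / real (Suc n)) \<le> 16 / real (Suc n)"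
      using k'b by (intro always_eventually) (auto intro!: divide_right_mono)
  qed
  show ?thesis
  proof (rule transported_limit[where C="20 * C" and \<phi>="\<lambda>n z. F n (fst z) * indicator B (snd z)" and \<psi>="\<lambda>n z. F' n (fst z) * indicator B (snd z)"])
    show "transported (\<lambda>z. F n (fst z) * indicator B (snd z)) (\<lambda>z. F' n (fst z) * indicator B (snd z))" for n
    proof (rule transported_indicator[OF FD Fc _ Fb F'b B])
      fix y assume "F n y \<noteq> 0"
      then have "- 1 \<le> y / real (Suc n) \<and> y / real (Suc n) \<le> 1"
        using bump_support[of 1 "-1" 1 "y / real (Suc n)"] by (auto simp: F_def k_def)
      then show "\<bar>y\<bar> \<le> real (Suc n)" by (auto simp: abs_le_iff divide_le_eq le_divide_eq)
    qed
    show "(\<lambda>n. F n (fst z) * indicator B (snd z)) \<longlonglongrightarrow> \<theta> (fst z - c) * indicator B (snd z)" for z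
      unfolding F_def using tendsto_mult[OF tendsto_mult[OF tendsto_const[of "\<theta> (fst z - c)"] kl[of "fst z"]] tendsto_const] by simp
    show "(\<lambda>n. F' n (fst z) * indicator B (snd z)) \<longlonglongrightarrow> \<theta>' (fst z - c) * indicator B (snd z)" for z
      unfolding F'_def
      using tendsto_mult[OF tendsto_add[OF tendsto_mult[OF tendsto_const[of "\<theta>' (fst z - c)"] kl[of "fst z"]]
         tendsto_mult[OF tendsto_const[of "\<theta> (fst z - c)"] k'l[of "fst z"]]] tendsto_const] by simp
  qed (use Fb F'b C0 B in \<open>auto simp: F_def F'_def indicator_def\<close>)
qed

text \<open>On each level set of a simple function the shift is constant, and the level set is a
  Borel cut-off in x of the kind already covered. Approximation of h by simple functions then admits
  every measurable shift.\<close>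

lemma transported_moving:
  fixes \<theta> \<theta>' :: "real \<Rightarrow> real"
  assumes \<theta>: "\<And>y. (\<theta> has_real_derivative \<theta>' y) (at y)" "continuous_on UNIV \<theta>'"
    and C: "\<And>y. \<bar>\<theta> y\<bar> \<le> C" "\<And>y. \<bar>\<theta>' y\<bar> \<le> C" and B[measurable]: "B \<in> sets borel"
    and h[measurable]: "h \<in> borel_measurable borel"
  shows "transported (\<lambda>z. \<theta> (fst z - h (snd z)) * indicator B (snd z)) (\<lambda>z. \<theta>' (fst z - h (snd z)) * indicator B (snd z))"
proof -
  have c\<theta>: "continuous_on UNIV \<theta>" using \<theta>(1) by (meson DERIV_continuous_on)
  have [measurable]: "\<theta> \<in> borel_measurable borel" "\<theta>' \<in> borel_measurable borel"
    using c\<theta> \<theta>(2) by (auto intro: borel_measurable_continuous_onI)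
  have C0: "0 \<le> C" using order_trans[OF abs_ge_zero C(1)] .
  obtain F where F: "\<And>i. simple_function borel (F i)" "\<And>x. (\<lambda>i. F i x) \<longlonglongrightarrow> h x"
    using borel_measurable_implies_sequence_metric[OF h, of 0] by auto
  have [measurable]: "F i \<in> borel_measurable borel" for i using borel_measurable_simple_function[OF F(1)] .
  show ?thesis
  proof (rule transported_limit[where C=C and \<phi>="\<lambda>n z. \<theta> (fst z - F n (snd z)) * indicator B (snd z)" and \<psi>="\<lambda>n z. \<theta>' (fst z - F n (snd z)) * indicator B (snd z)"])
    fix n
    have fin: "finite (range (F n))" using F(1)[of n] by (simp add: simple_function_def)
    let ?B = "\<lambda>c. B \<inter> (F n -` {c})"
    have Bc: "?B c \<in> sets borel" for c
      using measurable_sets[of "F n" borel borel "{c}"] by auto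
    have "transported (\<lambda>z. \<Sum>c\<in>range (F n). \<theta> (fst z - c) * indicator (?B c) (snd z)) (\<lambda>z. \<Sum>c\<in>range (F n). \<theta>' (fst z - c) * indicator (?B c) (snd z))"
      by (rule transported_sum[OF fin transported_translate[OF \<theta> C Bc], where C=C])
         (use C C0 Bc in \<open>auto simp: indicator_def\<close>)
    moreover have "(\<Sum>c\<in>range (F n). g (fst z - c) * indicator (?B c) (snd z)) = g (fst z - F n (snd z)) * indicator B (snd z)"
      for g :: "real \<Rightarrow> real" and z :: "real \<times> 'a"
    proof -
      have "(\<Sum>c\<in>range (F n). g (fst z - c) * indicator (?B c) (snd z))
         = (\<Sum>c\<in>{F n (snd z)}. g (fst z - c) * indicator (?B c) (snd z))"
        by (rule sum.mono_neutral_right[OF fin]) (auto simp: indicator_def)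
      then show ?thesis by (simp add: indicator_def)
    qed
    ultimately show "transported (\<lambda>z. \<theta> (fst z - F n (snd z)) * indicator B (snd z)) (\<lambda>z. \<theta>' (fst z - F n (snd z)) * indicator B (snd z))"
      by simp
  next
    fix z :: "real \<times> 'a"
    have *: "(\<lambda>n. fst z - F n (snd z)) \<longlonglongrightarrow> fst z - h (snd z)" by (intro tendsto_diff tendsto_const F)
    show "(\<lambda>n. \<theta> (fst z - F n (snd z)) * indicator B (snd z)) \<longlonglongrightarrow> \<theta> (fst z - h (snd z)) * indicator B (snd z)"
      "(\<lambda>n. \<theta>' (fst z - F n (snd z)) * indicator B (snd z)) \<longlonglongrightarrow> \<theta>' (fst z - h (snd z)) * indicator B (snd z)"
      using continuous_on_tendsto_compose[OF c\<theta> *] continuous_on_tendsto_compose[OF \<theta>(2) *]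
      by (auto intro!: tendsto_mult)
  qed (use C C0 in \<open>auto simp: indicator_def\<close>)
qed

end

lemma LBINT_Icc_singleton: "(LBINT \<tau>:{a..a::real}. (k \<tau> :: real)) = 0"
proof -
  have "AE \<tau> in lborel. indicator {a..a} \<tau> *\<^sub>R k \<tau> = 0"
    using AE_lborel_singleton[of a] by eventually_elim simp
  then show ?thesis unfolding set_lebesgue_integral_def by (rule integral_eq_zero_AE)
qed

section \<open>Conservation of mass along characteristics\<close>

context linear_equation
begin

text \<open>The displacement of a characteristic is a time integral inside the integral over
  \<sigma> s. Taken outside, it can be combined with the time integral of the flux.\<close>

lemma product_integral_swap:
  fixes \<psi> :: "real \<times> 'a \<Rightarrow> real" and \<beta> :: "real \<Rightarrow> 'a \<Rightarrow> real"
  assumes [measurable]: "\<psi> \<in> borel_measurable borel" "(\<lambda>(t, x). \<beta> t x) \<in> borel_measurable (borel \<Otimes>\<^sub>M borel)"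
    and bd: "\<And>\<tau> z. \<bar>\<psi> z * \<beta> \<tau> (snd z)\<bar> \<le> C" and t: "0 \<le> t"
  shows "(LINT z|\<sigma> s. \<psi> z * (LBINT \<tau>:{0..t}. \<beta> \<tau> (snd z))) = (LBINT \<tau>:{0..t}. LINT z|\<sigma> s. \<psi> z * \<beta> \<tau> (snd z))"
    "integrable (\<sigma> s) (\<lambda>z. \<psi> z * (LBINT \<tau>:{0..t}. \<beta> \<tau> (snd z)))"
proof -
  interpret pr: pair_sigma_finite "\<sigma> s" lborel
    by (simp add: pair_sigma_finite_def S.sigma_finite_measure_axioms sigma_finite_lborel)
  let ?h = "\<lambda>z \<tau>. indicator {0..t} \<tau> * (\<psi> z * \<beta> \<tau> (snd z))"
  have i: "integrable (\<sigma> s \<Otimes>\<^sub>M lborel) (\<lambda>(z, \<tau>). ?h z \<tau>)"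
  proof (rule Bochner_Integration.integrable_bound)
    show "integrable (\<sigma> s \<Otimes>\<^sub>M lborel) (\<lambda>z. C * indicator (UNIV \<times> {0..t}) z :: real)"
      by (intro integrable_mult_right integrable_real_indicator)
         (use t S.emeasure_space_1[of s] in \<open>auto simp: lborel.emeasure_pair_measure_Times\<close>)
    show "AE z in \<sigma> s \<Otimes>\<^sub>M lborel. norm (case z of (z, \<tau>) \<Rightarrow> ?h z \<tau>) \<le> norm (C * indicator (UNIV \<times> {0..t}) z)"
    proof (rule AE_I2)
      fix y :: "(real \<times> 'a) \<times> real"
      obtain z \<tau> where y: "y = (z, \<tau>)" by (cases y)
      have "\<bar>\<psi> z * \<beta> \<tau> (snd z)\<bar> \<le> \<bar>C\<bar>" by (rule order_trans[OF bd abs_ge_self])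
      then show "norm (case y of (z, \<tau>) \<Rightarrow> ?h z \<tau>) \<le> norm (C * indicator (UNIV \<times> {0..t}) y)"
        by (auto simp: y indicator_def)
    qed
  qed measurable
  have eq: "(LINT \<tau>|lborel. ?h z \<tau>) = \<psi> z * (LBINT \<tau>:{0..t}. \<beta> \<tau> (snd z))" for z
  proof -
    have "(LINT \<tau>|lborel. ?h z \<tau>) = (LINT \<tau>|lborel. \<psi> z * (indicator {0..t} \<tau> * \<beta> \<tau> (snd z)))"
      by (simp add: mult_ac)
    then show ?thesis by (simp add: set_lebesgue_integral_def)
  qed
  show "(LINT z|\<sigma> s. \<psi> z * (LBINT \<tau>:{0..t}. \<beta> \<tau> (snd z))) = (LBINT \<tau>:{0..t}. LINT z|\<sigma> s. \<psi> z * \<beta> \<tau> (snd z))"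
    using pr.Fubini_integral[OF i] by (simp add: eq set_lebesgue_integral_def)
  show "integrable (\<sigma> s) (\<lambda>z. \<psi> z * (LBINT \<tau>:{0..t}. \<beta> \<tau> (snd z)))"
    using pr.integrable_fst[OF i] by (simp add: eq)
qed

text \<open>The defect \<open>D\<close> has derivative zero: between \<open>s\<close> and \<open>t\<close>, the measure and the characteristic are
  moved one after the other, which costs \<open>o(|t - s|)\<close>.\<close>

lemma moving_frame:
  fixes \<theta> \<theta>' :: "real \<Rightarrow> real" and Z :: "real \<Rightarrow> 'a \<Rightarrow> real"
  assumes \<theta>: "\<And>y. (\<theta> has_real_derivative \<theta>' y) (at y)"
    and C: "\<And>y. \<bar>\<theta> y\<bar> \<le> C" "\<And>y. \<bar>\<theta>' y\<bar> \<le> C" and L: "\<And>v w. \<bar>\<theta>' v - \<theta>' w\<bar> \<le> L * \<bar>v - w\<bar>"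
    and B[measurable]: "B \<in> sets borel" and Zm[measurable]: "(\<lambda>(t, x). Z t x) \<in> borel_measurable (borel \<Otimes>\<^sub>M borel)"
    and Zb: "\<And>t x. x \<in> B \<Longrightarrow> \<bar>Z t x\<bar> \<le> R"
    and Z: "\<And>t x. x \<in> B \<Longrightarrow> t \<in> {0..T} \<Longrightarrow> Z t x = Z 0 x + (LBINT s:{0..t}. b s (Z s x) x)"
    and t: "t \<in> {0..T}"
  shows "(LINT z|\<sigma> t. \<theta> (fst z - Z t (snd z)) * indicator B (snd z)) - (LINT z|\<sigma> 0. \<theta> (fst z - Z 0 (snd z)) * indicator B (snd z))
    = (LBINT \<tau>:{0..t}. LINT z|\<sigma> \<tau>. \<theta>' (fst z - Z \<tau> (snd z)) * (b \<tau> (fst z) (snd z) - b \<tau> (Z \<tau> (snd z)) (snd z)) * indicator B (snd z))"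
proof -
  have L0: "0 \<le> L" using order_trans[OF abs_ge_zero L[of 1 0]] by simp
  have C0: "0 \<le> C" using order_trans[OF abs_ge_zero C(1)] .
  have c\<theta>: "continuous_on UNIV \<theta>" using \<theta>(1) by (meson DERIV_continuous_on)
  have c\<theta>': "continuous_on UNIV \<theta>'"
    by (rule lipschitz_on_continuous_on[of L], rule lipschitz_onI) (use L L0 in \<open>auto simp: dist_real_def\<close>)
  have [measurable]: "\<theta> \<in> borel_measurable borel" "\<theta>' \<in> borel_measurable borel"
    using c\<theta> c\<theta>' by (auto intro: borel_measurable_continuous_onI)
  obtain BF where BF: "0 \<le> BF" "\<And>\<psi> C s. \<psi> \<in> borel_measurable borel \<Longrightarrow> (\<And>z. \<bar>\<psi> z\<bar> \<le> C) \<Longrightarrow> \<bar>flux \<psi> s\<bar> \<le> C * BF"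
    using flux_bound by blast
  \<comment> \<open>Velocity of the characteristic, cut off outside B. On B the characteristics are
    bounded by R, so \<beta> is bounded by \<open>V\<close>.\<close>
  define \<beta> where "\<beta> \<tau> x = b \<tau> (Z \<tau> x) x * indicator B x" for \<tau> x
  have \<beta>m[measurable]: "(\<lambda>(t, x). \<beta> t x) \<in> borel_measurable (borel \<Otimes>\<^sub>M borel)"
    unfolding \<beta>_def by measurable
  define V where "V = K + A * \<bar>R\<bar>"
  have V0: "0 \<le> V" using K0 A1 by (simp add: V_def)
  have \<beta>V: "\<bar>\<beta> \<tau> x\<bar> \<le> V" for \<tau> x
  proof (cases "x \<in> B")
    case True
    have "A * \<bar>Z \<tau> x\<bar> \<le> A * \<bar>R\<bar>" using Zb[OF True, of \<tau>] A1 by (intro mult_left_mono) auto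
    then show ?thesis using b_growth[of \<tau> "Z \<tau> x" x] True by (simp add: \<beta>_def V_def)
  qed (simp add: \<beta>_def V0)
  have \<beta>m1[measurable]: "(\<lambda>\<tau>. \<beta> \<tau> x) \<in> borel_measurable borel" for x
    using measurable_Pair1[OF \<beta>m, of x] by simp
  have Zdiff: "Z t x - Z s x = (LBINT \<tau>:{0..t}. \<beta> \<tau> x) - (LBINT \<tau>:{0..s}. \<beta> \<tau> x)"
    if "x \<in> B" "s \<in> {0..T}" "t \<in> {0..T}" for s t x
    using Z[OF that(1,2)] Z[OF that(1,3)] that(1) by (simp add: \<beta>_def)
  have Zlip: "\<bar>Z t x - Z s x\<bar> \<le> V * \<bar>t - s\<bar>" if "x \<in> B" "s \<in> {0..T}" "t \<in> {0..T}" for s t x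
    unfolding Zdiff[OF that] by (rule LBINT_Icc_diff[where B=V]) (use \<beta>V that in auto)
  \<comment> \<open>\<theta>' is Lipschitz but possibly not differentiable, so the quadratic
    remainder comes from the mean value theorem, with L in place of L / 2.\<close>
  have taylor: "\<bar>\<theta> p - \<theta> q - \<theta>' q * (p - q)\<bar> \<le> L * \<bar>p - q\<bar>\<^sup>2" for p q
  proof -
    have "\<exists>r. \<bar>r - q\<bar> \<le> \<bar>p - q\<bar> \<and> \<theta> p - \<theta> q = (p - q) * \<theta>' r"
    proof (cases p q rule: linorder_cases)
      case less
      from MVT2[OF this, of \<theta> \<theta>'] \<theta> obtain r where "p < r" "r < q" "\<theta> q - \<theta> p = (q - p) * \<theta>' r" by auto
      then show ?thesis by (intro exI[of _ r]) (auto simp: algebra_simps)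
    next
      case greater
      from MVT2[OF this, of \<theta> \<theta>'] \<theta> obtain r where "q < r" "r < p" "\<theta> p - \<theta> q = (p - q) * \<theta>' r" by auto
      then show ?thesis by (intro exI[of _ r]) auto
    qed auto
    then obtain r where r: "\<bar>r - q\<bar> \<le> \<bar>p - q\<bar>" "\<theta> p - \<theta> q = (p - q) * \<theta>' r" by auto
    have "\<theta> p - \<theta> q - \<theta>' q * (p - q) = (\<theta>' r - \<theta>' q) * (p - q)" by (simp add: r(2) algebra_simps)
    also have "\<bar>\<dots>\<bar> \<le> (L * \<bar>p - q\<bar>) * \<bar>p - q\<bar>"
      unfolding abs_mult by (rule mult_right_mono) (use order_trans[OF L mult_left_mono[OF r(1) L0]] in auto)
    finally show ?thesis by (simp add: power2_eq_square mult.assoc)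
  qed
  define \<phi> where "\<phi> t z = \<theta> (fst z - Z t (snd z)) * indicator B (snd z)" for t z
  define \<psi> where "\<psi> t z = \<theta>' (fst z - Z t (snd z)) * indicator B (snd z)" for t z
  have Zt[measurable]: "Z t \<in> borel_measurable borel" for t
    using measurable_Pair2[OF Zm, of t] by simp
  have \<phi>m[measurable]: "\<phi> t \<in> borel_measurable borel" for t unfolding \<phi>_def by measurable
  have \<psi>m[measurable]: "\<psi> t \<in> borel_measurable borel" for t unfolding \<psi>_def by measurable
  have \<psi>m2: "(\<lambda>(t, z). \<psi> t z) \<in> borel_measurable (borel \<Otimes>\<^sub>M borel)" unfolding \<psi>_def by measurable
  have \<phi>C: "\<bar>\<phi> t z\<bar> \<le> C" and \<psi>C: "\<bar>\<psi> t z\<bar> \<le> C" for t z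
    using C C0 by (auto simp: \<phi>_def \<psi>_def indicator_def)
  have \<psi>lip: "\<bar>\<psi> t z - \<psi> s z\<bar> \<le> L * (V * \<bar>t - s\<bar>)" if "s \<in> {0..T}" "t \<in> {0..T}" for s t z
  proof (cases "snd z \<in> B")
    case True
    have "\<bar>\<psi> t z - \<psi> s z\<bar> \<le> L * \<bar>(fst z - Z t (snd z)) - (fst z - Z s (snd z))\<bar>"
      using L[of "fst z - Z t (snd z)" "fst z - Z s (snd z)"] True by (simp add: \<psi>_def)
    also have "\<dots> \<le> L * (V * \<bar>t - s\<bar>)"
      using Zlip[OF True that] L0 by (intro mult_left_mono) (auto simp: abs_minus_commute)
    finally show ?thesis .
  qed (use L0 V0 in \<open>auto simp: \<psi>_def\<close>)
  have \<psi>\<beta>: "\<bar>\<psi> t z * \<beta> \<tau> (snd z)\<bar> \<le> C * V" for t z \<tau>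
    unfolding abs_mult by (intro mult_mono \<psi>C \<beta>V C0) auto
  have i\<psi>\<beta>: "integrable (\<sigma> s) (\<lambda>z. \<psi> t z * \<beta> \<tau> (snd z))" for s t \<tau>
    by (rule integrable_linear_growth[of _ "C * V" 0]) (use \<psi>\<beta> in auto)
  have i\<phi>: "integrable (\<sigma> s) (\<phi> t)" for s t
    by (rule integrable_linear_growth[of _ C 0]) (use \<phi>C in auto)
  define e1 where "e1 \<tau> = flux (\<psi> \<tau>) \<tau>" for \<tau>
  define e2 where "e2 \<tau> = (LINT z|\<sigma> \<tau>. \<psi> \<tau> z * \<beta> \<tau> (snd z))" for \<tau>
  define e where "e \<tau> = e1 \<tau> - e2 \<tau>" for \<tau>
  have e1m[measurable]: "e1 \<in> borel_measurable borel"
    unfolding e1_def flux_def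
    by (rule integral_kernel_measurable[OF _ \<sigma>_kernel]) (use \<psi>m2 in measurable)
  have e2m[measurable]: "e2 \<in> borel_measurable borel"
    unfolding e2_def
    by (rule integral_kernel_measurable[OF _ \<sigma>_kernel]) (use \<psi>m2 in measurable)
  have e1b: "\<bar>e1 \<tau>\<bar> \<le> C * BF" for \<tau> unfolding e1_def by (rule BF(2)) (use \<psi>C in auto)
  have intb: "\<bar>LINT z|\<sigma> s. f z\<bar> \<le> D" if [measurable]: "f \<in> borel_measurable borel" and "\<And>z. \<bar>f z\<bar> \<le> D" for f :: "real \<times> 'a \<Rightarrow> real" and D s
  proof -
    have "\<bar>LINT z|\<sigma> s. f z\<bar> \<le> (LINT z|\<sigma> s. \<bar>f z\<bar>)" by (rule integral_abs_bound)
    also have "\<dots> \<le> (LINT z|\<sigma> s. D)"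
      by (rule integral_mono) (use that in \<open>auto intro!: integrable_linear_growth[of _ D 0]\<close>)
    finally show ?thesis by simp
  qed
  have e2b: "\<bar>e2 \<tau>\<bar> \<le> C * V" for \<tau> unfolding e2_def by (rule intb) (use \<psi>\<beta> in auto)
  define G where "G t = (LINT z|\<sigma> t. \<phi> t z)" for t
  define D where "D t = G t - (LBINT \<tau>:{0..t}. e \<tau>)" for t
  \<comment> \<open>Collects the linear errors of \<open>main\<close>: L V BF from replacing \<psi>
    t by \<psi> \<tau> in the flux, and L V V twice, from comparing \<psi> s with \<psi> \<tau> and
    from the Taylor remainder.\<close>
  define c1 where "c1 = L * V * BF + 2 * (L * V * V)"
  have c10: "0 \<le> c1" using L0 V0 BF(1) by (simp add: c1_def)
  \<comment> \<open>G t - G s is split at the mixed term with measure \<sigma> s and frame Z t: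
    \<open>I\<close> moves the measure with the frame frozen at t, \<open>II\<close> moves the frame
    with the measure frozen at s, and \<open>III\<close> compares both with the integrand e at the
    running time. Only the change of \<sigma> in the frame term costs \<epsilon> rather than a
    multiple of |t - s|.\<close>
  have main: "\<bar>D t - D s\<bar> \<le> (c1 * \<bar>t - s\<bar> + L * V * \<epsilon>) * \<bar>t - s\<bar>"
    if st: "s \<in> {0..T}" "t \<in> {0..T}" and \<epsilon>: "\<And>\<tau>. \<bar>\<tau> - s\<bar> \<le> \<bar>t - s\<bar> \<Longrightarrow> L2_d2 \<mu> (\<sigma> s) (\<sigma> \<tau>) \<le> \<epsilon>" for s t \<epsilon>
  proof -
    let ?J = "\<lambda>k. (LBINT \<tau>:{0..t}. k \<tau>) - (LBINT \<tau>:{0..s}. k \<tau>)"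
    define k2 where "k2 \<tau> = (LINT z|\<sigma> s. \<psi> s z * \<beta> \<tau> (snd z))" for \<tau>
    have k2m[measurable]: "k2 \<in> borel_measurable borel" unfolding k2_def by measurable
    have k2b: "\<bar>k2 \<tau>\<bar> \<le> C * V" for \<tau> unfolding k2_def by (rule intb) (use \<psi>\<beta> in auto)
    have k1b: "\<bar>flux (\<psi> t) \<tau>\<bar> \<le> C * BF" for \<tau> by (rule BF(2)) (use \<psi>C in auto)
    have tr: "transported (\<phi> t) (\<psi> t)"
      unfolding \<phi>_def \<psi>_def by (rule transported_moving[OF \<theta> c\<theta>' C B Zt])
    have I: "(LINT z|\<sigma> t. \<phi> t z) - (LINT z|\<sigma> s. \<phi> t z) = ?J (flux (\<psi> t))"
      using tr[unfolded transported_def, rule_format, OF st(1)] tr[unfolded transported_def, rule_format, OF st(2)]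
      by linarith
    have s0: "0 \<le> s" and t0: "0 \<le> t" using st by auto
    have J2: "(LINT z|\<sigma> s. \<psi> s z * (Z t (snd z) - Z s (snd z))) = ?J k2"
      and iJ2: "integrable (\<sigma> s) (\<lambda>z. \<psi> s z * (Z t (snd z) - Z s (snd z)))"
    proof -
      have eq: "\<psi> s z * (Z t (snd z) - Z s (snd z))
         = \<psi> s z * (LBINT \<tau>:{0..t}. \<beta> \<tau> (snd z)) - \<psi> s z * (LBINT \<tau>:{0..s}. \<beta> \<tau> (snd z))" for z
      proof (cases "snd z \<in> B")
        case True
        show ?thesis unfolding Zdiff[OF True st] by (simp add: right_diff_distrib)
      qed (simp add: \<psi>_def)
      note sw = product_integral_swap[OF \<psi>m \<beta>m \<psi>\<beta>]
      show "(LINT z|\<sigma> s. \<psi> s z * (Z t (snd z) - Z s (snd z))) = ?J k2"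
        unfolding eq k2_def by (simp add: sw[OF s0] sw[OF t0])
      show "integrable (\<sigma> s) (\<lambda>z. \<psi> s z * (Z t (snd z) - Z s (snd z)))"
        unfolding eq by (intro Bochner_Integration.integrable_diff sw s0 t0)
    qed
    have II: "\<bar>(LINT z|\<sigma> s. \<phi> t z) - (LINT z|\<sigma> s. \<phi> s z) + ?J k2\<bar> \<le> L * V * V * \<bar>t - s\<bar> * \<bar>t - s\<bar>"
    proof -
      have "(LINT z|\<sigma> s. \<phi> t z) - (LINT z|\<sigma> s. \<phi> s z) + ?J k2
        = (LINT z|\<sigma> s. \<phi> t z - \<phi> s z + \<psi> s z * (Z t (snd z) - Z s (snd z)))"
        unfolding J2[symmetric] using i\<phi> iJ2 by simp
      also have "\<bar>\<dots>\<bar> \<le> L * V * V * \<bar>t - s\<bar> * \<bar>t - s\<bar>"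
      proof (rule intb)
        fix z
        show "\<bar>\<phi> t z - \<phi> s z + \<psi> s z * (Z t (snd z) - Z s (snd z))\<bar> \<le> L * V * V * \<bar>t - s\<bar> * \<bar>t - s\<bar>"
        proof (cases "snd z \<in> B")
          case True
          have "\<bar>\<phi> t z - \<phi> s z + \<psi> s z * (Z t (snd z) - Z s (snd z))\<bar> \<le> L * \<bar>Z t (snd z) - Z s (snd z)\<bar>\<^sup>2"
            using taylor[of "fst z - Z t (snd z)" "fst z - Z s (snd z)"] True
            by (simp add: \<phi>_def \<psi>_def abs_minus_commute algebra_simps)
          also have "\<dots> \<le> L * (V * \<bar>t - s\<bar>)\<^sup>2"
            using Zlip[OF True st] L0 by (intro mult_left_mono power_mono) auto
          finally show ?thesis by (simp add: power2_eq_square mult_ac)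
        qed (use L0 V0 in \<open>auto simp: \<phi>_def \<psi>_def\<close>)
      qed measurable
      finally show ?thesis .
    qed
    have III: "\<bar>?J (\<lambda>\<tau>. flux (\<psi> t) \<tau> - k2 \<tau> - e \<tau>)\<bar> \<le> (L * V * BF * \<bar>t - s\<bar> + L * V * V * \<bar>t - s\<bar> + L * V * \<epsilon>) * \<bar>t - s\<bar>"
    proof (rule LBINT_Icc_diff[where B="C * BF + C * V + C * BF + C * V"])
      show "\<bar>flux (\<psi> t) \<tau> - k2 \<tau> - e \<tau>\<bar> \<le> C * BF + C * V + C * BF + C * V" for \<tau>
        using k1b[of \<tau>] k2b[of \<tau>] e1b[of \<tau>] e2b[of \<tau>] unfolding e_def by linarith
      fix \<tau> assume \<tau>: "\<tau> \<in> {min s t..max s t}"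
      then have \<tau>T: "\<tau> \<in> {0..T}" and d: "\<bar>\<tau> - s\<bar> \<le> \<bar>t - s\<bar>" "\<bar>t - \<tau>\<bar> \<le> \<bar>t - s\<bar>" using st by (auto simp: min_def max_def split: if_splits)
      have a: "\<bar>flux (\<psi> t) \<tau> - e1 \<tau>\<bar> \<le> (L * (V * \<bar>t - s\<bar>)) * BF"
      proof -
        have "flux (\<psi> t) \<tau> - e1 \<tau> = flux (\<lambda>z. \<psi> t z - \<psi> \<tau> z) \<tau>"
          using integrable_flux[OF \<psi>m \<psi>C] by (simp add: e1_def flux_def left_diff_distrib)
        also have "\<bar>\<dots>\<bar> \<le> (L * (V * \<bar>t - s\<bar>)) * BF"
        proof (rule BF(2))
          fix z
          have "\<bar>\<psi> t z - \<psi> \<tau> z\<bar> \<le> L * (V * \<bar>t - \<tau>\<bar>)" by (rule \<psi>lip[OF \<tau>T st(2)])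
          also have "\<dots> \<le> L * (V * \<bar>t - s\<bar>)" using d L0 V0 by (intro mult_left_mono) auto
          finally show "\<bar>\<psi> t z - \<psi> \<tau> z\<bar> \<le> L * (V * \<bar>t - s\<bar>)" .
        qed measurable
        finally show ?thesis .
      qed
      have b': "\<bar>k2 \<tau> - (LINT z|\<sigma> s. \<psi> \<tau> z * \<beta> \<tau> (snd z))\<bar> \<le> (L * (V * \<bar>t - s\<bar>)) * V"
      proof -
        have "k2 \<tau> - (LINT z|\<sigma> s. \<psi> \<tau> z * \<beta> \<tau> (snd z)) = (LINT z|\<sigma> s. (\<psi> s z - \<psi> \<tau> z) * \<beta> \<tau> (snd z))"
          using i\<psi>\<beta> by (simp add: k2_def left_diff_distrib)
        also have "\<bar>\<dots>\<bar> \<le> (L * (V * \<bar>t - s\<bar>)) * V"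
        proof (rule intb)
          fix z
          have "\<bar>\<psi> s z - \<psi> \<tau> z\<bar> \<le> L * (V * \<bar>s - \<tau>\<bar>)" by (rule \<psi>lip[OF \<tau>T st(1)])
          also have "\<dots> \<le> L * (V * \<bar>t - s\<bar>)" using d L0 V0 by (intro mult_left_mono) auto
          finally show "\<bar>(\<psi> s z - \<psi> \<tau> z) * \<beta> \<tau> (snd z)\<bar> \<le> (L * (V * \<bar>t - s\<bar>)) * V"
            unfolding abs_mult by (intro mult_mono \<beta>V) (use L0 V0 in auto)
        qed measurable
        finally show ?thesis .
      qed
      have c: "\<bar>(LINT z|\<sigma> s. \<psi> \<tau> z * \<beta> \<tau> (snd z)) - e2 \<tau>\<bar> \<le> L * V * \<epsilon>"
      proof -
        have "\<bar>(LINT z|\<sigma> s. \<psi> \<tau> z * \<beta> \<tau> (snd z)) - e2 \<tau>\<bar> \<le> (L * V) * L2_d2 \<mu> (\<sigma> s) (\<sigma> \<tau>)"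
          unfolding e2_def
        proof (rule integral_Lipschitz_diff[where C="C * V"])
          fix \<xi> \<zeta> x
          have "\<bar>\<psi> \<tau> (\<xi>, x) - \<psi> \<tau> (\<zeta>, x)\<bar> \<le> L * \<bar>\<xi> - \<zeta>\<bar>"
            using L[of "\<xi> - Z \<tau> x" "\<zeta> - Z \<tau> x"] L0 by (auto simp: \<psi>_def indicator_def)
          then have "\<bar>\<psi> \<tau> (\<xi>, x) - \<psi> \<tau> (\<zeta>, x)\<bar> * \<bar>\<beta> \<tau> x\<bar> \<le> (L * \<bar>\<xi> - \<zeta>\<bar>) * V"
            by (intro mult_mono \<beta>V) (use L0 in auto)
          then show "\<bar>\<psi> \<tau> (\<xi>, x) * \<beta> \<tau> (snd (\<xi>, x)) - \<psi> \<tau> (\<zeta>, x) * \<beta> \<tau> (snd (\<zeta>, x))\<bar> \<le> (L * V) * \<bar>\<xi> - \<zeta>\<bar>"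
            unfolding abs_mult[symmetric] left_diff_distrib by (simp add: mult_ac)
          show "\<bar>\<psi> \<tau> (0, x) * \<beta> \<tau> (snd (0 :: real, x))\<bar> \<le> C * V" by (rule \<psi>\<beta>)
        qed measurable
        also have "\<dots> \<le> L * V * \<epsilon>" using \<epsilon>[OF d(1)] L0 V0 by (intro mult_left_mono) auto
        finally show ?thesis .
      qed
      show "\<bar>flux (\<psi> t) \<tau> - k2 \<tau> - e \<tau>\<bar> \<le> L * V * BF * \<bar>t - s\<bar> + L * V * V * \<bar>t - s\<bar> + L * V * \<epsilon>"
      proof -
        have eqs: "(L * (V * \<bar>t - s\<bar>)) * BF = L * V * BF * \<bar>t - s\<bar>" "(L * (V * \<bar>t - s\<bar>)) * V = L * V * V * \<bar>t - s\<bar>"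
          by (simp_all add: mult_ac)
        show ?thesis using a b' c unfolding e_def eqs by linarith
      qed
    qed (use s0 t0 in \<open>auto simp: e_def\<close>)
    have i: "set_integrable lborel {0..r} (flux (\<psi> t))" "set_integrable lborel {0..r} k2" "set_integrable lborel {0..r} e" for r
    proof -
      show "set_integrable lborel {0..r} (flux (\<psi> t))"
        by (rule set_integrable_bounded_Icc[where C="C * BF"]) (use k1b in auto)
      show "set_integrable lborel {0..r} k2"
        by (rule set_integrable_bounded_Icc[where C="C * V"]) (use k2b in auto)
      have "\<bar>e \<tau>\<bar> \<le> C * BF + C * V" for \<tau> using e1b[of \<tau>] e2b[of \<tau>] unfolding e_def by linarith
      moreover have "e \<in> borel_measurable borel" unfolding e_def by measurable
      ultimately show "set_integrable lborel {0..r} e"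
        by (intro set_integrable_bounded_Icc[where C="C * BF + C * V"])
    qed
    have "?J (\<lambda>\<tau>. flux (\<psi> t) \<tau> - k2 \<tau> - e \<tau>) = ?J (flux (\<psi> t)) - ?J k2 - ?J e"
      using i by (simp add: set_integral_diff)
    moreover have "D t - D s = ?J (flux (\<psi> t)) + ((LINT z|\<sigma> s. \<phi> t z) - (LINT z|\<sigma> s. \<phi> s z)) - ?J e"
      using I by (simp add: D_def G_def)
    ultimately have "D t - D s = ?J (\<lambda>\<tau>. flux (\<psi> t) \<tau> - k2 \<tau> - e \<tau>) + ((LINT z|\<sigma> s. \<phi> t z) - (LINT z|\<sigma> s. \<phi> s z) + ?J k2)"
      by linarith
    then have "\<bar>D t - D s\<bar> \<le> (L * V * BF * \<bar>t - s\<bar> + L * V * V * \<bar>t - s\<bar> + L * V * \<epsilon>) * \<bar>t - s\<bar> + L * V * V * \<bar>t - s\<bar> * \<bar>t - s\<bar>"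
      using II III by linarith
    also have "\<dots> = (c1 * \<bar>t - s\<bar> + L * V * \<epsilon>) * \<bar>t - s\<bar>" by (simp add: c1_def algebra_simps)
    finally show ?thesis .
  qed
  have "(D has_derivative (\<lambda>h. 0)) (at s within {0..T})" if s: "s \<in> {0..T}" for s
    unfolding has_derivative_within_alt
  proof (intro conjI allI impI)
    fix \<epsilon> :: real assume \<epsilon>: "0 < \<epsilon>"
    \<comment> \<open>Half of \<epsilon> is reserved for each of the two error terms; the summands 1
      in the denominators here and in \<delta> guard against L V = 0 and c1 = 0.\<close>
    define \<epsilon>' where "\<epsilon>' = \<epsilon> / (2 * (L * V + 1))"
    have LV: "0 \<le> L * V" using L0 V0 by simp
    have \<epsilon>': "0 < \<epsilon>'" using \<epsilon> LV by (simp add: \<epsilon>'_def)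
    have "\<forall>\<^sub>F \<tau> in at s. L2_d2 \<mu> (\<sigma> \<tau>) (\<sigma> s) < \<epsilon>'" using cont[of s] \<epsilon>' by (rule order_tendstoD)
    then obtain d where d: "d > 0" "\<And>\<tau>. \<tau> \<noteq> s \<Longrightarrow> dist \<tau> s < d \<Longrightarrow> L2_d2 \<mu> (\<sigma> \<tau>) (\<sigma> s) < \<epsilon>'"
      by (auto simp: eventually_at)
    have d2: "L2_d2 \<mu> (\<sigma> s) (\<sigma> \<tau>) \<le> \<epsilon>'" if "\<bar>\<tau> - s\<bar> < d" for \<tau>
    proof (cases "\<tau> = s")
      case True
      then show ?thesis using \<epsilon>' by (simp add: L2_d2_eq[OF P2 P2])
    next
      case False
      have "L2_d2 \<mu> (\<sigma> s) (\<sigma> \<tau>) = L2_d2 \<mu> (\<sigma> \<tau>) (\<sigma> s)" by (simp add: L2_d2_eq[OF P2 P2] power2_commute)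
      then show ?thesis using d(2)[OF False] that by (simp add: dist_real_def)
    qed
    define \<delta> where "\<delta> = min d (\<epsilon> / (2 * (c1 + 1)))"
    have \<delta>: "0 < \<delta>" using d(1) \<epsilon> c10 by (simp add: \<delta>_def)
    show "\<exists>d>0. \<forall>y\<in>{0..T}. norm (y - s) < d \<longrightarrow> norm (D y - D s - 0) \<le> \<epsilon> * norm (y - s)"
    proof (intro exI[of _ \<delta>] conjI ballI impI \<delta>)
      fix y assume y: "y \<in> {0..T}" "norm (y - s) < \<delta>"
      have "\<bar>D y - D s\<bar> \<le> (c1 * \<bar>y - s\<bar> + L * V * \<epsilon>') * \<bar>y - s\<bar>"
        by (rule main[OF s y(1)]) (use d2 y(2) in \<open>auto simp: \<delta>_def\<close>)
      also have "\<dots> \<le> \<epsilon> * \<bar>y - s\<bar>"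
      proof (rule mult_right_mono)
        have half: "p * (\<epsilon> / (2 * p)) = \<epsilon> / 2" if "0 < p" for p using that by simp
        have "c1 * \<bar>y - s\<bar> \<le> (c1 + 1) * (\<epsilon> / (2 * (c1 + 1)))"
          using y(2) c10 by (intro mult_mono) (auto simp: \<delta>_def)
        moreover have "L * V * \<epsilon>' \<le> (L * V + 1) * (\<epsilon> / (2 * (L * V + 1)))"
          unfolding \<epsilon>'_def[symmetric] using \<epsilon>' by (intro mult_right_mono) auto
        ultimately show "c1 * \<bar>y - s\<bar> + L * V * \<epsilon>' \<le> \<epsilon>" using half[of "c1 + 1"] half[of "L * V + 1"] c10 LV by linarith
      qed simp
      finally show "norm (D y - D s - 0) \<le> \<epsilon> * norm (y - s)" by simp
    qed
  qed simp
  then obtain c where "\<And>s. s \<in> {0..T} \<Longrightarrow> D s = c"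
    using has_derivative_zero_constant[OF convex_real_interval(5), of 0 T D] by blast
  then have "D t = D 0" using t T by simp
  then have "G t - G 0 = (LBINT \<tau>:{0..t}. e \<tau>)" using LBINT_Icc_singleton[of 0 e] by (simp add: D_def)
  moreover have "e \<tau> = (LINT z|\<sigma> \<tau>. \<theta>' (fst z - Z \<tau> (snd z)) * (b \<tau> (fst z) (snd z) - b \<tau> (Z \<tau> (snd z)) (snd z)) * indicator B (snd z))" for \<tau>
  proof -
    have "e \<tau> = (LINT z|\<sigma> \<tau>. \<psi> \<tau> z * b \<tau> (fst z) (snd z) - \<psi> \<tau> z * \<beta> \<tau> (snd z))"
      using integrable_flux[OF \<psi>m \<psi>C] i\<psi>\<beta> by (simp add: e_def e1_def e2_def flux_def)
    also have "\<dots> = (LINT z|\<sigma> \<tau>. \<theta>' (fst z - Z \<tau> (snd z)) * (b \<tau> (fst z) (snd z) - b \<tau> (Z \<tau> (snd z)) (snd z)) * indicator B (snd z))"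
      by (intro Bochner_Integration.integral_cong) (auto simp: \<psi>_def \<beta>_def indicator_def algebra_simps)
    finally show ?thesis .
  qed
  ultimately show ?thesis by (simp add: G_def \<phi>_def)
qed

end

lemma SIGMA_Collect_eq:
  "(SIGMA x:space M. {y. P x y}) = {z \<in> space (M \<Otimes>\<^sub>M borel). P (fst z) (snd z)}"
  by (auto simp: space_pair_measure)

context linear_equation
begin

text \<open>\<open>moving_frame\<close> is applied to steps of slope n. With w = n \<epsilon> (\<xi>
  - Z), the Lipschitz bound on b supplies a factor |\<xi> - Z| and bounds the integrand by A times
  the modulus of w times \<open>sstep' w\<close>, which is at most A and tends to 0 everywhere. The
  sign \<epsilon> treats the right and the left side together.\<close>

lemma conserved:
  fixes Z :: "real \<Rightarrow> 'a \<Rightarrow> real" and \<epsilon> :: real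
  assumes \<epsilon>: "\<bar>\<epsilon>\<bar> = 1"
    and B[measurable]: "B \<in> sets borel" and Zm[measurable]: "(\<lambda>(t, x). Z t x) \<in> borel_measurable (borel \<Otimes>\<^sub>M borel)"
    and Zb: "\<And>t x. x \<in> B \<Longrightarrow> \<bar>Z t x\<bar> \<le> R"
    and Z: "\<And>t x. x \<in> B \<Longrightarrow> t \<in> {0..T} \<Longrightarrow> Z t x = Z 0 x + (LBINT s:{0..t}. b s (Z s x) x)"
    and t: "t \<in> {0..T}"
  shows "measure (\<sigma> t) {z. 0 < \<epsilon> * (fst z - Z t (snd z)) \<and> snd z \<in> B}
    = measure (\<sigma> 0) {z. 0 < \<epsilon> * (fst z - Z 0 (snd z)) \<and> snd z \<in> B}"
proof -
  have Zt[measurable]: "Z t \<in> borel_measurable borel" for t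
    using measurable_Pair2[OF Zm, of t] by simp
  define \<theta> where "\<theta> n v = sstep (real n * (\<epsilon> * v))" for n v
  define \<theta>' where "\<theta>' n v = real n * \<epsilon> * sstep' (real n * (\<epsilon> * v))" for n v
  have d: "(\<theta> n has_real_derivative \<theta>' n y) (at y)" for n y
  proof -
    have "((\<lambda>v. real n * (\<epsilon> * v)) has_real_derivative real n * \<epsilon>) (at y)" by (auto intro!: derivative_eq_intros)
    from DERIV_chain2[OF DERIV_sstep this] show ?thesis unfolding \<theta>_def \<theta>'_def by (simp add: mult_ac)
  qed
  have abs': "\<bar>real n * \<epsilon> * s\<bar> = real n * \<bar>s\<bar>" for n s using \<epsilon> by (simp add: abs_mult)
  have c1: "\<bar>\<theta> n y\<bar> \<le> 1 + 2 * real n" for n y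
    using sstep_le_1[of "real n * (\<epsilon> * y)"] sstep_nonneg[of "real n * (\<epsilon> * y)"]
    unfolding \<theta>_def by linarith
  have c2: "\<bar>\<theta>' n y\<bar> \<le> 1 + 2 * real n" for n y
    using mult_left_mono[OF sstep'_bounds(2)[of "real n * (\<epsilon> * y)"], of "real n"]
    by (simp add: \<theta>'_def abs' sstep'_bounds(1))
  have L: "\<bar>\<theta>' n v - \<theta>' n w\<bar> \<le> (real n * (10 * real n)) * \<bar>v - w\<bar>" for n v w
  proof -
    have "\<bar>\<theta>' n v - \<theta>' n w\<bar> = real n * \<bar>sstep' (real n * (\<epsilon> * v)) - sstep' (real n * (\<epsilon> * w))\<bar>"
      unfolding \<theta>'_def by (simp add: abs' flip: right_diff_distrib)
    also have "\<dots> \<le> real n * (10 * \<bar>real n * (\<epsilon> * v) - real n * (\<epsilon> * w)\<bar>)"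
      by (intro mult_left_mono sstep'_Lipschitz) auto
    also have "\<bar>real n * (\<epsilon> * v) - real n * (\<epsilon> * w)\<bar> = real n * \<bar>v - w\<bar>"
      using \<epsilon> by (simp add: abs_mult flip: right_diff_distrib)
    finally show ?thesis by (simp add: mult_ac)
  qed
  define E where "E n \<tau> z = \<theta>' n (fst z - Z \<tau> (snd z)) * (b \<tau> (fst z) (snd z) - b \<tau> (Z \<tau> (snd z)) (snd z)) * indicator B (snd z)"
    for n \<tau> and z :: "real \<times> 'a"
  have mf: "(LINT z|\<sigma> t. \<theta> n (fst z - Z t (snd z)) * indicator B (snd z)) - (LINT z|\<sigma> 0. \<theta> n (fst z - Z 0 (snd z)) * indicator B (snd z))
      = (LBINT \<tau>:{0..t}. LINT z|\<sigma> \<tau>. E n \<tau> z)" for n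
    unfolding E_def by (rule moving_frame[OF d c1 c2 L B Zm Zb Z t])
  have [measurable]: "\<theta> n \<in> borel_measurable borel" "\<theta>' n \<in> borel_measurable borel" for n
    unfolding \<theta>_def \<theta>'_def by measurable
  have Em[measurable]: "(\<lambda>(\<tau>, z). E n \<tau> z) \<in> borel_measurable (borel \<Otimes>\<^sub>M borel)" for n
    unfolding E_def by measurable
  have Em2[measurable]: "E n \<tau> \<in> borel_measurable borel" for n \<tau>
    using measurable_Pair2[OF Em, of \<tau>] by simp
  have Em3[measurable]: "(\<lambda>\<tau>. LINT z|\<sigma> \<tau>. E n \<tau> z) \<in> borel_measurable borel" for n
    by (rule integral_kernel_measurable[OF Em \<sigma>_kernel])
  have Ele: "\<bar>E n \<tau> z\<bar> \<le> A * \<bar>real n * (\<epsilon> * (fst z - Z \<tau> (snd z))) * sstep' (real n * (\<epsilon> * (fst z - Z \<tau> (snd z))))\<bar>" for n \<tau> z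
  proof -
    let ?v = "fst z - Z \<tau> (snd z)"
    have "\<bar>E n \<tau> z\<bar> \<le> \<bar>\<theta>' n ?v\<bar> * \<bar>b \<tau> (fst z) (snd z) - b \<tau> (Z \<tau> (snd z)) (snd z)\<bar>"
      by (auto simp: E_def abs_mult indicator_def)
    also have "\<dots> \<le> \<bar>\<theta>' n ?v\<bar> * (A * \<bar>?v\<bar>)" by (intro mult_left_mono b_lip) auto
    finally show ?thesis by (simp add: \<theta>'_def abs_mult mult_ac)
  qed
  have Eb: "\<bar>E n \<tau> z\<bar> \<le> A" for n \<tau> z
    using order_trans[OF Ele mult_left_mono[OF sstep'_bounds(3)]] A1 by simp
  have E0: "(\<lambda>n. E n \<tau> z) \<longlonglongrightarrow> 0" for \<tau> z
  proof (rule Lim_null_comparison)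
    show "\<forall>\<^sub>F n in sequentially. norm (E n \<tau> z) \<le> A * \<bar>real n * (\<epsilon> * (fst z - Z \<tau> (snd z))) * sstep' (real n * (\<epsilon> * (fst z - Z \<tau> (snd z))))\<bar>"
      using Ele by simp
    show "(\<lambda>n. A * \<bar>real n * (\<epsilon> * (fst z - Z \<tau> (snd z))) * sstep' (real n * (\<epsilon> * (fst z - Z \<tau> (snd z))))\<bar>) \<longlonglongrightarrow> 0"
      using tendsto_mult[OF tendsto_const[of A] tendsto_rabs_zero[OF sstep'_scale_limit]] by simp
  qed
  have iE0: "(\<lambda>n. LINT z|\<sigma> \<tau>. E n \<tau> z) \<longlonglongrightarrow> 0" for \<tau>
  proof -
    have "(\<lambda>n. LINT z|\<sigma> \<tau>. E n \<tau> z) \<longlonglongrightarrow> (LINT z|\<sigma> \<tau>. 0)"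
      by (rule integral_dominated_convergence[where w="\<lambda>_. A"]) (use E0 Eb in auto)
    then show ?thesis by simp
  qed
  have iEb: "\<bar>LINT z|\<sigma> \<tau>. E n \<tau> z\<bar> \<le> A" for n \<tau>
  proof -
    have "\<bar>LINT z|\<sigma> \<tau>. E n \<tau> z\<bar> \<le> (LINT z|\<sigma> \<tau>. \<bar>E n \<tau> z\<bar>)" by (rule integral_abs_bound)
    also have "\<dots> \<le> (LINT z|\<sigma> \<tau>. A)"
      by (rule integral_mono) (use Eb in \<open>auto intro!: integrable_linear_growth[of _ A 0]\<close>)
    finally show ?thesis by simp
  qed
  have R0: "(\<lambda>n. LBINT \<tau>:{0..t}. LINT z|\<sigma> \<tau>. E n \<tau> z) \<longlonglongrightarrow> 0"
  proof -
    have "(\<lambda>n. LBINT \<tau>:{0..t}. LINT z|\<sigma> \<tau>. E n \<tau> z) \<longlonglongrightarrow> (LINT \<tau>::real|lborel. 0)"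
      unfolding set_lebesgue_integral_def
    proof (rule integral_dominated_convergence[where w="\<lambda>s. indicator {0..t} s *\<^sub>R A"])
      show "integrable lborel (\<lambda>s. indicator {0..t} s *\<^sub>R A)"
        using set_integrable_const_Icc by (simp add: set_integrable_def)
      show "AE \<tau> in lborel. (\<lambda>n. indicator {0..t} \<tau> *\<^sub>R (LINT z|\<sigma> \<tau>. E n \<tau> z)) \<longlonglongrightarrow> 0"
        using tendsto_scaleR[OF tendsto_const iE0] by auto
      show "AE \<tau> in lborel. norm (indicator {0..t} \<tau> *\<^sub>R (LINT z|\<sigma> \<tau>. E n \<tau> z)) \<le> indicator {0..t} \<tau> *\<^sub>R A" for n
        using iEb by (auto simp: indicator_def)
    qed measurable
    then show ?thesis by simp
  qed
  have lim: "(\<lambda>n. LINT z|\<sigma> s. \<theta> n (fst z - Z s (snd z)) * indicator B (snd z)) \<longlonglongrightarrow> measure (\<sigma> s) {z. 0 < \<epsilon> * (fst z - Z s (snd z)) \<and> snd z \<in> B}" for s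
  proof -
    let ?S = "{z :: real \<times> 'a. 0 < \<epsilon> * (fst z - Z s (snd z)) \<and> snd z \<in> B}"
    have S: "?S \<in> sets borel" by measurable
    have "(\<lambda>n. LINT z|\<sigma> s. \<theta> n (fst z - Z s (snd z)) * indicator B (snd z)) \<longlonglongrightarrow> (LINT z|\<sigma> s. indicator ?S z)"
    proof (rule integral_dominated_convergence[where w="\<lambda>_. 1"])
      show "AE z in \<sigma> s. (\<lambda>n. \<theta> n (fst z - Z s (snd z)) * indicator B (snd z)) \<longlonglongrightarrow> indicator ?S z"
      proof (rule AE_I2)
        fix z
        have "indicator {0<..} (\<epsilon> * (fst z - Z s (snd z))) * indicator B (snd z) = (indicator ?S z :: real)"
          by (auto simp: indicator_def)
        then show "(\<lambda>n. \<theta> n (fst z - Z s (snd z)) * indicator B (snd z)) \<longlonglongrightarrow> indicator ?S z"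
          using tendsto_mult[OF sstep_scale_limit[of "\<epsilon> * (fst z - Z s (snd z))"] tendsto_const[of "indicator B (snd z)"]]
          by (simp add: \<theta>_def)
      qed
    qed (use S in \<open>auto simp: \<theta>_def indicator_def\<close>)
    then show ?thesis using S by simp
  qed
  have "(\<lambda>n. LBINT \<tau>:{0..t}. LINT z|\<sigma> \<tau>. E n \<tau> z) \<longlonglongrightarrow>
     measure (\<sigma> t) {z. 0 < \<epsilon> * (fst z - Z t (snd z)) \<and> snd z \<in> B} - measure (\<sigma> 0) {z. 0 < \<epsilon> * (fst z - Z 0 (snd z)) \<and> snd z \<in> B}"
    unfolding mf[symmetric] by (intro tendsto_diff lim)
  from LIMSEQ_unique[OF this R0] show ?thesis by simp
qed

lemma emeasure_disintegration:
  fixes S :: "'a \<Rightarrow> real set"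
  assumes "{z. fst z \<in> S (snd z) \<and> snd z \<in> B} \<in> sets borel"
  shows "emeasure (\<sigma> t) {z. fst z \<in> S (snd z) \<and> snd z \<in> B} = (\<integral>\<^sup>+x\<in>B. emeasure (disintegration \<mu> (\<sigma> t) x) (S x) \<partial>\<mu>)"
proof -
  have "emeasure (\<sigma> t) {z. fst z \<in> S (snd z) \<and> snd z \<in> B}
     = (\<integral>\<^sup>+x. emeasure (disintegration \<mu> (\<sigma> t) x) {\<xi>. (\<xi>, x) \<in> {z. fst z \<in> S (snd z) \<and> snd z \<in> B}} \<partial>\<mu>)"
    using is_disintegration_disintegration[OF P2, of t] assms unfolding is_disintegration_def by blast
  also have "\<dots> = (\<integral>\<^sup>+x\<in>B. emeasure (disintegration \<mu> (\<sigma> t) x) (S x) \<partial>\<mu>)"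
    by (intro nn_integral_cong) (auto simp: indicator_def)
  finally show ?thesis .
qed

text \<open>A characteristic started at the \<open>u\<close>-quantile remains a \<open>u\<close>-quantile, since the masses on both
  sides of it are conserved.\<close>

theorem characteristic_representation:
  obtains Y :: "real \<Rightarrow> real \<times> 'a \<Rightarrow> real"
  where "(\<lambda>(t, w). Y t w) \<in> borel_measurable (borel \<Otimes>\<^sub>M (borel \<Otimes>\<^sub>M borel))"
    "\<And>t w. 0 \<le> t \<Longrightarrow> set_integrable lborel {0..t} (\<lambda>s. b s (Y s w) (snd w))"
    "\<And>t w. 0 \<le> t \<Longrightarrow> Y t w = qfun (\<sigma> 0) (fst w) (snd w) + (LBINT s:{0..t}. b s (Y s w) (snd w))"
    "\<And>t w. 0 \<le> t \<Longrightarrow> \<bar>Y t w\<bar> \<le> \<bar>qfun (\<sigma> 0) (fst w) (snd w)\<bar> + 2 * (K + A * \<bar>qfun (\<sigma> 0) (fst w) (snd w)\<bar>) * exp (2 * A * t)"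
    "\<And>t. t \<in> {0..T} \<Longrightarrow> AE x in \<mu>. disintegration \<mu> (\<sigma> t) x = distr unit_lborel borel (\<lambda>u. Y t (u, x))"
proof -
  have gm: "(\<lambda>(t, y, w). b t y (snd w)) \<in> borel_measurable (borel \<Otimes>\<^sub>M borel \<Otimes>\<^sub>M (borel \<Otimes>\<^sub>M borel :: (real \<times> 'a) measure))"
    by measurable
  have q0m: "(\<lambda>w. qfun (\<sigma> 0) (fst w) (snd w)) \<in> borel_measurable (borel \<Otimes>\<^sub>M borel)"
    using qfun_measurable[OF P2, of 0] by (simp add: split_beta')
  obtain Y :: "real \<Rightarrow> real \<times> 'a \<Rightarrow> real" where Ym: "(\<lambda>(t, w). Y t w) \<in> borel_measurable (borel \<Otimes>\<^sub>M (borel \<Otimes>\<^sub>M borel))"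
    and Yi: "\<And>t w. 0 \<le> t \<Longrightarrow> set_integrable lborel {0..t} (\<lambda>s. b s (Y s w) (snd w))"
    and YE: "\<And>t w. 0 \<le> t \<Longrightarrow> Y t w = qfun (\<sigma> 0) (fst w) (snd w) + (LBINT s:{0..t}. b s (Y s w) (snd w))"
    and Yb: "\<And>t w. 0 \<le> t \<Longrightarrow> \<bar>Y t w\<bar> \<le> \<bar>qfun (\<sigma> 0) (fst w) (snd w)\<bar> + 2 * (K + A * \<bar>qfun (\<sigma> 0) (fst w) (snd w)\<bar>) * exp (2 * A * t)"
  proof (rule caratheodory_flow[OF gm A1 b_lip b_0 q0m])
    fix Y :: "real \<Rightarrow> real \<times> 'a \<Rightarrow> real"
    assume "(\<lambda>(t, w). Y t w) \<in> borel_measurable (borel \<Otimes>\<^sub>M (borel \<Otimes>\<^sub>M borel))"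
      "\<And>t w. w \<in> space (borel \<Otimes>\<^sub>M borel) \<Longrightarrow> 0 \<le> t \<Longrightarrow> set_integrable lborel {0..t} (\<lambda>s. b s (Y s w) (snd w))"
      "\<And>t w. w \<in> space (borel \<Otimes>\<^sub>M borel) \<Longrightarrow> 0 \<le> t \<Longrightarrow> Y t w = qfun (\<sigma> 0) (fst w) (snd w) + (LBINT s:{0..t}. b s (Y s w) (snd w))"
      "\<And>t w. w \<in> space (borel \<Otimes>\<^sub>M borel) \<Longrightarrow> 0 \<le> t \<Longrightarrow> \<bar>Y t w\<bar> \<le> \<bar>qfun (\<sigma> 0) (fst w) (snd w)\<bar> + 2 * (K + A * \<bar>qfun (\<sigma> 0) (fst w) (snd w)\<bar>) * exp (2 * A * t)"
    then show thesis using that[of Y] by (simp add: space_pair_measure)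
  qed
  have Y0: "Y 0 w = qfun (\<sigma> 0) (fst w) (snd w)" for w
    using YE[of 0 w] by (simp add: LBINT_Icc_singleton[simplified])
  have Ytm: "(\<lambda>w. Y t w) \<in> borel_measurable (borel \<Otimes>\<^sub>M borel)" for t
    using measurable_Pair2[OF Ym, of t] by simp
  show thesis
  proof (rule that[OF Ym Yi YE Yb])
    fix t assume t: "t \<in> {0..T}"
    let ?\<kappa> = "\<lambda>t. disintegration \<mu> (\<sigma> t)"
    have rd: "real_distribution (?\<kappa> t x)" for t x by (rule real_distribution_disintegration[OF P2])
    have \<kappa>m: "?\<kappa> t \<in> \<mu> \<rightarrow>\<^sub>M prob_algebra borel" for t
      using is_disintegration_disintegration[OF P2] by (auto simp: is_disintegration_def)
    \<comment> \<open>The level u is fixed, so this concerns one measurable family of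
      characteristics, one for each x. \<open>conserved\<close> needs them to be uniformly bounded,
      hence the restriction to fibres whose initial quantile has modulus at most n; these exhaust
      the base.\<close>
    have side: "AE x in \<mu>. measure (?\<kappa> t x) {\<xi>. 0 < \<epsilon> * (\<xi> - Y t (u, x))} \<le> c"
      if \<epsilon>: "\<bar>\<epsilon>\<bar> = 1" and c: "\<And>x. measure (?\<kappa> 0 x) {\<xi>. 0 < \<epsilon> * (\<xi> - qfun (\<sigma> 0) u x)} \<le> c" for \<epsilon> u c
    proof -
      have c0: "0 \<le> c" by (rule order_trans[OF measure_nonneg c[of undefined]])
      define Z where "Z t x = Y (max 0 (min T t)) (u, x)" for t x
      have Zm[measurable]: "(\<lambda>(t, x). Z t x) \<in> borel_measurable (borel \<Otimes>\<^sub>M borel)"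
      proof -
        have "(\<lambda>z. (max 0 (min T (fst z)), (u, snd z))) \<in> (borel \<Otimes>\<^sub>M borel) \<rightarrow>\<^sub>M (borel \<Otimes>\<^sub>M (borel \<Otimes>\<^sub>M (borel :: 'a measure)))"
          by measurable
        from measurable_compose[OF this Ym] show ?thesis by (simp add: Z_def split_beta')
      qed
      have Zt[measurable]: "Z t \<in> borel_measurable borel" for t
        using measurable_Pair2[OF Zm, of t] by simp
      have ZY: "Z t x = Y t (u, x)" if "t \<in> {0..T}" for t x using that by (simp add: Z_def)
      have q0u[measurable]: "qfun (\<sigma> 0) u \<in> borel_measurable borel"
        using measurable_Pair2[OF qfun_measurable[OF P2, of 0], of u] by simp
      have "AE x in \<mu>. emeasure (?\<kappa> t x) {\<xi>. 0 < \<epsilon> * (\<xi> - Z t x)} * indicator {x. \<bar>qfun (\<sigma> 0) u x\<bar> \<le> real n} x \<le> ennreal c" for n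
      proof (rule AE_le_if_nn_integral_le)
        have m: "(\<lambda>x. emeasure (?\<kappa> t x) {\<xi>. 0 < \<epsilon> * (\<xi> - Z t x)}) \<in> borel_measurable \<mu>"
          by (rule emeasure_measurable_subprob_algebra2[OF _ measurable_prob_algebraD[OF \<kappa>m]], unfold SIGMA_Collect_eq, measurable)
        then show "(\<lambda>x. emeasure (?\<kappa> t x) {\<xi>. 0 < \<epsilon> * (\<xi> - Z t x)} * indicator {x. \<bar>qfun (\<sigma> 0) u x\<bar> \<le> real n} x) \<in> borel_measurable \<mu>"
          by measurable
        fix B assume "B \<in> sets \<mu>"
        then have B[measurable]: "B \<in> sets borel" by (simp add: sets_\<mu>)
        let ?B = "B \<inter> {x. \<bar>qfun (\<sigma> 0) u x\<bar> \<le> real n}"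
        have B'[measurable]: "?B \<in> sets borel" by measurable
        have cons: "measure (\<sigma> t) {z. 0 < \<epsilon> * (fst z - Z t (snd z)) \<and> snd z \<in> ?B} = measure (\<sigma> 0) {z. 0 < \<epsilon> * (fst z - Z 0 (snd z)) \<and> snd z \<in> ?B}"
        proof (rule conserved[OF \<epsilon> B' Zm _ _ t, where R="real n + 2 * (K + A * real n) * exp (2 * A * T)"])
          fix s x assume x: "x \<in> ?B"
          let ?s = "max 0 (min T s)"
          have "\<bar>Z s x\<bar> \<le> \<bar>qfun (\<sigma> 0) u x\<bar> + 2 * (K + A * \<bar>qfun (\<sigma> 0) u x\<bar>) * exp (2 * A * ?s)"
            using Yb[of ?s "(u, x)"] by (simp add: Z_def)
          also have "\<dots> \<le> real n + 2 * (K + A * real n) * exp (2 * A * T)"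
            using x A1 K0 T by (intro add_mono mult_mono) auto
          finally show "\<bar>Z s x\<bar> \<le> real n + 2 * (K + A * real n) * exp (2 * A * T)" .
        next
          fix s x assume s: "s \<in> {0..T}"
          have "(LBINT r:{0..s}. b r (Z r x) x) = (LBINT r:{0..s}. b r (Y r (u, x)) x)"
            by (rule set_lebesgue_integral_cong) (use s in \<open>auto simp: ZY\<close>)
          then show "Z s x = Z 0 x + (LBINT r:{0..s}. b r (Z r x) x)"
            using YE[of s "(u, x)"] Y0[of "(u, x)"] s T by (simp add: ZY)
        qed
        have em: "emeasure (\<sigma> s) {z. 0 < \<epsilon> * (fst z - Z s (snd z)) \<and> snd z \<in> ?B} = (\<integral>\<^sup>+x\<in>?B. emeasure (?\<kappa> s x) {\<xi>. 0 < \<epsilon> * (\<xi> - Z s x)} \<partial>\<mu>)" for s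
        proof -
          have "{z. 0 < \<epsilon> * (fst z - Z s (snd z)) \<and> snd z \<in> ?B} \<in> sets (borel :: (real \<times> 'a) measure)" by measurable
          then show ?thesis using emeasure_disintegration[of "\<lambda>x. {\<xi>. 0 < \<epsilon> * (\<xi> - Z s x)}" ?B s] by simp
        qed
        have "(\<integral>\<^sup>+x\<in>B. emeasure (?\<kappa> t x) {\<xi>. 0 < \<epsilon> * (\<xi> - Z t x)} * indicator {x. \<bar>qfun (\<sigma> 0) u x\<bar> \<le> real n} x \<partial>\<mu>)
          = (\<integral>\<^sup>+x\<in>?B. emeasure (?\<kappa> t x) {\<xi>. 0 < \<epsilon> * (\<xi> - Z t x)} \<partial>\<mu>)"
          by (intro nn_integral_cong) (auto simp: indicator_def)
        also have "\<dots> = (\<integral>\<^sup>+x\<in>?B. emeasure (?\<kappa> 0 x) {\<xi>. 0 < \<epsilon> * (\<xi> - Z 0 x)} \<partial>\<mu>)"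
          unfolding em[symmetric] S.emeasure_eq_measure cons ..
        also have "\<dots> \<le> (\<integral>\<^sup>+x\<in>B. ennreal c \<partial>\<mu>)"
        proof (rule nn_integral_mono)
          fix x
          interpret k: real_distribution "?\<kappa> 0 x" by (rule rd)
          have "emeasure (?\<kappa> 0 x) {\<xi>. 0 < \<epsilon> * (\<xi> - Z 0 x)} \<le> ennreal c"
            using c[of x] T by (simp add: k.emeasure_eq_measure ZY Y0 ennreal_leI)
          then show "emeasure (?\<kappa> 0 x) {\<xi>. 0 < \<epsilon> * (\<xi> - Z 0 x)} * indicator ?B x \<le> ennreal c * indicator B x"
            by (auto simp: indicator_def)
        qed
        finally show "(\<integral>\<^sup>+x\<in>B. emeasure (?\<kappa> t x) {\<xi>. 0 < \<epsilon> * (\<xi> - Z t x)} * indicator {x. \<bar>qfun (\<sigma> 0) u x\<bar> \<le> real n} x \<partial>\<mu>) \<le> (\<integral>\<^sup>+x\<in>B. ennreal c \<partial>\<mu>)" .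
      qed auto
      then have "AE x in \<mu>. \<forall>n. emeasure (?\<kappa> t x) {\<xi>. 0 < \<epsilon> * (\<xi> - Z t x)} * indicator {x. \<bar>qfun (\<sigma> 0) u x\<bar> \<le> real n} x \<le> ennreal c"
        by (simp add: AE_all_countable)
      then show ?thesis
      proof (rule AE_mp, intro AE_I2 impI)
        fix x assume a: "\<forall>n. emeasure (?\<kappa> t x) {\<xi>. 0 < \<epsilon> * (\<xi> - Z t x)} * indicator {x. \<bar>qfun (\<sigma> 0) u x\<bar> \<le> real n} x \<le> ennreal c"
        interpret k: real_distribution "?\<kappa> t x" by (rule rd)
        obtain n :: nat where "\<bar>qfun (\<sigma> 0) u x\<bar> \<le> real n" using real_arch_simple by blast
        then have "emeasure (?\<kappa> t x) {\<xi>. 0 < \<epsilon> * (\<xi> - Z t x)} \<le> ennreal c" using a[rule_format, of n] by simp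
        then show "measure (?\<kappa> t x) {\<xi>. 0 < \<epsilon> * (\<xi> - Y t (u, x))} \<le> c"
          using c0 t by (simp add: k.emeasure_eq_measure ZY)
      qed
    qed
    have gt: "{\<xi>. 0 < 1 * (\<xi> - y)} = {y<..}" and lt: "{\<xi>. 0 < - 1 * (\<xi> - y)} = {..<y}" for y :: real by auto
    have uAE: "AE x in \<mu>. measure (?\<kappa> t x) {Y t (u, x)<..} \<le> 1 - u \<and> measure (?\<kappa> t x) {..<Y t (u, x)} \<le> u"
      if u: "0 < u" "u < 1" for u
      using side[of 1 u "1 - u"] side[of "-1" u u] quantile_tails[OF rd u]
      unfolding gt lt qfun_def by (intro AE_conjI) auto
    have "AE u in unit_lborel. AE x in \<mu>. measure (?\<kappa> t x) {Y t (u, x)<..} \<le> 1 - u \<and> measure (?\<kappa> t x) {..<Y t (u, x)} \<le> u"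
      using AE_unit_lborel by eventually_elim (rule uAE, auto)
    moreover have "{z \<in> space P. measure (?\<kappa> t (snd z)) {Y t (fst z, snd z)<..} \<le> 1 - fst z \<and> measure (?\<kappa> t (snd z)) {..<Y t (fst z, snd z)} \<le> fst z} \<in> sets P"
    proof -
      have [measurable]: "Y t \<in> borel_measurable P"
        using Ytm[of t] by (simp add: measurable_cong_sets[OF sets_P refl])
      have k2: "(\<lambda>z. ?\<kappa> t (snd z)) \<in> P \<rightarrow>\<^sub>M prob_algebra borel"
        by (rule measurable_compose[OF measurable_snd \<kappa>m])
      have [measurable]: "(\<lambda>z. measure (?\<kappa> t (snd z)) {Y t z<..}) \<in> borel_measurable P"
        unfolding greaterThan_def
        by (rule measure_measurable_prob_algebra2[OF _ k2], unfold SIGMA_Collect_eq, measurable)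
      have [measurable]: "(\<lambda>z. measure (?\<kappa> t (snd z)) {..<Y t z}) \<in> borel_measurable P"
        unfolding lessThan_def
        by (rule measure_measurable_prob_algebra2[OF _ k2], unfold SIGMA_Collect_eq, measurable)
      show ?thesis unfolding prod.collapse by measurable
    qed
    \<comment> \<open>The exceptional set of x depends on u, whereas the law of a fibre needs almost
      every u at a fixed x. Fubini exchanges the two quantifiers, and the measurability just shown
      permits this.\<close>
    ultimately have "AE x in \<mu>. AE u in unit_lborel. measure (?\<kappa> t x) {Y t (u, x)<..} \<le> 1 - u \<and> measure (?\<kappa> t x) {..<Y t (u, x)} \<le> u"
      by (subst P.AE_commute[symmetric]) auto
    then show "AE x in \<mu>. ?\<kappa> t x = distr unit_lborel borel (\<lambda>u. Y t (u, x))"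
    proof eventually_elim
      case (elim x)
      show ?case
        by (rule law_eq_if_quantile[OF rd _ elim]) (use measurable_Pair1[OF Ytm, of x t] in simp)
    qed
  qed
qed

end

section \<open>Absolutely continuous curves\<close>

lemma L2_dist_commute: "L2_dist \<mu> f g = L2_dist \<mu> g f"
  by (simp add: L2_dist_def power2_commute)

lemma sup_dist_commute: "sup_dist f g = sup_dist g f"
  by (simp add: sup_dist_def abs_minus_commute case_prod_beta)

text \<open>Membership in \<open>Cb_offdiag\<close> supplies the boundedness without which the real
  \<open>SUP\<close> would carry no information.\<close>

lemma sup_dist_upper:
  assumes f: "f \<in> Cb_offdiag" and g: "g \<in> Cb_offdiag" and xy: "(x, y) \<in> offdiag"
  shows "\<bar>f x y - g x y\<bar> \<le> sup_dist f g"
proof -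
  obtain F where "\<forall>p\<in>offdiag. \<bar>case p of (x, y) \<Rightarrow> f x y\<bar> \<le> F"
    using f by (auto simp: Cb_offdiag_def bounded_iff)
  note F = this[rule_format]
  obtain G where "\<forall>p\<in>offdiag. \<bar>case p of (x, y) \<Rightarrow> g x y\<bar> \<le> G"
    using g by (auto simp: Cb_offdiag_def bounded_iff)
  note G = this[rule_format]
  have "bdd_above ((\<lambda>(x, y). \<bar>f x y - g x y\<bar>) ` offdiag)"
  proof (rule bdd_aboveI2)
    fix p :: "'a \<times> 'a" assume p: "p \<in> offdiag"
    obtain x y where "p = (x, y)" by (cases p)
    then show "(case p of (x, y) \<Rightarrow> \<bar>f x y - g x y\<bar>) \<le> F + G" using F[OF p] G[OF p] by simp
  qed
  from cSUP_upper[OF xy this] show ?thesis by (simp add: sup_dist_def)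
qed

text \<open>I is the primitive of the density. The definition covers only s <= t, and symmetry of
  \<delta> yields the other order; one continuous modulus thus serves both the L^2 distance and the
  sup distance.\<close>

lemma abs_cont_curve_modulus:
  assumes u: "abs_cont_curve X \<delta> T u" and sym: "\<And>f g. \<delta> f g = \<delta> g f"
  obtains I where "continuous_on {0..T} I" "\<And>s t. s \<in> {0..T} \<Longrightarrow> t \<in> {0..T} \<Longrightarrow> \<delta> (u s) (u t) \<le> \<bar>I t - I s\<bar>"
proof -
  obtain m where m: "set_integrable lborel {0..T} m"
    and le: "\<And>s t. s \<in> {0..T} \<Longrightarrow> t \<in> {s..T} \<Longrightarrow> \<delta> (u s) (u t) \<le> (LBINT \<tau>:{s..t}. m \<tau>)"
    using u unfolding abs_cont_curve_def by blast
  have mi: "m integrable_on {0..T}" using set_borel_integral_eq_integral(1)[OF m] .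
  define I where "I t = integral {0..t} m" for t
  have *: "\<delta> (u s) (u t) \<le> \<bar>I t - I s\<bar>" if st: "s \<in> {0..T}" "t \<in> {0..T}" "s \<le> t" for s t
  proof -
    have "set_integrable lborel {s..t} m"
      by (rule set_integrable_subset[OF m]) (use st in auto)
    then have "(LBINT \<tau>:{s..t}. m \<tau>) = integral {s..t} m" by (rule set_borel_integral_eq_integral(2))
    moreover have "integral {0..s} m + integral {s..t} m = integral {0..t} m"
      by (rule Henstock_Kurzweil_Integration.integral_combine)
         (use st in \<open>auto intro: integrable_on_subinterval[OF mi]\<close>)
    ultimately show ?thesis using le[of s t] st by (auto simp: I_def)
  qed
  show thesis
  proof (rule that)
    show "continuous_on {0..T} I" unfolding I_def by (rule indefinite_integral_continuous_1[OF mi])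
    fix s t assume "s \<in> {0..T}" "t \<in> {0..T}"
    then show "\<delta> (u s) (u t) \<le> \<bar>I t - I s\<bar>"
      using *[of s t] *[of t s] sym[of "u s" "u t"] by (cases "s \<le> t") (auto simp: abs_minus_commute)
  qed
qed

lemma abs_cont_curve_continuous:
  assumes u: "abs_cont_curve X \<delta> T u" and sym: "\<And>f g. \<delta> f g = \<delta> g f" and nonneg: "\<And>f g. 0 \<le> \<delta> f g"
  shows "continuous_curve X \<delta> T u"
  unfolding continuous_curve_def
proof (intro conjI ballI)
  show "u t \<in> X" if "t \<in> {0..T}" for t using u that by (simp add: abs_cont_curve_def)
  obtain I where I: "continuous_on {0..T} I" "\<And>s t. s \<in> {0..T} \<Longrightarrow> t \<in> {0..T} \<Longrightarrow> \<delta> (u s) (u t) \<le> \<bar>I t - I s\<bar>"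
    using abs_cont_curve_modulus[OF u sym] by blast
  fix t assume t: "t \<in> {0..T}"
  show "((\<lambda>s. \<delta> (u s) (u t)) \<longlongrightarrow> 0) (at t within {0..T})"
  proof (rule Lim_null_comparison)
    show "\<forall>\<^sub>F s in at t within {0..T}. norm (\<delta> (u s) (u t)) \<le> \<bar>I s - I t\<bar>"
      using I(2) t nonneg by (auto simp: eventually_at_filter abs_minus_commute)
    show "((\<lambda>s. \<bar>I s - I t\<bar>) \<longlongrightarrow> 0) (at t within {0..T})"
      using I(1) t by (intro tendsto_rabs_zero LIM_zero) (auto simp: continuous_on_def)
  qed
qed

lemma open_offdiag: "open (offdiag :: ('a::t2_space \<times> 'a) set)"
  using open_diagonal_complement[where 'a='a] by (simp add: offdiag_def split_beta')

text \<open>The modulus in time is uniform in (x, y), so it combines with the spatial continuity of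
  the single function at time t. Joint continuity provides the joint measurability of \<eta> that
  the velocity requires.\<close>

lemma sup_dist_curve_continuous:
  fixes \<eta> :: "real \<Rightarrow> 'a::metric_space \<Rightarrow> 'a \<Rightarrow> real"
  assumes \<eta>: "abs_cont_curve Cb_offdiag sup_dist T \<eta>"
  shows "continuous_on ({0..T} \<times> offdiag) (\<lambda>(t, x, y). \<eta> t x y)"
  unfolding continuous_on_def
proof
  fix p :: "real \<times> 'a \<times> 'a" assume p: "p \<in> {0..T} \<times> offdiag"
  obtain t x y where p': "p = (t, x, y)" by (cases p)
  have t: "t \<in> {0..T}" and xy: "(x, y) \<in> offdiag" using p p' by auto
  obtain I where I: "continuous_on {0..T} I" "\<And>s t. s \<in> {0..T} \<Longrightarrow> t \<in> {0..T} \<Longrightarrow> sup_dist (\<eta> s) (\<eta> t) \<le> \<bar>I t - I s\<bar>"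
    using abs_cont_curve_modulus[OF \<eta> sup_dist_commute] by blast
  have C: "\<eta> s \<in> Cb_offdiag" if "s \<in> {0..T}" for s using \<eta> that by (simp add: abs_cont_curve_def)
  let ?F = "at p within {0..T} \<times> offdiag"
  have fst: "(fst \<longlongrightarrow> t) ?F" and snd: "(snd \<longlongrightarrow> (x, y)) ?F"
    using tendsto_fst[OF tendsto_ident_at[of p]] tendsto_snd[OF tendsto_ident_at[of p]] by (simp_all add: p')
  have ev: "\<forall>\<^sub>F q in ?F. q \<in> {0..T} \<times> offdiag" by (simp add: eventually_at_filter)
  have 1: "((\<lambda>q. \<bar>I (fst q) - I t\<bar>) \<longlongrightarrow> 0) ?F"
    by (intro tendsto_rabs_zero LIM_zero continuous_on_tendsto_compose[OF I(1) fst t] eventually_mono[OF ev]) auto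
  have 2: "((\<lambda>q. (case snd q of (x, y) \<Rightarrow> \<eta> t x y)) \<longlongrightarrow> (case (x, y) of (x, y) \<Rightarrow> \<eta> t x y)) ?F"
    using C[OF t] by (intro continuous_on_tendsto_compose[OF _ snd xy] eventually_mono[OF ev]) (auto simp: Cb_offdiag_def)
  have 3: "((\<lambda>q. (case q of (t, x, y) \<Rightarrow> \<eta> t x y) - (case snd q of (x, y) \<Rightarrow> \<eta> t x y)) \<longlongrightarrow> 0) ?F"
  proof (rule Lim_null_comparison[OF _ 1], rule eventually_mono[OF ev])
    fix q :: "real \<times> 'a \<times> 'a" assume q: "q \<in> {0..T} \<times> offdiag"
    obtain s x' y' where q': "q = (s, x', y')" by (cases q)
    have "\<bar>\<eta> s x' y' - \<eta> t x' y'\<bar> \<le> sup_dist (\<eta> s) (\<eta> t)"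
      using q q' t by (intro sup_dist_upper C) auto
    also have "\<dots> \<le> \<bar>I s - I t\<bar>" using I(2)[of s t] q q' t by (auto simp: abs_minus_commute)
    finally show "norm ((case q of (t, x, y) \<Rightarrow> \<eta> t x y) - (case snd q of (x, y) \<Rightarrow> \<eta> t x y)) \<le> \<bar>I (fst q) - I t\<bar>"
      by (simp add: q')
  qed
  from tendsto_add[OF 3 2] show "((\<lambda>(t, x, y). \<eta> t x y) \<longlongrightarrow> (case p of (t, x, y) \<Rightarrow> \<eta> t x y)) ?F"
    by (simp add: p' split_beta')
qed

text \<open>Outside \<open>[0,T]\<close> time is clamped, and on the diagonal the coefficient is set to zero; since
  \<open>\<Phi> a b 0 = 0\<close>, the latter implements the integration over \<open>{x' | x' \<noteq> x}\<close>.\<close>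

definition clamp_coeff :: "real \<Rightarrow> (real \<Rightarrow> 'a \<Rightarrow> 'a \<Rightarrow> real) \<Rightarrow> real \<Rightarrow> 'a \<Rightarrow> 'a \<Rightarrow> real" where
  "clamp_coeff T f t x y = (if x = y then 0 else f (max 0 (min T t)) x y)"

lemma clamp_coeff_borel:
  fixes f :: "real \<Rightarrow> 'a::euclidean_space \<Rightarrow> 'a \<Rightarrow> real"
  assumes f: "(\<lambda>(t, x, y). f t x y) \<in> borel_measurable (restrict_space borel ({0..T} \<times> offdiag))" and T: "0 \<le> T"
  shows "(\<lambda>(t, x, y). clamp_coeff T f t x y) \<in> borel_measurable (borel \<Otimes>\<^sub>M borel \<Otimes>\<^sub>M borel)"
proof -
  have \<Omega>: "{0..T} \<times> (offdiag :: ('a \<times> 'a) set) \<in> sets borel"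
    using open_offdiag[where 'a='a] by (intro borel_Times) auto
  then have g: "(\<lambda>z. indicator ({0..T} \<times> offdiag) z *\<^sub>R (case z of (t, x, y) \<Rightarrow> f t x y)) \<in> borel_measurable borel"
    using f by (subst (asm) borel_measurable_restrict_space_iff) auto
  have c: "(\<lambda>z :: real \<times> 'a \<times> 'a. (max 0 (min T (fst z)), snd z)) \<in> borel_measurable borel"
    by (intro borel_measurable_continuous_onI continuous_intros)
  have "(\<lambda>(t, x, y). clamp_coeff T f t x y) = (\<lambda>z. indicator ({0..T} \<times> offdiag) (max 0 (min T (fst z)), snd z) *\<^sub>R
     (case (max 0 (min T (fst z)), snd z) of (t, x, y) \<Rightarrow> f t x y))"
    using T by (auto simp: clamp_coeff_def fun_eq_iff indicator_def offdiag_def)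
  then show ?thesis using measurable_compose[OF c g] by (simp add: borel_prod)
qed

lemma clamp_continuous_curve:
  fixes \<mu> :: "'a::euclidean_space measure"
  assumes \<mu>: "marginal_space \<mu>" and T: "0 < T" and \<sigma>: "continuous_curve (P2_marginal \<mu>) (L2_d2 \<mu>) T \<sigma>"
  shows "marginal_curve \<mu> T (\<lambda>t. \<sigma> (max 0 (min T t)))"
proof -
  interpret marginal_space \<mu> by (rule \<mu>)
  let ?c = "\<lambda>t. max 0 (min T t)"
  have c: "?c t \<in> {0..T}" for t using T by auto
  have P: "\<sigma> (?c t) \<in> P2_marginal \<mu>" for t using \<sigma> c by (auto simp: continuous_curve_def)
  show ?thesis
  proof unfold_locales
    fix t
    have "((\<lambda>s. L2_d2 \<mu> (\<sigma> s) (\<sigma> (?c t))) \<longlongrightarrow> 0) (at (?c t) within {0..T})"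
      using \<sigma> c[of t] unfolding continuous_curve_def by blast
    \<comment> \<open>The limit along the curve ignores the point itself, but the clamp takes the
      values 0 and T on whole half-lines. With this value the limit becomes continuity and can be
      composed with the clamp.\<close>
    moreover have "L2_d2 \<mu> (\<sigma> (?c t)) (\<sigma> (?c t)) = 0" by (simp add: L2_d2_eq P)
    ultimately have "continuous (at (?c t) within {0..T}) (\<lambda>s. L2_d2 \<mu> (\<sigma> s) (\<sigma> (?c t)))"
      by (simp only: continuous_within)
    moreover have "continuous (at t) ?c" by (intro continuous_intros)
    ultimately have "continuous (at t) (\<lambda>s. L2_d2 \<mu> (\<sigma> (?c s)) (\<sigma> (?c t)))"
      using continuous_within_compose2[of t UNIV ?c "\<lambda>s. L2_d2 \<mu> (\<sigma> s) (\<sigma> (?c t))"]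
        continuous_within_subset[of "?c t" "{0..T}" _ "range ?c"] c by blast
    then show "((\<lambda>s. L2_d2 \<mu> (\<sigma> (?c s)) (\<sigma> (?c t))) \<longlongrightarrow> 0) (at t)"
      by (simp add: continuous_within L2_d2_eq P)
  qed (use T P in auto)
qed

section \<open>Stability\<close>

text \<open>The a priori bound makes the weighted supremum S finite; the step gives S <= p + (S + q)
  / 4, that is S <= 4/3 p + q/3. Working with suprema, f need not be measurable; q is the slot for
  the nonlocal contribution.\<close>

lemma weighted_sup_Gronwall:
  fixes f :: "real \<Rightarrow> real"
  assumes T: "0 \<le> T" and bd: "\<And>t. t \<in> {0..T} \<Longrightarrow> f t \<le> R" and p: "0 \<le> p" and l: "0 \<le> l"
    and step: "\<And>t S. t \<in> {0..T} \<Longrightarrow> (\<And>s. s \<in> {0..T} \<Longrightarrow> f s \<le> S * exp (l * s)) \<Longrightarrow> f t \<le> p + (S + q) / 4 * exp (l * t)"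
    and t: "t \<in> {0..T}"
  shows "f t \<le> (4 / 3 * p + q / 3) * exp (l * t)"
proof -
  let ?g = "\<lambda>t. f t * exp (- (l * t))"
  define S where "S = (SUP t\<in>{0..T}. ?g t)"
  have bdd: "bdd_above (?g ` {0..T})"
  proof (rule bdd_aboveI2)
    fix s assume s: "s \<in> {0..T}"
    have "?g s \<le> \<bar>R\<bar> * exp (- (l * s))" using bd[OF s] by (intro mult_right_mono) auto
    also have "\<dots> \<le> \<bar>R\<bar> * 1" using s l by (intro mult_left_mono) auto
    finally show "?g s \<le> \<bar>R\<bar>" by simp
  qed
  have up: "f s \<le> S * exp (l * s)" if "s \<in> {0..T}" for s
  proof -
    have "?g s \<le> S" unfolding S_def by (rule cSUP_upper[OF that bdd])
    then have "?g s * exp (l * s) \<le> S * exp (l * s)" by (rule mult_right_mono) simp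
    then show ?thesis by (simp add: mult.assoc flip: exp_add)
  qed
  have "S \<le> p + (S + q) / 4"
    unfolding S_def
  proof (rule cSUP_least)
    fix s assume s: "s \<in> {0..T}"
    have "?g s \<le> (p + (S + q) / 4 * exp (l * s)) * exp (- (l * s))"
      using step[OF s up] by (intro mult_right_mono) auto
    also have "\<dots> = p * exp (- (l * s)) + (S + q) / 4" by (simp add: distrib_right mult.assoc flip: exp_add)
    also have "\<dots> \<le> p * 1 + (S + q) / 4" using p s l by (intro add_right_mono mult_left_mono) auto
    finally show "?g s \<le> p + ((SUP t\<in>{0..T}. ?g t) + q) / 4" by (simp add: S_def)
  qed (use T in auto)
  then have "S \<le> 4 / 3 * p + q / 3" by (simp add: field_simps)
  then show ?thesis using up[OF t] by (meson exp_ge_zero mult_right_mono order_trans)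
qed

text \<open>The coefficients are frozen: v and h stand for V and \<eta> along the given solution of
  the Euler system, so the graph equation involves \<sigma> alone. W bounds the L^2 norm of v in its
  second point, uniformly in time and in the first point.\<close>

locale flux_field = marginal_space +
  fixes T :: real and \<Phi> :: "real \<Rightarrow> real \<Rightarrow> real \<Rightarrow> real" and v h :: "real \<Rightarrow> 'a \<Rightarrow> 'a \<Rightarrow> real" and L H W :: real
  assumes T0: "0 < T"
    and \<Phi>_borel: "(\<lambda>(a, b, v). \<Phi> a b v) \<in> borel_measurable borel"
    and \<Phi>_0: "\<And>v. \<Phi> 0 0 v = 0" and L0: "0 \<le> L"
    and \<Phi>_lip: "\<And>a b c d v. \<bar>\<Phi> a b v - \<Phi> c d v\<bar> \<le> L * (\<bar>a - c\<bar> + \<bar>b - d\<bar>) * \<bar>v\<bar>"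
    and v_borel: "(\<lambda>(t, x, y). v t x y) \<in> borel_measurable (borel \<Otimes>\<^sub>M borel \<Otimes>\<^sub>M borel)"
    and h_borel: "(\<lambda>(t, x, y). h t x y) \<in> borel_measurable (borel \<Otimes>\<^sub>M borel \<Otimes>\<^sub>M borel)"
    and h_bound: "\<And>t x y. \<bar>h t x y\<bar> \<le> H" and W0: "0 \<le> W"
    and v_bound: "\<And>t x. (\<integral>\<^sup>+y. ennreal ((v t x y)\<^sup>2) \<partial>\<mu>) \<le> ennreal (W\<^sup>2)"
begin

lemma H0: "0 \<le> H" using order_trans[OF abs_ge_zero h_bound] .

lemma v_measurable [measurable (raw)]:
  assumes "f \<in> borel_measurable N" "g \<in> N \<rightarrow>\<^sub>M borel" "k \<in> N \<rightarrow>\<^sub>M borel"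
  shows "(\<lambda>z. v (f z) (g z) (k z)) \<in> borel_measurable N"
  using measurable_compose[OF measurable_Pair[OF assms(1) measurable_Pair[OF assms(2,3)]] v_borel] by simp

lemma h_measurable [measurable (raw)]:
  assumes "f \<in> borel_measurable N" "g \<in> N \<rightarrow>\<^sub>M borel" "k \<in> N \<rightarrow>\<^sub>M borel"
  shows "(\<lambda>z. h (f z) (g z) (k z)) \<in> borel_measurable N"
  using measurable_compose[OF measurable_Pair[OF assms(1) measurable_Pair[OF assms(2,3)]] h_borel] by simp

lemma \<Phi>_measurable [measurable (raw)]:
  assumes "f \<in> borel_measurable N" "g \<in> borel_measurable N" "k \<in> borel_measurable N"
  shows "(\<lambda>z. \<Phi> (f z) (g z) (k z)) \<in> borel_measurable N"
proof -
  have "(\<lambda>(a, b, v). \<Phi> a b v) \<in> borel_measurable (borel \<Otimes>\<^sub>M borel \<Otimes>\<^sub>M borel)"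
    using \<Phi>_borel by (simp add: borel_prod)
  from measurable_compose[OF measurable_Pair[OF assms(1) measurable_Pair[OF assms(2,3)]] this] show ?thesis by simp
qed

lemma \<Phi>_growth: "\<bar>\<Phi> a b c\<bar> \<le> L * (\<bar>a\<bar> + \<bar>b\<bar>) * \<bar>c\<bar>"
  using \<Phi>_lip[of a b c 0 0] \<Phi>_0[of c] by simp

definition velocity :: "(real \<Rightarrow> (real \<times> 'a) measure) \<Rightarrow> real \<Rightarrow> real \<Rightarrow> 'a \<Rightarrow> real" where
  "velocity \<sigma> t \<xi> x = - (LINT z|\<sigma> t. \<Phi> \<xi> (fst z) (v t x (snd z)) * h t x (snd z))"

lemma v_sq_integrable: "integrable \<mu> (\<lambda>y. (v t x y)\<^sup>2)" "(LINT y|\<mu>. (v t x y)\<^sup>2) \<le> W\<^sup>2"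
proof -
  have [measurable]: "(\<lambda>y. v t x y) \<in> borel_measurable \<mu>" by measurable
  show i: "integrable \<mu> (\<lambda>y. (v t x y)\<^sup>2)"
    using v_bound[of t x] by (intro integrableI_nonneg) (auto intro: le_less_trans)
  have "ennreal (LINT y|\<mu>. (v t x y)\<^sup>2) \<le> ennreal (W\<^sup>2)"
    using v_bound[of t x] nn_integral_eq_integral[OF i] by simp
  then show "(LINT y|\<mu>. (v t x y)\<^sup>2) \<le> W\<^sup>2" by (simp add: ennreal_le_iff)
qed

lemma v_snd_P: "integrable P (\<lambda>w. (v t x (snd w))\<^sup>2)" "sqrt (LINT w|P. (v t x (snd w))\<^sup>2) \<le> W"
proof -
  have d: "distr P \<mu> snd = \<mu>"
  proof (rule measure_eqI)
    fix A assume A: "A \<in> sets (distr P \<mu> snd)"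
    have "emeasure (distr P \<mu> snd) A = emeasure P (UNIV \<times> A)"
      by (subst emeasure_distr) (use A in \<open>auto simp: space_pair_measure intro!: arg_cong[where f="emeasure P"]\<close>)
    also have "\<dots> = emeasure \<mu> A"
      using A U.emeasure_space_1 by (simp add: M.emeasure_pair_measure_Times)
    finally show "emeasure (distr P \<mu> snd) A = emeasure \<mu> A" .
  qed simp
  have "integrable (distr P \<mu> snd) (\<lambda>y. (v t x y)\<^sup>2)" unfolding d by (rule v_sq_integrable)
  then show "integrable P (\<lambda>w. (v t x (snd w))\<^sup>2)" by (subst (asm) integrable_distr_eq) auto
  have "(LINT y|distr P \<mu> snd. (v t x y)\<^sup>2) \<le> W\<^sup>2" unfolding d by (rule v_sq_integrable)
  then have "(LINT w|P. (v t x (snd w))\<^sup>2) \<le> W\<^sup>2" by (subst (asm) integral_distr) auto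
  then show "sqrt (LINT w|P. (v t x (snd w))\<^sup>2) \<le> W" using W0 by (simp add: real_le_lsqrt)
qed

lemma prob_space_P: "prob_space P" by unfold_locales

text \<open>Both measures are realised on \<open>P\<close> with the same interaction partner x', so
  the Lipschitz bound of \<Phi> compares the two states of one partner. Since v is controlled only
  in L^2, their difference is handled by Cauchy-Schwarz; the \<xi> part needs only the L^1 norm of
  v, which is at most W on a probability space.\<close>

lemma velocity_difference:
  assumes s1: "\<sigma>1 t = graph_law q1" and s2: "\<sigma>2 t = graph_law q2"
    and q1: "(\<lambda>(u, x). q1 u x) \<in> borel_measurable (borel \<Otimes>\<^sub>M borel)"
    and q2: "(\<lambda>(u, x). q2 u x) \<in> borel_measurable (borel \<Otimes>\<^sub>M borel)"
    and i1: "integrable P (\<lambda>w. (q1 (fst w) (snd w))\<^sup>2)" and i2: "integrable P (\<lambda>w. (q2 (fst w) (snd w))\<^sup>2)"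
  shows "\<bar>velocity \<sigma>1 t \<xi> x - velocity \<sigma>2 t \<zeta> x\<bar>
    \<le> L * H * W * (\<bar>\<xi> - \<zeta>\<bar> + sqrt (LINT w|P. (q1 (fst w) (snd w) - q2 (fst w) (snd w))\<^sup>2))"
proof -
  define Q1 where "Q1 w = q1 (fst w) (snd w)" for w
  define Q2 where "Q2 w = q2 (fst w) (snd w)" for w
  define va where "va w = \<bar>v t x (snd w)\<bar>" for w :: "real \<times> 'a"
  have m[measurable]: "Q1 \<in> borel_measurable P" "Q2 \<in> borel_measurable P"
    unfolding Q1_def Q2_def by (rule measurable_on_P[OF q1], rule measurable_on_P[OF q2])
  have vm[measurable]: "va \<in> borel_measurable P" unfolding va_def by measurable
  have v2: "integrable P (\<lambda>w. (va w)\<^sup>2)" "sqrt (LINT w|P. (va w)\<^sup>2) \<le> W"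
    using v_snd_P[of t x] by (simp_all add: va_def)
  have v1: "integrable P va" "(LINT w|P. va w) \<le> W"
    using prob_space.integral_abs_le_sqrt[OF prob_space_P vm v2(1)] v2(2) by (auto simp: va_def[abs_def])
  define I where "I \<xi> Q w = \<Phi> \<xi> (Q w) (v t x (snd w)) * h t x (snd w)" for \<xi> Q and w :: "real \<times> 'a"
  have I: "velocity \<sigma> t \<xi> x = - (LINT w|P. I \<xi> (\<lambda>w. q (fst w) (snd w)) w)" if "\<sigma> t = graph_law q" "(\<lambda>(u, x). q u x) \<in> borel_measurable (borel \<Otimes>\<^sub>M borel)" for \<sigma> q \<xi>
    unfolding velocity_def that(1) I_def
    by (subst integral_graph_law[OF that(2)]) (auto intro!: borel_measurable_times)
  have Ii: "integrable P (I \<xi> Q)" if [measurable]: "Q \<in> borel_measurable P" and Q2: "integrable P (\<lambda>w. (Q w)\<^sup>2)" for \<xi> Q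
  proof (rule Bochner_Integration.integrable_bound)
    have "integrable P (\<lambda>w. \<bar>Q w * va w\<bar>)" by (intro integrable_abs Cauchy_Schwarz_integral(1) that v2) measurable
    then show "integrable P (\<lambda>w. L * H * (\<bar>\<xi>\<bar> * va w + \<bar>Q w * va w\<bar>))" using v1 by auto
    show "AE w in P. norm (I \<xi> Q w) \<le> norm (L * H * (\<bar>\<xi>\<bar> * va w + \<bar>Q w * va w\<bar>))"
    proof (rule AE_I2)
      fix w
      have "norm (I \<xi> Q w) \<le> (L * (\<bar>\<xi>\<bar> + \<bar>Q w\<bar>) * va w) * H"
        unfolding I_def real_norm_def abs_mult va_def
        by (intro mult_mono \<Phi>_growth h_bound) (use L0 in auto)
      also have "\<dots> = L * H * (\<bar>\<xi>\<bar> * va w + \<bar>Q w * va w\<bar>)" by (simp add: abs_mult va_def algebra_simps)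
      also have "\<dots> \<le> norm (L * H * (\<bar>\<xi>\<bar> * va w + \<bar>Q w * va w\<bar>))" by simp
      finally show "norm (I \<xi> Q w) \<le> norm (L * H * (\<bar>\<xi>\<bar> * va w + \<bar>Q w * va w\<bar>))" .
    qed
    show "I \<xi> Q \<in> borel_measurable P" unfolding I_def by measurable
  qed
  have I1: "integrable P (I \<xi> Q1)" and I2: "integrable P (I \<zeta> Q2)"
    by (rule Ii; use i1 i2 in \<open>simp add: Q1_def Q2_def\<close>)+
  have d2: "integrable P (\<lambda>w. (Q1 w - Q2 w)\<^sup>2)"
    by (intro integrable_sq_diff) (use i1 i2 in \<open>simp_all add: Q1_def[symmetric] Q2_def[symmetric]\<close>)
  have dv: "integrable P (\<lambda>w. (Q1 w - Q2 w) * va w)" "(LINT w|P. \<bar>(Q1 w - Q2 w) * va w\<bar>) \<le> sqrt (LINT w|P. (Q1 w - Q2 w)\<^sup>2) * W"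
  proof -
    show "integrable P (\<lambda>w. (Q1 w - Q2 w) * va w)" by (rule Cauchy_Schwarz_integral(1)) (use d2 v2 in auto)
    have "(LINT w|P. \<bar>(Q1 w - Q2 w) * va w\<bar>) \<le> sqrt (LINT w|P. (Q1 w - Q2 w)\<^sup>2) * sqrt (LINT w|P. (va w)\<^sup>2)"
      by (rule Cauchy_Schwarz_integral(2)) (use d2 v2 in auto)
    also have "\<dots> \<le> sqrt (LINT w|P. (Q1 w - Q2 w)\<^sup>2) * W" by (intro mult_left_mono v2) auto
    finally show "(LINT w|P. \<bar>(Q1 w - Q2 w) * va w\<bar>) \<le> sqrt (LINT w|P. (Q1 w - Q2 w)\<^sup>2) * W" .
  qed
  have "velocity \<sigma>1 t \<xi> x - velocity \<sigma>2 t \<zeta> x = (LINT w|P. I \<zeta> Q2 w) - (LINT w|P. I \<xi> Q1 w)"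
    using I[of \<sigma>1 q1 \<xi>, OF s1 q1] I[of \<sigma>2 q2 \<zeta>, OF s2 q2] by (simp add: Q1_def[abs_def] Q2_def[abs_def])
  also have "\<dots> = (LINT w|P. I \<zeta> Q2 w - I \<xi> Q1 w)" using I1 I2 by simp
  also have "\<bar>\<dots>\<bar> \<le> (LINT w|P. \<bar>I \<zeta> Q2 w - I \<xi> Q1 w\<bar>)" by (rule integral_abs_bound)
  also have "\<dots> \<le> (LINT w|P. L * H * (\<bar>\<xi> - \<zeta>\<bar> * va w + \<bar>(Q1 w - Q2 w) * va w\<bar>))"
  proof (rule integral_mono)
    show "integrable P (\<lambda>w. \<bar>I \<zeta> Q2 w - I \<xi> Q1 w\<bar>)" using I1 I2 by auto
    show "integrable P (\<lambda>w. L * H * (\<bar>\<xi> - \<zeta>\<bar> * va w + \<bar>(Q1 w - Q2 w) * va w\<bar>))"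
      using v1 integrable_abs[OF dv(1)] by auto
    fix w
    have "\<bar>I \<zeta> Q2 w - I \<xi> Q1 w\<bar> = \<bar>\<Phi> \<zeta> (Q2 w) (v t x (snd w)) - \<Phi> \<xi> (Q1 w) (v t x (snd w))\<bar> * \<bar>h t x (snd w)\<bar>"
      by (simp add: I_def abs_mult flip: left_diff_distrib)
    also have "\<dots> \<le> (L * (\<bar>\<zeta> - \<xi>\<bar> + \<bar>Q2 w - Q1 w\<bar>) * va w) * H"
      unfolding va_def by (intro mult_mono \<Phi>_lip h_bound) (use L0 in auto)
    also have "\<dots> = L * H * (\<bar>\<xi> - \<zeta>\<bar> * va w + \<bar>(Q1 w - Q2 w) * va w\<bar>)"
    proof -
      have e: "\<bar>(Q1 w - Q2 w) * va w\<bar> = \<bar>Q2 w - Q1 w\<bar> * va w"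
        by (simp add: abs_mult va_def abs_minus_commute)
      show ?thesis unfolding e abs_minus_commute[of \<xi> \<zeta>] by (simp add: algebra_simps)
    qed
    finally show "\<bar>I \<zeta> Q2 w - I \<xi> Q1 w\<bar> \<le> L * H * (\<bar>\<xi> - \<zeta>\<bar> * va w + \<bar>(Q1 w - Q2 w) * va w\<bar>)" .
  qed
  also have "\<dots> = L * H * (\<bar>\<xi> - \<zeta>\<bar> * (LINT w|P. va w) + (LINT w|P. \<bar>(Q1 w - Q2 w) * va w\<bar>))"
    using v1 integrable_abs[OF dv(1)] by simp
  also have "\<dots> \<le> L * H * (\<bar>\<xi> - \<zeta>\<bar> * W + sqrt (LINT w|P. (Q1 w - Q2 w)\<^sup>2) * W)"
    using L0 H0 v1 dv by (intro mult_left_mono add_mono) auto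
  finally show ?thesis by (simp add: Q1_def Q2_def algebra_simps)
qed

text \<open>The maximum with 1 supplies the requirement \<open>1 \<le> A\<close> of the Picard
  iteration.\<close>

definition rate :: real where "rate = max 1 (L * H * W)"

end

locale graph_solution = flux_field + marginal_curve +
  assumes weak_solution: "\<And>\<phi>. \<phi> \<in> C1c_test T \<Longrightarrow>
        (LBINT t:{0..T}. LINT (\<xi>, x)|\<sigma> t. vector_derivative (\<lambda>s. \<phi> (s, \<xi>, x)) (at t within {0..T}))
        + (LINT (\<xi>, x)|\<sigma> 0. \<phi> (0, \<xi>, x)) - (LINT (\<xi>, x)|\<sigma> T. \<phi> (T, \<xi>, x))
        = - (LBINT t:{0..T}. LINT (\<xi>, x)|\<sigma> t. deriv (\<lambda>\<zeta>. \<phi> (t, \<zeta>, x)) \<xi> * velocity \<sigma> t \<xi> x)"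
begin

lemma linear_equation_velocity: "\<exists>K\<ge>0. linear_equation \<mu> T \<sigma> (velocity \<sigma>) rate K"
proof -
  obtain M where M: "0 \<le> M" "\<And>t. (LINT z|\<sigma> t. (fst z)\<^sup>2) \<le> M\<^sup>2" using moment_bound by blast
  have M': "sqrt (LINT w|P. (Q t w)\<^sup>2) \<le> M" for t
    using M(2)[of t] M(1) by (simp add: integral_\<sigma> real_le_lsqrt)
  have gl: "\<sigma> t = graph_law (qfun (\<sigma> t))" for t by (rule graph_law_qfun[OF P2, symmetric])
  have r: "L * H * W \<le> rate" "0 \<le> L * H * W" using L0 H0 W0 by (auto simp: rate_def)
  have "linear_equation \<mu> T \<sigma> (velocity \<sigma>) rate (L * H * W * M)"
  proof unfold_locales
    show "(\<lambda>(t, \<xi>, x). velocity \<sigma> t \<xi> x) \<in> borel_measurable (borel \<Otimes>\<^sub>M borel \<Otimes>\<^sub>M borel)"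
    proof -
      have "(\<lambda>y :: real \<times> real \<times> 'a. LINT z|\<sigma> (fst y). \<Phi> (fst (snd y)) (fst z) (v (fst y) (snd (snd y)) (snd z)) * h (fst y) (snd (snd y)) (snd z))
         \<in> borel_measurable (borel \<Otimes>\<^sub>M borel \<Otimes>\<^sub>M borel)"
        by (rule integral_kernel_measurable[where N=borel]) measurable
      then show ?thesis by (simp add: velocity_def split_beta')
    qed
    show "1 \<le> rate" by (simp add: rate_def)
    fix t \<xi> \<zeta> x
    have "\<bar>velocity \<sigma> t \<xi> x - velocity \<sigma> t \<zeta> x\<bar> \<le> L * H * W * (\<bar>\<xi> - \<zeta>\<bar> + sqrt (LINT w|P. (Q t w - Q t w)\<^sup>2))"
      by (rule velocity_difference[OF gl gl]) (auto intro!: qfun_measurable integrable_qfun_sq P2)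
    also have "\<dots> \<le> rate * \<bar>\<xi> - \<zeta>\<bar>" using r by (auto intro: mult_right_mono)
    finally show "\<bar>velocity \<sigma> t \<xi> x - velocity \<sigma> t \<zeta> x\<bar> \<le> rate * \<bar>\<xi> - \<zeta>\<bar>" .
    \<comment> \<open>Reference curve concentrated at \<xi> = 0. Its velocity at 0 vanishes because
      \<Phi> 0 0 v = 0, so \<open>velocity_difference\<close> turns the second moment of \<sigma>
      into the bound at \<xi> = 0.\<close>
    define \<sigma>0 where "\<sigma>0 = (\<lambda>t::real. graph_law (\<lambda>u x. 0))"
    have z: "velocity \<sigma>0 t 0 x = 0"
      unfolding velocity_def \<sigma>0_def by (subst integral_graph_law) (auto simp: \<Phi>_0)
    have "\<bar>velocity \<sigma> t 0 x - velocity \<sigma>0 t 0 x\<bar> \<le> L * H * W * (\<bar>0 - 0\<bar> + sqrt (LINT w|P. (Q t w - 0)\<^sup>2))"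
      by (rule velocity_difference[OF gl]) (auto intro!: qfun_measurable integrable_qfun_sq P2 simp: \<sigma>0_def)
    also have "\<dots> \<le> L * H * W * M" using r M' by (auto intro: mult_left_mono)
    finally show "\<bar>velocity \<sigma> t 0 x\<bar> \<le> L * H * W * M" by (simp add: z)
  qed (rule weak_solution)
  then show ?thesis using r M(1) by (intro exI[of _ "L * H * W * M"]) auto
qed

text \<open>The affine bound by the initial quantile function has constants independent of t, u and
  x, so it will serve as a time-independent square-integrable majorant.\<close>

lemma flow_representation:
  obtains Y :: "real \<Rightarrow> real \<Rightarrow> 'a \<Rightarrow> real" and c0 c1 :: real
  where "\<And>t. (\<lambda>(u, x). Y t u x) \<in> borel_measurable (borel \<Otimes>\<^sub>M borel)"
    "\<And>t u x. 0 \<le> t \<Longrightarrow> set_integrable lborel {0..t} (\<lambda>s. velocity \<sigma> s (Y s u x) x)"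
    "\<And>t u x. 0 \<le> t \<Longrightarrow> Y t u x = Y 0 u x + (LBINT s:{0..t}. velocity \<sigma> s (Y s u x) x)"
    "Y 0 = qfun (\<sigma> 0)"
    "\<And>t u x. t \<in> {0..T} \<Longrightarrow> \<bar>Y t u x\<bar> \<le> c0 + c1 * \<bar>qfun (\<sigma> 0) u x\<bar>"
    "\<And>t. t \<in> {0..T} \<Longrightarrow> AE x in \<mu>. disintegration \<mu> (\<sigma> t) x = distr unit_lborel borel (\<lambda>u. Y t u x)"
proof -
  obtain K where K: "0 \<le> K" "linear_equation \<mu> T \<sigma> (velocity \<sigma>) rate K" using linear_equation_velocity by blast
  interpret lin: linear_equation \<mu> T \<sigma> "velocity \<sigma>" rate K by (rule K(2))
  obtain Y :: "real \<Rightarrow> real \<times> 'a \<Rightarrow> real" where Ym: "(\<lambda>(t, w). Y t w) \<in> borel_measurable (borel \<Otimes>\<^sub>M (borel \<Otimes>\<^sub>M borel))"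
    and Yi: "\<And>t w. 0 \<le> t \<Longrightarrow> set_integrable lborel {0..t} (\<lambda>s. velocity \<sigma> s (Y s w) (snd w))"
    and YE: "\<And>t w. 0 \<le> t \<Longrightarrow> Y t w = qfun (\<sigma> 0) (fst w) (snd w) + (LBINT s:{0..t}. velocity \<sigma> s (Y s w) (snd w))"
    and Yb: "\<And>t w. 0 \<le> t \<Longrightarrow> \<bar>Y t w\<bar> \<le> \<bar>qfun (\<sigma> 0) (fst w) (snd w)\<bar> + 2 * (K + rate * \<bar>qfun (\<sigma> 0) (fst w) (snd w)\<bar>) * exp (2 * rate * t)"
    and YD: "\<And>t. t \<in> {0..T} \<Longrightarrow> AE x in \<mu>. disintegration \<mu> (\<sigma> t) x = distr unit_lborel borel (\<lambda>u. Y t (u, x))"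
    using lin.characteristic_representation by blast
  have Y0: "Y 0 w = qfun (\<sigma> 0) (fst w) (snd w)" for w
    using YE[of 0 w] by (simp add: LBINT_Icc_singleton[simplified])
  have r1: "1 \<le> rate" by (simp add: rate_def)
  show thesis
  proof (rule that[of "\<lambda>t u x. Y t (u, x)" "2 * K * exp (2 * rate * T)" "1 + 2 * rate * exp (2 * rate * T)"])
    show "(\<lambda>(u, x). Y t (u, x)) \<in> borel_measurable (borel \<Otimes>\<^sub>M borel)" for t
      using measurable_Pair2[OF Ym, of t] by simp
    fix t u x assume t: "t \<in> {0..T}"
    have "\<bar>Y t (u, x)\<bar> \<le> \<bar>qfun (\<sigma> 0) u x\<bar> + 2 * (K + rate * \<bar>qfun (\<sigma> 0) u x\<bar>) * exp (2 * rate * t)"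
      using Yb[of t "(u, x)"] t by simp
    also have "\<dots> \<le> \<bar>qfun (\<sigma> 0) u x\<bar> + 2 * (K + rate * \<bar>qfun (\<sigma> 0) u x\<bar>) * exp (2 * rate * T)"
      using t r1 K(1) by (intro add_left_mono mult_left_mono) auto
    finally show "\<bar>Y t (u, x)\<bar> \<le> 2 * K * exp (2 * rate * T) + (1 + 2 * rate * exp (2 * rate * T)) * \<bar>qfun (\<sigma> 0) u x\<bar>"
      by (simp add: algebra_simps)
  next
    fix t u x assume "0 \<le> (t::real)"
    then show "set_integrable lborel {0..t} (\<lambda>s. velocity \<sigma> s (Y s (u, x)) x)"
      "Y t (u, x) = Y 0 (u, x) + (LBINT s:{0..t}. velocity \<sigma> s (Y s (u, x)) x)"
      using Yi[of t "(u, x)"] YE[of t "(u, x)"] by (simp_all add: Y0)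
  qed (use K r1 YD in \<open>auto simp: Y0\<close>)
qed

end

text \<open>The estimate works on two levels. For fixed (u, x) the other points enter only through
  the L^2 distance N of the flows, which is carried as its weighted supremum S; the resulting
  pointwise bound is then squared and integrated, which closes an inequality for S itself.\<close>

theorem (in flux_field) stability:
  assumes s1: "graph_solution \<mu> T \<Phi> v h L H W \<sigma>1" and s2: "graph_solution \<mu> T \<Phi> v h L H W \<sigma>2" and t: "t \<in> {0..T}"
  shows "L2_d2 \<mu> (\<sigma>1 t) (\<sigma>2 t) \<le> 3 * exp (4 * rate * T) * L2_d2 \<mu> (\<sigma>1 0) (\<sigma>2 0)"
proof -
  interpret s1: graph_solution \<mu> T \<Phi> v h L H W \<sigma>1 by (rule s1)
  interpret s2: graph_solution \<mu> T \<Phi> v h L H W \<sigma>2 by (rule s2)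
  obtain Y1 :: "real \<Rightarrow> real \<Rightarrow> 'a \<Rightarrow> real" and c1 d1 where
    m1: "\<And>t. (\<lambda>(u, x). Y1 t u x) \<in> borel_measurable (borel \<Otimes>\<^sub>M borel)"
    and i1: "\<And>t u x. 0 \<le> t \<Longrightarrow> set_integrable lborel {0..t} (\<lambda>s. velocity \<sigma>1 s (Y1 s u x) x)"
    and e1: "\<And>t u x. 0 \<le> t \<Longrightarrow> Y1 t u x = Y1 0 u x + (LBINT s:{0..t}. velocity \<sigma>1 s (Y1 s u x) x)"
    and z1: "Y1 0 = qfun (\<sigma>1 0)"
    and b1: "\<And>t u x. t \<in> {0..T} \<Longrightarrow> \<bar>Y1 t u x\<bar> \<le> c1 + d1 * \<bar>qfun (\<sigma>1 0) u x\<bar>"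
    and a1: "\<And>t. t \<in> {0..T} \<Longrightarrow> AE x in \<mu>. disintegration \<mu> (\<sigma>1 t) x = distr unit_lborel borel (\<lambda>u. Y1 t u x)"
    using s1.flow_representation by blast
  obtain Y2 :: "real \<Rightarrow> real \<Rightarrow> 'a \<Rightarrow> real" and c2 d2 where
    m2: "\<And>t. (\<lambda>(u, x). Y2 t u x) \<in> borel_measurable (borel \<Otimes>\<^sub>M borel)"
    and i2: "\<And>t u x. 0 \<le> t \<Longrightarrow> set_integrable lborel {0..t} (\<lambda>s. velocity \<sigma>2 s (Y2 s u x) x)"
    and e2: "\<And>t u x. 0 \<le> t \<Longrightarrow> Y2 t u x = Y2 0 u x + (LBINT s:{0..t}. velocity \<sigma>2 s (Y2 s u x) x)"
    and z2: "Y2 0 = qfun (\<sigma>2 0)"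
    and b2: "\<And>t u x. t \<in> {0..T} \<Longrightarrow> \<bar>Y2 t u x\<bar> \<le> c2 + d2 * \<bar>qfun (\<sigma>2 0) u x\<bar>"
    and a2: "\<And>t. t \<in> {0..T} \<Longrightarrow> AE x in \<mu>. disintegration \<mu> (\<sigma>2 t) x = distr unit_lborel borel (\<lambda>u. Y2 t u x)"
    using s2.flow_representation by blast
  have r1: "1 \<le> rate" and rL: "L * H * W \<le> rate" by (simp_all add: rate_def)
  have sq: "(c + d * \<bar>q\<bar>)\<^sup>2 \<le> 2 * c\<^sup>2 + 2 * d\<^sup>2 * q\<^sup>2" for c d q :: real
    using sum_squares_bound[of c "d * \<bar>q\<bar>"] by (simp add: power2_sum power_mult_distrib)
  \<comment> \<open>Majorant for the squared flows, uniform in time; through \<open>Nb\<close> it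
    makes the supremum S finite.\<close>
  define G where "G \<sigma> c d w = 2 * c\<^sup>2 + 2 * d\<^sup>2 * (qfun (\<sigma> 0) (fst w) (snd w))\<^sup>2" for \<sigma> :: "real \<Rightarrow> (real \<times> 'a) measure" and c d :: real and w
  have G1: "integrable P (G \<sigma>1 c1 d1)" and G2: "integrable P (G \<sigma>2 c2 d2)"
    unfolding G_def by (auto intro!: integrable_qfun_sq s1.P2 s2.P2)
  have Y1G: "(Y1 t (fst w) (snd w))\<^sup>2 \<le> G \<sigma>1 c1 d1 w" and Y2G: "(Y2 t (fst w) (snd w))\<^sup>2 \<le> G \<sigma>2 c2 d2 w" if "t \<in> {0..T}" for t w
    using order_trans[OF power_mono[OF b1[OF that] abs_ge_zero, where n=2] sq] order_trans[OF power_mono[OF b2[OF that] abs_ge_zero, where n=2] sq]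
    by (simp_all add: G_def)
  note mP = measurable_on_P[OF m1] measurable_on_P[OF m2]
  have sq1: "integrable P (\<lambda>w. (Y1 t (fst w) (snd w))\<^sup>2)" and sq2: "integrable P (\<lambda>w. (Y2 t (fst w) (snd w))\<^sup>2)" if "t \<in> {0..T}" for t
  proof -
    show "integrable P (\<lambda>w. (Y1 t (fst w) (snd w))\<^sup>2)"
      by (rule Bochner_Integration.integrable_bound[OF G1])
         (use mP Y1G[OF that] in \<open>auto intro!: AE_I2 intro: order_trans[OF _ abs_ge_self]\<close>)
    show "integrable P (\<lambda>w. (Y2 t (fst w) (snd w))\<^sup>2)"
      by (rule Bochner_Integration.integrable_bound[OF G2])
         (use mP Y2G[OF that] in \<open>auto intro!: AE_I2 intro: order_trans[OF _ abs_ge_self]\<close>)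
  qed
  define d where "d t w = \<bar>Y1 t (fst w) (snd w) - Y2 t (fst w) (snd w)\<bar>" for t w
  define N where "N t = sqrt (LINT w|P. (Y1 t (fst w) (snd w) - Y2 t (fst w) (snd w))\<^sup>2)" for t
  have di: "integrable P (\<lambda>w. (Y1 t (fst w) (snd w) - Y2 t (fst w) (snd w))\<^sup>2)" if "t \<in> {0..T}" for t
    by (intro integrable_sq_diff sq1 sq2 that mP)
  have N2: "(N t)\<^sup>2 = (LINT w|P. (d t w)\<^sup>2)" for t by (simp add: N_def d_def)
  have N0: "0 \<le> N t" for t by (simp add: N_def)
  have law1: "\<sigma>1 t = graph_law (Y1 t)" and law2: "\<sigma>2 t = graph_law (Y2 t)" if "t \<in> {0..T}" for t
    by (rule graph_law_eqI[OF s1.sets_\<sigma> is_disintegration_disintegration[OF s1.P2] m1 a1[OF that]],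
        rule graph_law_eqI[OF s2.sets_\<sigma> is_disintegration_disintegration[OF s2.P2] m2 a2[OF that]])
  have vel: "\<bar>velocity \<sigma>1 s \<xi> x - velocity \<sigma>2 s \<zeta> x\<bar> \<le> rate * (\<bar>\<xi> - \<zeta>\<bar> + N s)" if "s \<in> {0..T}" for s \<xi> \<zeta> x
  proof -
    have "\<bar>velocity \<sigma>1 s \<xi> x - velocity \<sigma>2 s \<zeta> x\<bar> \<le> L * H * W * (\<bar>\<xi> - \<zeta>\<bar> + N s)"
      unfolding N_def by (rule velocity_difference[OF law1 law2 m1 m2 sq1 sq2]) (use that in auto)
    also have "\<dots> \<le> rate * (\<bar>\<xi> - \<zeta>\<bar> + N s)" using rL N0 by (intro mult_right_mono) auto
    finally show ?thesis .
  qed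
  \<comment> \<open>With this exponent, rate times the integral of exp(l r) over [0,s] is at most
    exp(l s) / 4, the factor expected by \<open>weighted_sup_Gronwall\<close>.\<close>
  let ?l = "4 * rate"
  have Nb: "N s \<le> sqrt (2 * (LINT w|P. G \<sigma>1 c1 d1 w) + 2 * (LINT w|P. G \<sigma>2 c2 d2 w))" if "s \<in> {0..T}" for s
    unfolding N_def
  proof (rule real_sqrt_le_mono)
    have "(LINT w|P. (Y1 s (fst w) (snd w) - Y2 s (fst w) (snd w))\<^sup>2) \<le> (LINT w|P. 2 * G \<sigma>1 c1 d1 w + 2 * G \<sigma>2 c2 d2 w)"
    proof (rule integral_mono[OF di[OF that]])
      fix w
      have "(Y1 s (fst w) (snd w) - Y2 s (fst w) (snd w))\<^sup>2 \<le> 2 * (Y1 s (fst w) (snd w))\<^sup>2 + 2 * (Y2 s (fst w) (snd w))\<^sup>2"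
        using zero_le_power2[of "Y1 s (fst w) (snd w) + Y2 s (fst w) (snd w)"] unfolding power2_sum power2_diff by linarith
      then show "(Y1 s (fst w) (snd w) - Y2 s (fst w) (snd w))\<^sup>2 \<le> 2 * G \<sigma>1 c1 d1 w + 2 * G \<sigma>2 c2 d2 w"
        using Y1G[OF that, of w] Y2G[OF that, of w] by linarith
    qed (use G1 G2 in auto)
    then show "(LINT w|P. (Y1 s (fst w) (snd w) - Y2 s (fst w) (snd w))\<^sup>2) \<le> 2 * (LINT w|P. G \<sigma>1 c1 d1 w) + 2 * (LINT w|P. G \<sigma>2 c2 d2 w)"
      using G1 G2 by simp
  qed
  define S where "S = (SUP s\<in>{0..T}. N s * exp (- (?l * s)))"
  have bddS: "bdd_above ((\<lambda>s. N s * exp (- (?l * s))) ` {0..T})"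
  proof (rule bdd_aboveI2)
    fix s assume s: "s \<in> {0..T}"
    have "N s * exp (- (?l * s)) \<le> N s * 1" using s r1 N0 by (intro mult_left_mono) auto
    then show "N s * exp (- (?l * s)) \<le> sqrt (2 * (LINT w|P. G \<sigma>1 c1 d1 w) + 2 * (LINT w|P. G \<sigma>2 c2 d2 w))"
      using Nb[OF s] by simp
  qed
  have NS: "N s \<le> S * exp (?l * s)" if "s \<in> {0..T}" for s
  proof -
    have "N s * exp (- (?l * s)) \<le> S" unfolding S_def by (rule cSUP_upper[OF that bddS])
    then have "N s * exp (- (?l * s)) * exp (?l * s) \<le> S * exp (?l * s)" by (rule mult_right_mono) simp
    then show ?thesis by (simp add: mult.assoc flip: exp_add)
  qed
  have S0: "0 \<le> S" using NS[of 0] N0[of 0] T0 by simp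
  \<comment> \<open>The slots p and q of \<open>weighted_sup_Gronwall\<close> are filled with the
    initial distance \<open>d 0 w\<close> and with S, so the nonlocal term is a mere number
    here.\<close>
  have pw: "d s w \<le> (4 / 3 * d 0 w + S / 3) * exp (?l * s)" if s: "s \<in> {0..T}" for s w
  proof (rule weighted_sup_Gronwall[OF _ _ _ _ _ s])
    show "0 \<le> T" using T0 by simp
    show "0 \<le> d 0 w" by (simp add: d_def)
    show "0 \<le> ?l" using r1 by simp
    show "d s w \<le> c1 + d1 * \<bar>qfun (\<sigma>1 0) (fst w) (snd w)\<bar> + (c2 + d2 * \<bar>qfun (\<sigma>2 0) (fst w) (snd w)\<bar>)" if "s \<in> {0..T}" for s
      using b1[OF that, of "fst w" "snd w"] b2[OF that, of "fst w" "snd w"] unfolding d_def by linarith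
    fix s D assume s: "s \<in> {0..T}" and D: "\<And>s. s \<in> {0..T} \<Longrightarrow> d s w \<le> D * exp (?l * s)"
    have s0: "0 \<le> s" using s by simp
    have D0: "0 \<le> D" using D[of 0] T0 by (simp add: d_def)
    obtain u x where w: "w = (u, x)" by (cases w)
    have int: "set_integrable lborel {0..s} (\<lambda>r. velocity \<sigma>1 r (Y1 r u x) x - velocity \<sigma>2 r (Y2 r u x) x)"
      by (rule set_integral_diff[OF i1[OF s0] i2[OF s0]])
    have "Y1 s u x - Y2 s u x = Y1 0 u x - Y2 0 u x + (LBINT r:{0..s}. velocity \<sigma>1 r (Y1 r u x) x - velocity \<sigma>2 r (Y2 r u x) x)"
      using e1[OF s0, of u x] e2[OF s0, of u x] by (simp add: set_integral_diff(2)[OF i1[OF s0] i2[OF s0]])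
    then have "d s w \<le> d 0 w + \<bar>LBINT r:{0..s}. velocity \<sigma>1 r (Y1 r u x) x - velocity \<sigma>2 r (Y2 r u x) x\<bar>"
      unfolding d_def w by simp
    also have "\<bar>LBINT r:{0..s}. velocity \<sigma>1 r (Y1 r u x) x - velocity \<sigma>2 r (Y2 r u x) x\<bar>
       \<le> (LBINT r:{0..s}. \<bar>velocity \<sigma>1 r (Y1 r u x) x - velocity \<sigma>2 r (Y2 r u x) x\<bar>)"
      unfolding set_lebesgue_integral_def by (auto simp: abs_mult intro!: order_trans[OF integral_abs_bound])
    also have "\<dots> \<le> (LBINT r:{0..s}. rate * (D + S) * exp (?l * r))"
    proof (rule set_integral_mono)
      show "set_integrable lborel {0..s} (\<lambda>r. \<bar>velocity \<sigma>1 r (Y1 r u x) x - velocity \<sigma>2 r (Y2 r u x) x\<bar>)"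
        by (rule set_integrable_abs[OF int])
      show "set_integrable lborel {0..s} (\<lambda>r. rate * (D + S) * exp (?l * r))"
        using LBINT_exp_le(1)[of ?l s] r1 s0 by auto
      fix r assume "r \<in> {0..s}"
      then have r: "r \<in> {0..T}" using s by auto
      have "\<bar>velocity \<sigma>1 r (Y1 r u x) x - velocity \<sigma>2 r (Y2 r u x) x\<bar> \<le> rate * (d r w + N r)"
        using vel[OF r, of "Y1 r u x" x "Y2 r u x"] by (simp add: d_def w)
      also have "\<dots> \<le> rate * (D * exp (?l * r) + S * exp (?l * r))"
        using D[OF r] NS[OF r] r1 by (intro mult_left_mono add_mono) auto
      finally show "\<bar>velocity \<sigma>1 r (Y1 r u x) x - velocity \<sigma>2 r (Y2 r u x) x\<bar> \<le> rate * (D + S) * exp (?l * r)"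
        by (simp add: algebra_simps)
    qed
    also have "\<dots> = rate * (D + S) * (LBINT r:{0..s}. exp (?l * r))" by simp
    also have "\<dots> \<le> rate * (D + S) * (exp (?l * s) / ?l)"
      using LBINT_exp_le(2)[of ?l s] r1 s0 D0 S0 by (intro mult_left_mono) auto
    also have "\<dots> = (D + S) / 4 * exp (?l * s)" using r1 by (simp add: field_simps)
    finally show "d s w \<le> d 0 w + (D + S) / 4 * exp (?l * s)" by simp
  qed
  \<comment> \<open>Squaring 4/3 d + S/3, with d the initial distance, yields the factors 32/9 and
    2/9, rounded up to 4 and 1/4. The factor of S^2 has to stay below 1, so that it can be
    absorbed.\<close>
  have Nsq: "N s * exp (- (?l * s)) \<le> sqrt (4 * (N 0)\<^sup>2 + S\<^sup>2 / 4)" if s: "s \<in> {0..T}" for s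
  proof (rule real_le_rsqrt)
    have i0: "integrable P (\<lambda>w. (d 0 w)\<^sup>2)" and iS: "integrable P (\<lambda>w. (d s w)\<^sup>2)"
      using di[of 0] di[OF s] T0 by (simp_all add: d_def)
    have "(N s * exp (- (?l * s)))\<^sup>2 = (LINT w|P. (d s w)\<^sup>2 * (exp (- (?l * s)))\<^sup>2)"
      by (simp add: power_mult_distrib N2)
    also have "\<dots> \<le> (LINT w|P. 4 * (d 0 w)\<^sup>2 + S\<^sup>2 / 4)"
    proof (rule integral_mono)
      fix w
      have "d s w * exp (- (?l * s)) \<le> (4 / 3 * d 0 w + S / 3) * exp (?l * s) * exp (- (?l * s))"
        using pw[OF s, of w] by (rule mult_right_mono) simp
      also have "\<dots> = 4 / 3 * d 0 w + S / 3" by (simp add: mult.assoc flip: exp_add)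
      finally have "(d s w * exp (- (?l * s)))\<^sup>2 \<le> (4 / 3 * d 0 w + S / 3)\<^sup>2"
        by (intro power_mono) (auto simp: d_def)
      also have "\<dots> \<le> 2 * (4 / 3 * d 0 w)\<^sup>2 + 2 * (S / 3)\<^sup>2"
        using sum_squares_bound[of "4 / 3 * d 0 w" "S / 3"] unfolding power2_sum by linarith
      also have "\<dots> \<le> 4 * (d 0 w)\<^sup>2 + S\<^sup>2 / 4"
      proof -
        have "2 * (4 / 3 * d 0 w)\<^sup>2 + 2 * (S / 3)\<^sup>2 = 32 / 9 * (d 0 w)\<^sup>2 + 2 / 9 * S\<^sup>2"
          by (simp add: power_mult_distrib power_divide)
        then show ?thesis using zero_le_power2[of "d 0 w"] zero_le_power2[of S] by linarith
      qed
      finally show "(d s w)\<^sup>2 * (exp (- (?l * s)))\<^sup>2 \<le> 4 * (d 0 w)\<^sup>2 + S\<^sup>2 / 4" by (simp add: power_mult_distrib)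
    qed (use i0 iS in auto)
    also have "\<dots> = 4 * (N 0)\<^sup>2 + S\<^sup>2 / 4" using i0 by (simp add: N2 prob_space.prob_space[OF prob_space_P])
    finally show "(N s * exp (- (?l * s)))\<^sup>2 \<le> 4 * (N 0)\<^sup>2 + S\<^sup>2 / 4" .
  qed
  have "(SUP s\<in>{0..T}. N s * exp (- (?l * s))) \<le> sqrt (4 * (N 0)\<^sup>2 + S\<^sup>2 / 4)"
    by (rule cSUP_least[OF _ Nsq]) (use T0 in auto)
  then have "S \<le> sqrt (4 * (N 0)\<^sup>2 + S\<^sup>2 / 4)" by (simp only: S_def[symmetric])
  then have "S\<^sup>2 \<le> (sqrt (4 * (N 0)\<^sup>2 + S\<^sup>2 / 4))\<^sup>2" using S0 by (rule power_mono)
  then have "S\<^sup>2 \<le> 4 * (N 0)\<^sup>2 + S\<^sup>2 / 4" by simp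
  moreover have "(3 * N 0)\<^sup>2 = 9 * (N 0)\<^sup>2" by (simp add: power_mult_distrib)
  \<comment> \<open>Absorption leaves S^2 <= 16/3 (N 0)^2, rounded up to 9 (N 0)^2; this is the
    origin of the prefactor 3.\<close>
  ultimately have "S\<^sup>2 \<le> (3 * N 0)\<^sup>2" using zero_le_power2[of "N 0"] by linarith
  then have S3: "S \<le> 3 * N 0" by (rule power2_le_imp_le) (simp add: N0)
  have "L2_d2 \<mu> (\<sigma>1 t) (\<sigma>2 t) \<le> N t"
    unfolding N_def by (rule L2_d2_le[OF m1 m2 a1[OF t] a2[OF t] di[OF t]])
  also have "\<dots> \<le> S * exp (?l * t)" by (rule NS[OF t])
  also have "\<dots> \<le> (3 * N 0) * exp (?l * T)" using S3 N0[of 0] t r1 by (intro mult_mono) auto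
  also have "N 0 = L2_d2 \<mu> (\<sigma>1 0) (\<sigma>2 0)" by (simp add: N_def L2_d2_eq[OF s1.P2 s2.P2] z1 z2)
  finally show ?thesis by (simp add: mult_ac)
qed

section \<open>Freezing the coefficients along the solution of the Euler system\<close>

theorem theorem4p2:
  fixes T :: real
    and \<mu> :: "(real ^ 'd) measure"
    and \<Phi> :: "real \<Rightarrow> real \<Rightarrow> real \<Rightarrow> real"
    and V \<omega> :: "real \<Rightarrow> (real ^ 'd \<Rightarrow> real) \<Rightarrow> real ^ 'd \<Rightarrow> real ^ 'd \<Rightarrow> real"
    and r0 :: "real ^ 'd \<Rightarrow> real"
    and \<eta>0 :: "real ^ 'd \<Rightarrow> real ^ 'd \<Rightarrow> real"
    and r :: "real \<Rightarrow> real ^ 'd \<Rightarrow> real"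
    and \<eta> :: "real \<Rightarrow> real ^ 'd \<Rightarrow> real ^ 'd \<Rightarrow> real"
    and C\<^sub>V L\<^sub>V C\<^sub>\<omega> L\<^sub>\<omega> :: real
  assumes "T > 0"
    and "prob_space \<mu>" and "sets \<mu> = sets borel" and "integrable \<mu> (\<lambda>x. (norm x)\<^sup>2)"
    and "admissible_flux \<Phi>" and "jointly_antisymmetric \<Phi>"
    \<comment> \<open>the map \<omega>\<close>
    and "respects_AE \<mu> T \<omega>" and "measurable_along_curves \<mu> T \<omega>"
    and "\<And>t g. t \<in> {0..T} \<Longrightarrow> g \<in> L2 \<mu> \<Longrightarrow> continuous_on offdiag (\<lambda>(x, y). \<omega> t g x y)"
    and "\<And>t g. t \<in> {0..T} \<Longrightarrow> g \<in> L2 \<mu> \<Longrightarrow> symmetric_offdiag (\<omega> t g)"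
    and "\<And>g x y. g \<in> L2 \<mu> \<Longrightarrow> (x, y) \<in> offdiag \<Longrightarrow>
           set_integrable lborel {0..T} (\<lambda>t. \<omega> t g x y)"
    and "\<And>t g h x y. t \<in> {0..T} \<Longrightarrow> g \<in> L2 \<mu> \<Longrightarrow> h \<in> L2 \<mu> \<Longrightarrow> (x, y) \<in> offdiag \<Longrightarrow>
           \<bar>\<omega> t g x y - \<omega> t h x y\<bar> \<le> L\<^sub>\<omega> * L2_dist \<mu> g h"
    and "\<And>t g x y. t \<in> {0..T} \<Longrightarrow> g \<in> L2 \<mu> \<Longrightarrow> (x, y) \<in> offdiag \<Longrightarrow> \<bar>\<omega> t g x y\<bar> \<le> C\<^sub>\<omega>"
    \<comment> \<open>the map V\<close>
    and "respects_AE \<mu> T V" and "measurable_along_curves \<mu> T V"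
    and "\<And>t g. t \<in> {0..T} \<Longrightarrow> g \<in> L2 \<mu> \<Longrightarrow> antisymmetric_offdiag (V t g)"
    and "\<And>g x y. g \<in> L2 \<mu> \<Longrightarrow> (x, y) \<in> offdiag \<Longrightarrow> continuous_on {0..T} (\<lambda>t. V t g x y)"
    and "C\<^sub>V > 0" and "L\<^sub>V > 0"
    and "(SUP t\<in>{0..T}. SUP g\<in>L2 \<mu>. SUP x.
           \<integral>\<^sup>+x'\<in>-{x}. ennreal (\<bar>V t g x x'\<bar>\<^sup>2) \<partial>\<mu>) \<le> ennreal C\<^sub>V"
    and "\<And>t g h. t \<in> {0..T} \<Longrightarrow> g \<in> L2 \<mu> \<Longrightarrow> h \<in> L2 \<mu> \<Longrightarrow>
           (SUP x. \<integral>\<^sup>+x'\<in>-{x}. ennreal (\<bar>V t g x x' - V t h x x'\<bar>\<^sup>2) \<partial>\<mu>)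
             \<le> ennreal (L\<^sub>V * (L2_dist \<mu> g h)\<^sup>2)"
    \<comment> \<open>the solution of the Euler Co-NCL system\<close>
    and "r0 \<in> L2 \<mu>" and "\<eta>0 \<in> Cb_offdiag" and "symmetric_offdiag \<eta>0"
    and "euler_co_ncl_solution T \<mu> \<Phi> V \<omega> r0 \<eta>0 r \<eta>"
  shows "\<exists>C::real. \<forall>\<sigma>1 \<sigma>2 \<sigma>01 \<sigma>02.
           \<sigma>01 \<in> P2_marginal \<mu> \<longrightarrow> \<sigma>02 \<in> P2_marginal \<mu> \<longrightarrow>
           graph_ce_solution T \<mu> \<Phi> V r \<eta> \<sigma>01 \<sigma>1 \<longrightarrow> graph_ce_solution T \<mu> \<Phi> V r \<eta> \<sigma>02 \<sigma>2 \<longrightarrow>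
           (SUP t\<in>{0..T}. ennreal (L2_d2 \<mu> (\<sigma>1 t) (\<sigma>2 t)))
             \<le> ennreal (sqrt 2 * exp C * L2_d2 \<mu> \<sigma>01 \<sigma>02)"
proof -
  interpret marginal_space \<mu> using assms(2,3) by (rule marginal_space.intro)
  obtain L where L: "L > 0" "\<And>a b c d v. \<bar>\<Phi> a b v - \<Phi> c d v\<bar> \<le> L * (\<bar>a - c\<bar> + \<bar>b - d\<bar>) * \<bar>v\<bar>"
    and \<Phi>: "(\<lambda>(a, b, v). \<Phi> a b v) \<in> borel_measurable borel" "\<And>v. \<Phi> 0 0 v = 0" "\<And>a b. \<Phi> a b 0 = 0"
    using \<open>admissible_flux \<Phi>\<close> unfolding admissible_flux_def by blast
  have r: "abs_cont_curve (L2 \<mu>) (L2_dist \<mu>) T r" and \<eta>: "abs_cont_curve Cb_offdiag sup_dist T \<eta>"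
    using \<open>euler_co_ncl_solution T \<mu> \<Phi> V \<omega> r0 \<eta>0 r \<eta>\<close> by (auto simp: euler_co_ncl_solution_def)
  have rL2: "r t \<in> L2 \<mu>" if "t \<in> {0..T}" for t using r that by (simp add: abs_cont_curve_def)
  have rc: "continuous_curve (L2 \<mu>) (L2_dist \<mu>) T r"
    by (rule abs_cont_curve_continuous[OF r L2_dist_commute]) (simp add: L2_dist_def)
  \<comment> \<open>Only the values of V along r are kept: r is a continuous curve in L^2, so
    \<open>measurable_along_curves\<close> makes them a measurable function of (t, x, y).\<close>
  define v where "v = clamp_coeff T (\<lambda>t. V t (r t))"
  define h where "h = clamp_coeff T \<eta>"
  have vm: "(\<lambda>(t, x, y). v t x y) \<in> borel_measurable (borel \<Otimes>\<^sub>M borel \<Otimes>\<^sub>M borel)"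
    unfolding v_def
    by (rule clamp_coeff_borel) (use \<open>measurable_along_curves \<mu> T V\<close> rc \<open>T > 0\<close> in \<open>auto simp: measurable_along_curves_def\<close>)
  have hm: "(\<lambda>(t, x, y). h t x y) \<in> borel_measurable (borel \<Otimes>\<^sub>M borel \<Otimes>\<^sub>M borel)"
    unfolding h_def
    by (rule clamp_coeff_borel[OF borel_measurable_continuous_on_restrict[OF sup_dist_curve_continuous[OF \<eta>]]])
       (use \<open>T > 0\<close> in simp)
  obtain H where H: "\<And>t x y. \<bar>h t x y\<bar> \<le> H"
  proof -
    obtain I where I: "continuous_on {0..T} I" "\<And>s t. s \<in> {0..T} \<Longrightarrow> t \<in> {0..T} \<Longrightarrow> sup_dist (\<eta> s) (\<eta> t) \<le> \<bar>I t - I s\<bar>"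
      using abs_cont_curve_modulus[OF \<eta> sup_dist_commute] by blast
    have C: "\<eta> s \<in> Cb_offdiag" if "s \<in> {0..T}" for s using \<eta> that by (simp add: abs_cont_curve_def)
    obtain B where "\<forall>t\<in>{0..T}. \<bar>I t\<bar> \<le> B"
      using compact_imp_bounded[OF compact_continuous_image[OF I(1) compact_Icc]] by (auto simp: bounded_iff)
    note B = this[rule_format]
    have "bounded ((\<lambda>(x, y). \<eta> 0 x y) ` offdiag)" using C[of 0] \<open>T > 0\<close> by (simp add: Cb_offdiag_def)
    then obtain F where "\<forall>p\<in>offdiag. \<bar>case p of (x, y) \<Rightarrow> \<eta> 0 x y\<bar> \<le> F"
      by (auto simp: bounded_iff)
    note F = this[rule_format]
    \<comment> \<open>\<eta> at time 0 is bounded by F, and its sup distance to \<eta> at time t is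
      at most |I 0 - I t|, hence at most 2 B.\<close>
    have e: "\<bar>\<eta> t x y\<bar> \<le> F + 2 * B" if t: "t \<in> {0..T}" and "x \<noteq> y" for t x y
    proof -
      have xy: "(x, y) \<in> offdiag" using that by (simp add: offdiag_def)
      have 0: "0 \<in> {0..T}" using \<open>T > 0\<close> by simp
      show ?thesis
        using F[OF xy] sup_dist_upper[OF C[OF t] C[OF 0] xy] I(2)[OF t 0] B[OF t] B[OF 0] by simp
    qed
    have "\<bar>h t x y\<bar> \<le> \<bar>F + 2 * B\<bar>" for t x y
      using order_trans[OF e[of "max 0 (min T t)" x y] abs_ge_self] \<open>T > 0\<close> by (simp add: h_def clamp_coeff_def)
    then show ?thesis by (rule that)
  qed
  have vb: "(\<integral>\<^sup>+y. ennreal ((v t x y)\<^sup>2) \<partial>\<mu>) \<le> ennreal ((sqrt C\<^sub>V)\<^sup>2)" for t x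
  proof -
    let ?t = "max 0 (min T t)"
    have t: "?t \<in> {0..T}" using \<open>T > 0\<close> by auto
    have "(\<integral>\<^sup>+y. ennreal ((v t x y)\<^sup>2) \<partial>\<mu>) = (\<integral>\<^sup>+y\<in>-{x}. ennreal (\<bar>V ?t (r ?t) x y\<bar>\<^sup>2) \<partial>\<mu>)"
      by (intro nn_integral_cong) (auto simp: v_def clamp_coeff_def indicator_def)
    also have "\<dots> \<le> (SUP x. \<integral>\<^sup>+y\<in>-{x}. ennreal (\<bar>V ?t (r ?t) x y\<bar>\<^sup>2) \<partial>\<mu>)" by (rule SUP_upper) simp
    also have "\<dots> \<le> (SUP g\<in>L2 \<mu>. SUP x. \<integral>\<^sup>+y\<in>-{x}. ennreal (\<bar>V ?t g x y\<bar>\<^sup>2) \<partial>\<mu>)"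
      by (rule SUP_upper2[OF rL2[OF t] order_refl])
    also have "\<dots> \<le> (SUP t\<in>{0..T}. SUP g\<in>L2 \<mu>. SUP x. \<integral>\<^sup>+y\<in>-{x}. ennreal (\<bar>V t g x y\<bar>\<^sup>2) \<partial>\<mu>)"
      by (rule SUP_upper2[OF t order_refl])
    also have "\<dots> \<le> ennreal C\<^sub>V" by fact
    finally show ?thesis using \<open>C\<^sub>V > 0\<close> by simp
  qed
  interpret flux_field \<mu> T \<Phi> v h L H "sqrt C\<^sub>V"
    by unfold_locales (use \<open>T > 0\<close> \<Phi> L vm hm H vb \<open>C\<^sub>V > 0\<close> in auto)
  let ?c = "\<lambda>t. max 0 (min T t)"
  have sol: "graph_solution \<mu> T \<Phi> v h L H (sqrt C\<^sub>V) (\<lambda>t. \<sigma> (?c t))" if ce: "graph_ce_solution T \<mu> \<Phi> V r \<eta> \<sigma>0 \<sigma>" for \<sigma>0 \<sigma>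
  proof -
    have "continuous_curve (P2_marginal \<mu>) (L2_d2 \<mu>) T \<sigma>" and s0: "\<sigma> 0 = \<sigma>0"
      using ce by (auto simp: graph_ce_solution_def)
    then interpret cv: marginal_curve \<mu> T "\<lambda>t. \<sigma> (?c t)"
      by (intro clamp_continuous_curve marginal_space_axioms \<open>T > 0\<close>)
    \<comment> \<open>d stands for the \<xi>-derivative of the test function, which is constant in
      the inner integral. The minus sign is the one built into \<open>velocity\<close> and accounts
      for the sign on the right of \<open>weak_solution\<close>.\<close>
    have inner: "set_lebesgue_integral (\<sigma> t) (UNIV \<times> -{x}) (\<lambda>(\<xi>', x'). d * \<Phi> \<xi> \<xi>' (V t (r t) x x') * \<eta> t x x')
        = - (d * velocity (\<lambda>t. \<sigma> (?c t)) t \<xi> x)" if t: "t \<in> {0..T}" for t \<xi> x d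
    proof -
      have "set_lebesgue_integral (\<sigma> t) (UNIV \<times> -{x}) (\<lambda>(\<xi>', x'). d * \<Phi> \<xi> \<xi>' (V t (r t) x x') * \<eta> t x x')
        = (LINT z|\<sigma> t. d * (\<Phi> \<xi> (fst z) (v t x (snd z)) * h t x (snd z)))"
        unfolding set_lebesgue_integral_def
        by (intro Bochner_Integration.integral_cong)
           (use t in \<open>auto simp: v_def h_def clamp_coeff_def indicator_def \<Phi>(3)\<close>)
      then show ?thesis using t by (simp add: velocity_def)
    qed
    show ?thesis
    proof unfold_locales
      fix \<phi> :: "real \<times> real \<times> (real ^ 'd) \<Rightarrow> real" assume \<phi>: "\<phi> \<in> C1c_test T"
      have ends: "?c 0 = 0" "?c T = T" using \<open>T > 0\<close> by auto
      let ?D = "\<lambda>t \<xi> x. vector_derivative (\<lambda>s. \<phi> (s, \<xi>, x)) (at t within {0..T})"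
      have "(LBINT t:{0..T}. LINT (\<xi>, x)|\<sigma> t. ?D t \<xi> x) + (LINT (\<xi>, x)|\<sigma> 0. \<phi> (0, \<xi>, x)) - (LINT (\<xi>, x)|\<sigma> T. \<phi> (T, \<xi>, x))
        = (LBINT t:{0..T}. LINT (\<xi>, x)|\<sigma> t.
             set_lebesgue_integral (\<sigma> t) (UNIV \<times> -{x}) (\<lambda>(\<xi>', x').
               deriv (\<lambda>\<zeta>. \<phi> (t, \<zeta>, x)) \<xi> * \<Phi> \<xi> \<xi>' (V t (r t) x x') * \<eta> t x x'))"
        using ce \<phi> s0 by (auto simp: graph_ce_solution_def)
      also have "\<dots> = (LBINT t:{0..T}. - (LINT (\<xi>, x)|\<sigma> (?c t). deriv (\<lambda>\<zeta>. \<phi> (t, \<zeta>, x)) \<xi> * velocity (\<lambda>t. \<sigma> (?c t)) t \<xi> x))"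
      proof (rule set_lebesgue_integral_cong, simp, intro allI impI)
        fix t assume t: "t \<in> {0..T}"
        show "(LINT (\<xi>, x)|\<sigma> t. set_lebesgue_integral (\<sigma> t) (UNIV \<times> -{x}) (\<lambda>(\<xi>', x').
               deriv (\<lambda>\<zeta>. \<phi> (t, \<zeta>, x)) \<xi> * \<Phi> \<xi> \<xi>' (V t (r t) x x') * \<eta> t x x'))
          = - (LINT (\<xi>, x)|\<sigma> (?c t). deriv (\<lambda>\<zeta>. \<phi> (t, \<zeta>, x)) \<xi> * velocity (\<lambda>t. \<sigma> (?c t)) t \<xi> x)"
          unfolding inner[OF t] using t by (simp add: split_beta')
      qed
      also have "\<dots> = - (LBINT t:{0..T}. LINT (\<xi>, x)|\<sigma> (?c t). deriv (\<lambda>\<zeta>. \<phi> (t, \<zeta>, x)) \<xi> * velocity (\<lambda>t. \<sigma> (?c t)) t \<xi> x)"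
        by (simp add: set_lebesgue_integral_def)
      also have "(LBINT t:{0..T}. LINT (\<xi>, x)|\<sigma> t. ?D t \<xi> x) = (LBINT t:{0..T}. LINT (\<xi>, x)|\<sigma> (?c t). ?D t \<xi> x)"
        by (rule set_lebesgue_integral_cong) auto
      finally show "(LBINT t:{0..T}. LINT (\<xi>, x)|\<sigma> (?c t). ?D t \<xi> x) + (LINT (\<xi>, x)|\<sigma> (?c 0). \<phi> (0, \<xi>, x)) - (LINT (\<xi>, x)|\<sigma> (?c T). \<phi> (T, \<xi>, x))
        = - (LBINT t:{0..T}. LINT (\<xi>, x)|\<sigma> (?c t). deriv (\<lambda>\<zeta>. \<phi> (t, \<zeta>, x)) \<xi> * velocity (\<lambda>t. \<sigma> (?c t)) t \<xi> x)"
        unfolding ends .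
    qed
  qed
  show ?thesis
  \<comment> \<open>The exponential of this number is exp(4 rate T) times 3 / sqrt 2, so
    multiplication by sqrt 2 returns the prefactor 3. Besides T it depends, through
    \<open>rate\<close>, only on L, H and \<open>C\<^sub>V\<close>, and so not on the two
    solutions.\<close>
  proof (intro exI[of _ "ln (3 / sqrt 2) + 4 * rate * T"] allI impI SUP_least ennreal_leI)
    fix \<sigma>1 \<sigma>2 :: "real \<Rightarrow> (real \<times> (real ^ 'd)) measure" and \<sigma>01 \<sigma>02 t
    assume s: "graph_ce_solution T \<mu> \<Phi> V r \<eta> \<sigma>01 \<sigma>1" "graph_ce_solution T \<mu> \<Phi> V r \<eta> \<sigma>02 \<sigma>2" and t: "t \<in> {0..T}"
    have "L2_d2 \<mu> (\<sigma>1 t) (\<sigma>2 t) \<le> 3 * exp (4 * rate * T) * L2_d2 \<mu> (\<sigma>1 0) (\<sigma>2 0)"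
      using stability[OF sol[OF s(1)] sol[OF s(2)] t] t \<open>T > 0\<close> by simp
    also have "3 * exp (4 * rate * T) = sqrt 2 * exp (ln (3 / sqrt 2) + 4 * rate * T)"
      by (simp add: exp_add)
    finally show "L2_d2 \<mu> (\<sigma>1 t) (\<sigma>2 t) \<le> sqrt 2 * exp (ln (3 / sqrt 2) + 4 * rate * T) * L2_d2 \<mu> \<sigma>01 \<sigma>02"
      using s by (simp add: graph_ce_solution_def)
  qed
qed

end
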